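(* Let $N\ge 1$ be an integer, $\alpha\in(0,N)$, $p,q>0$, $m>s>1$, $s<N$, $q\ge\alpha-1$ and $\min\{p,q\}>m-1$. Then the following statements are equivalent (statement (ii) being considered when $m\ge2$): (i) The equation $-\Delta_m u-\Delta_s u=(|x|^{-\alpha}*u^p)u^q$ in $\mathbb R^N\setminus\overline B_1$ has a positive $C^1$-solution. (ii) The equation $-H_m u-\Delta_s u=(|x|^{-\alpha}*u^p)u^q$ in $\mathbb R^N\setminus\overline B_1$, where $m\ge 2$ and $H_m u=\operatorname{div}\Big(\frac{|\nabla u|^{m-2}}{\sqrt{1+|\nabla u|^m}}\nabla u\Big)$, has a positive $C^1$-solution. (iii) The exponents $p$ and $q$ satisfy $$ \min\{p,q\}>\frac{(s-1)(N-\alpha)}{N-s}\qquad\text{and}\qquad p+q>\frac{(s-1)(2N-\alpha)}{N-s}. $$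
   Context: $B_R$ is the open ball of radius $R$ centred at the origin in $\mathbb R^N$. For $r>1$, $\Delta_r u=\operatorname{div}(|\nabla u|^{r-2}\nabla u)$. The convolution is taken over $\mathbb R^N\setminus B_1$: $(|x|^{-\alpha}*u^p)(x)=\int_{\mathbb R^N\setminus B_1}\frac{u^p(y)}{|x-y|^{\alpha}}\,dy$ for $x\in\mathbb R^N\setminus\overline B_1$. Both equations have the form $-\operatorname{div}\big(|\nabla u|^{m-2}g(|\nabla u|)\nabla u\big)-\Delta_s u=(|x|^{-\alpha}*u^p)u^q$, with $g\equiv1$ in (i) and $g(t)=(1+t^m)^{-1/2}$ in (ii). A positive $C^1$-solution is a function $u\in C^1(\mathbb R^N\setminus\overline B_1)$ with $u>0$, with $\int_{\mathbb R^N\setminus B_1}\frac{u^p(y)}{1+|y|^\alpha}\,dy<\infty$, and such that for every $\phi\in C_c^\infty(\mathbb R^N\setminus\overline B_1)$, $$ \int_{\mathbb R^N\setminus B_1}\Big(|\nabla u|^{m-2}g(|\nabla u|)+|\nabla u|^{s-2}\Big)\nabla u\cdot\nabla\phi\,dx=\int_{\mathbb R^N\setminus B_1}(|x|^{-\alpha}*u^p)u^q\phi\,dx . $$ *)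

theory Defs
  imports "HOL-Analysis.Analysis"
begin

definition grad :: "('a::euclidean_space \<Rightarrow> real) \<Rightarrow> 'a \<Rightarrow> 'a" where
  "grad f x = (THE D. GDERIV f x :> D)"

lemma grad_eqI:
  assumes "GDERIV f x :> D"
  shows "grad f x = D"
  unfolding grad_def
proof (rule the_equality)
  show "GDERIV f x :> D" by (fact assms)
next
  fix D' assume "GDERIV f x :> D'"
  then have "(\<lambda>h. inner h D') = (\<lambda>h. inner h D)"
    using assms unfolding gderiv_def by (rule has_derivative_unique)
  then show "D' = D"
    by (metis euclidean_eqI inner_commute)
qed

text \<open>\<open>Ck_on k S f\<close> is the class \<open>C\<^sup>k\<close> on an open set \<open>S\<close>: all partial derivatives up to order \<open>k\<close>
  exist and are continuous. The values of \<open>f\<close> outside \<open>S\<close> play no role.\<close>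

primrec Ck_on :: "nat \<Rightarrow> 'a::euclidean_space set \<Rightarrow> ('a \<Rightarrow> real) \<Rightarrow> bool" where
  "Ck_on 0 S f \<longleftrightarrow> continuous_on S f"
| "Ck_on (Suc k) S f \<longleftrightarrow>
     (\<forall>x\<in>S. f differentiable (at x)) \<and> (\<forall>b\<in>Basis. Ck_on k S (\<lambda>x. grad f x \<bullet> b))"

text \<open>A member of \<open>C\<^sub>c\<^sup>\<infinity>(S)\<close> is represented by its extension by zero to the whole space.\<close>

definition test_function_on :: "'a::euclidean_space set \<Rightarrow> ('a \<Rightarrow> real) \<Rightarrow> bool" where
  "test_function_on S \<phi> \<longleftrightarrow>
     (\<forall>k. Ck_on k UNIV \<phi>) \<and>
     compact (closure {x. \<phi> x \<noteq> 0}) \<and> closure {x. \<phi> x \<noteq> 0} \<subseteq> S"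

text \<open>The complement of the open unit ball is \<open>- ball 0 1\<close>, that of the closed unit ball is
  \<open>- cball 0 1\<close>. Integrals are taken with respect to the complete measure \<open>lebesgue\<close>, so that the
  arbitrary values of \<open>u\<close> on the unit sphere, where a solution is not defined, have no influence,
  not even on measurability.\<close>

definition ext_conv :: "real \<Rightarrow> ('a::euclidean_space \<Rightarrow> real) \<Rightarrow> 'a \<Rightarrow> real" where
  "ext_conv \<alpha> f x = (LINT y:(- ball 0 1)|lebesgue. f y / norm (x - y) powr \<alpha>)"

text \<open>Positive \<open>C\<^sup>1\<close>-solutions of
  \<open>- div (|\<nabla>u|\<^sup>m\<^sup>-\<^sup>2 g(|\<nabla>u|) \<nabla>u) - \<Delta>\<^sub>s u = (|x|\<^sup>-\<^sup>\<alpha> * u\<^sup>p) u\<^sup>q\<close> outside the closed unit ball.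
  Where the gradient vanishes, the vector \<open>|\<nabla>u|\<^sup>r\<^sup>-\<^sup>2 \<nabla>u\<close> is zero also for \<open>1 < r < 2\<close>, which is the
  usual convention.\<close>

definition positive_C1_solution ::
  "(real \<Rightarrow> real) \<Rightarrow> real \<Rightarrow> real \<Rightarrow> real \<Rightarrow> real \<Rightarrow> real \<Rightarrow> ('a::euclidean_space \<Rightarrow> real) \<Rightarrow> bool" where
  "positive_C1_solution g m s \<alpha> p q u \<longleftrightarrow>
     Ck_on 1 (- cball 0 1) u \<and>
     (\<forall>x \<in> - cball 0 1. u x > 0) \<and>
     set_integrable lebesgue (- ball 0 1) (\<lambda>y. u y powr p / (1 + norm y powr \<alpha>)) \<and>
     (\<forall>\<phi>. test_function_on (- cball 0 1) \<phi> \<longrightarrow>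
        (LINT x:(- ball 0 1)|lebesgue.
           (norm (grad u x) powr (m - 2) * g (norm (grad u x)) + norm (grad u x) powr (s - 2))
             * (grad u x \<bullet> grad \<phi> x))
        = (LINT x:(- ball 0 1)|lebesgue.
             ext_conv \<alpha> (\<lambda>y. u y powr p) x * u x powr q * \<phi> x))"

end

(* Write b = (N - s)/(s - 1) and Phi(t) = a(|t|) t for the flux of the operator; near zero Phi(t) is
   comparable to t^(s-1), so that only the s-Laplacian matters for slowly varying functions.

   Radial functions V with V' = - Psi(G(t) t^(1-N)), where Psi is the inverse of Phi, have the source
   t^(1-N) G'(t) and are used as barriers. Constant flux G gives u >= c |x|^(-b) for every positive
   solution u. If b p <= N - alpha, this already contradicts the integrability of
   u^p |y|^(-alpha). If b q <= N - alpha or b (p + q) <= 2 N - alpha, then the source is at least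
   c W^e |x|^(-N) wherever u >= W |x|^(-b), with e = q or e = p + q. Logarithmic flux makes W
   arbitrarily large, and Dirichlet barriers on annuli then give W(2 r) >= C W(r)^(e/(s-1)) with
   e > s - 1, which grows faster than any power of r; but spherical minima of u are bounded by
   comparison with increasing barriers.

   Conversely, under the two conditions the source of a radial function of size delta |x|^(-b) is
   integrable, with integral of order delta^(p+q), which is small compared with delta^(s-1). So the
   monotone map taking U to the radial function whose flux is epsilon plus the integrated source of U
   preserves 0 <= U <= delta t^(-b), and its iterates starting at 0 increase to a fixed point. *)

theory Submission
  imports Defs "HOL-Computational_Algebra.Polynomial"
begin

section \<open>Flux profiles\<close>

text \<open>The operator is not homogeneous, so rescaled solutions do not solve the same equation.
  What survives is one-sided: \<open>Psi z\<close> is at most z^(1/(s-1)) for all z \<ge> 0, but the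
  reverse bound, up to a factor, is available only for z \<le> 1. Hence lower barriers carry
  smallness conditions such as \<open>decay * \<mu> \<le> l\<close> or \<open>f * r \<le> 1\<close>,
  and sources are truncated to meet them. The unit sphere carries no information on u, so barriers
  start strictly outside it; for lower bounds a nonpositive value on the outer sphere is enough,
  because u > 0. Polar coordinates are replaced by symmetries of Lebesgue measure: dilation
  invariance of |x|^(-N) dx gives the weak form of a radial field, dyadic balls give the
  integrability of powers, reflections give the radial symmetry of Riesz potentials. For existence,
  the decay of u^p is weakened to |x|^(-P) with P < N, so that its Riesz potential is bounded by a
  pure power; the positive \<epsilon> in the flux excludes the zero fixed point.\<close>

locale flux_profile =
  fixes a :: "real \<Rightarrow> real" and s :: real
  assumes s_gt_1: "1 < s"
    and continuous_flux: "continuous_on UNIV (\<lambda>t. a \<bar>t\<bar> * t)"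
    and strict_mono_flux: "strict_mono (\<lambda>t. a \<bar>t\<bar> * t)"
    and flux_lower: "\<And>t. 0 \<le> t \<Longrightarrow> t powr (s - 1) \<le> a t * t"
    and flux_upper: "\<And>t. 0 \<le> t \<Longrightarrow> t \<le> 1 \<Longrightarrow> a t * t \<le> 2 * t powr (s - 1)"
begin

text \<open>Oddness makes the inverse \<open>Psi\<close> available for negative fluxes too; these
  belong to barriers that increase with the radius. The upper bound on the flux is assumed only for
  t \<le> 1, where the term of order m is dominated by t^(s-1).\<close>

definition Phi :: "real \<Rightarrow> real" where "Phi t = a \<bar>t\<bar> * t"
definition Psi :: "real \<Rightarrow> real" where "Psi = inv Phi"

lemma Phi_0 [simp]: "Phi 0 = 0"
  by (simp add: Phi_def)

lemma Phi_minus [simp]: "Phi (- t) = - Phi t"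
  by (simp add: Phi_def)

lemma strict_mono_Phi: "strict_mono Phi"
  using strict_mono_flux by (simp add: Phi_def[abs_def])

lemma isCont_Phi: "isCont Phi x"
  using continuous_flux by (simp add: Phi_def[abs_def] continuous_on_eq_continuous_at)

lemma Phi_lower: "0 \<le> t \<Longrightarrow> t powr (s - 1) \<le> Phi t"
  using flux_lower by (simp add: Phi_def)

lemma Phi_upper: "0 \<le> t \<Longrightarrow> t \<le> 1 \<Longrightarrow> Phi t \<le> 2 * t powr (s - 1)"
  using flux_upper by (simp add: Phi_def)

text \<open>Intermediate values on [0, z^(1/(s-1))]: the lower bound on the flux already places its
  value at the right end above z.\<close>

lemma Phi_attains:
  assumes "0 \<le> z" shows "\<exists>t\<ge>0. Phi t = z"
proof -
  let ?T = "z powr (1 / (s - 1))"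
  have "?T powr (s - 1) = z"
    using s_gt_1 assms by (simp add: powr_powr)
  then have "z \<le> Phi ?T"
    using Phi_lower[of ?T] by simp
  then obtain t where "0 \<le> t" "Phi t = z"
    using IVT[of Phi 0 z ?T] isCont_Phi assms by auto
  then show ?thesis by blast
qed

lemma surj_Phi: "surj Phi"
proof (unfold surj_def, rule allI)
  fix z :: real
  show "\<exists>t. z = Phi t"
  proof (cases "0 \<le> z")
    case False
    then obtain t where "Phi t = - z" using Phi_attains[of "- z"] by auto
    then have "Phi (- t) = z" by simp
    then show ?thesis by blast
  next
    case True
    then show ?thesis using Phi_attains[of z] by blast
  qed
qed

lemma inj_Phi: "inj Phi"
  by (rule strict_mono_imp_inj_on[OF strict_mono_Phi])

lemma Phi_Psi [simp]: "Phi (Psi z) = z"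
  by (simp add: Psi_def surj_Phi surj_f_inv_f)

lemma Psi_Phi [simp]: "Psi (Phi t) = t"
  by (simp add: Psi_def inj_Phi)

lemma Phi_less_iff: "Phi x < Phi y \<longleftrightarrow> x < y"
  by (rule strict_mono_less[OF strict_mono_Phi])

lemma Psi_less_iff [simp]: "Psi x < Psi y \<longleftrightarrow> x < y"
  by (metis Phi_Psi Phi_less_iff)

lemma Psi_le_iff [simp]: "Psi x \<le> Psi y \<longleftrightarrow> x \<le> y"
  by (meson Psi_less_iff linorder_not_le)

lemma Psi_0 [simp]: "Psi 0 = 0"
  by (metis Phi_0 Psi_Phi)

lemma Psi_minus [simp]: "Psi (- z) = - Psi z"
  by (metis Phi_Psi Phi_minus Psi_Phi)

lemma Psi_nonneg_iff [simp]: "0 \<le> Psi z \<longleftrightarrow> 0 \<le> z"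
  by (metis Psi_0 Psi_le_iff)

lemma Psi_pos_iff [simp]: "0 < Psi z \<longleftrightarrow> 0 < z"
  by (metis Psi_0 Psi_less_iff)

lemma isCont_Psi: "isCont Psi z"
proof -
  have "isCont Psi (Phi (Psi z))"
    by (rule isCont_inverse_function[where d = 1 and f = Phi]) (auto simp: isCont_Phi)
  then show ?thesis by simp
qed

lemma continuous_on_Psi: "continuous_on S Psi"
  by (simp add: continuous_at_imp_continuous_on isCont_Psi)

lemma continuous_on_Psi' [continuous_intros]:
  "continuous_on S f \<Longrightarrow> continuous_on S (\<lambda>x. Psi (f x))"
  by (rule continuous_on_compose2[OF continuous_on_Psi[of UNIV]]) auto

lemma Psi_measurable [measurable]: "Psi \<in> borel_measurable borel"
  by (rule borel_measurable_continuous_onI[OF continuous_on_Psi])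

lemma Psi_upper:
  assumes "0 \<le> z" shows "Psi z \<le> z powr (1 / (s - 1))"
proof -
  have "Psi z powr (s - 1) \<le> z"
    using Phi_lower[of "Psi z"] assms by simp
  then have "(Psi z powr (s - 1)) powr (1 / (s - 1)) \<le> z powr (1 / (s - 1))"
    using s_gt_1 by (intro powr_mono2) auto
  then show ?thesis
    using s_gt_1 assms by (simp add: powr_powr)
qed

text \<open>The upper bound on \<open>Phi\<close> can be inverted only when
  \<open>Psi z \<le> 1\<close>. Otherwise the claim is trivial, because z \<le> 1 makes the left
  side at most 1.\<close>

lemma Psi_lower:
  assumes "0 \<le> z" "z \<le> 1" shows "(z / 2) powr (1 / (s - 1)) \<le> Psi z"
proof (cases "Psi z \<le> 1")
  case True
  then have "z / 2 \<le> Psi z powr (s - 1)"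
    using Phi_upper[of "Psi z"] assms by simp
  then have "(z / 2) powr (1 / (s - 1)) \<le> (Psi z powr (s - 1)) powr (1 / (s - 1))"
    using s_gt_1 assms by (intro powr_mono2) auto
  then show ?thesis
    using s_gt_1 assms by (simp add: powr_powr)
next
  case False
  have "(z / 2) powr (1 / (s - 1)) \<le> 1 powr (1 / (s - 1))"
    using s_gt_1 assms by (intro powr_mono2) auto
  then show ?thesis using False by simp
qed

lemma coeff_eq: "a t = Phi t / t" if "0 < t"
  using that by (simp add: Phi_def)

lemma coeff_pos: "0 < a t" if "0 < t"
proof -
  have "0 < Phi t" using Phi_less_iff[of 0 t] that by simp
  then show ?thesis using that by (simp add: coeff_eq)
qed

section \<open>The vector field of a profile and its monotonicity\<close>

definition field :: "'a::euclidean_space \<Rightarrow> 'a" where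
  "field v = a (norm v) *\<^sub>R v"

lemma field_0 [simp]: "field 0 = 0"
  by (simp add: field_def)

lemma norm_field: "norm (field v) = Phi (norm v)"
proof (cases "v = 0")
  case False
  then show ?thesis using coeff_pos[of "norm v"] by (simp add: field_def Phi_def)
qed simp

lemma field_scaleR_unit:
  assumes "norm e = 1" shows "field (t *\<^sub>R e) = Phi t *\<^sub>R e"
  using assms by (simp add: field_def Phi_def)

text \<open>For s < 2 the coefficient \<open>a\<close> blows up at 0, so continuity at the origin
  comes from |field v| = Phi |v|; elsewhere the coefficient is Phi(t) / t.\<close>

lemma continuous_on_field: "continuous_on S (field :: 'a::euclidean_space \<Rightarrow> 'a)"
proof -
  have "isCont field v" for v :: 'a
  proof (cases "v = 0")
    case True
    have "((\<lambda>v::'a. Phi (norm v)) \<longlongrightarrow> Phi (norm (0::'a))) (at 0)"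
      by (rule isCont_tendsto_compose[OF isCont_Phi]) (intro tendsto_intros)
    then have "((\<lambda>v::'a. norm (field v)) \<longlongrightarrow> 0) (at 0)"
      by (simp add: norm_field)
    then have "((\<lambda>v::'a. field v) \<longlongrightarrow> 0) (at 0)"
      by (rule tendsto_norm_zero_cancel)
    then show ?thesis using True by (simp add: isCont_def)
  next
    case False
    have "isCont (\<lambda>v::'a. (Phi (norm v) / norm v) *\<^sub>R v) v"
      using False by (intro continuous_intros isCont_o2[OF _ isCont_Phi]) auto
    moreover have "\<forall>\<^sub>F w in nhds v. w \<noteq> 0"
      using False by (simp add: t1_space_nhds)
    then have "\<forall>\<^sub>F w in nhds v. field w = (Phi (norm w) / norm w) *\<^sub>R w"
      by eventually_elim (simp add: field_def coeff_eq)
    ultimately show ?thesis by (simp add: isCont_cong)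
  qed
  then show ?thesis by (simp add: continuous_at_imp_continuous_on)
qed

text \<open>The product splits into a radial part, nonnegative because \<open>Phi\<close> increases,
  and an angular part, a nonnegative multiple of the defect in the Cauchy-Schwarz inequality. If
  both vanish, the vectors have equal length and the same direction.\<close>

lemma field_monotone:
  "0 \<le> (field v - field w) \<bullet> (v - w)"
  "(field v - field w) \<bullet> (v - w) = 0 \<Longrightarrow> v = w"
proof -
  let ?r = "norm v" and ?t = "norm w"
  let ?A = "(Phi ?r - Phi ?t) * (?r - ?t)"
  let ?B = "(a ?r + a ?t) * (?r * ?t - v \<bullet> w)"
  have eq: "(field v - field w) \<bullet> (v - w) = ?A + ?B"
    by (simp add: field_def Phi_def algebra_simps inner_commute power2_norm_eq_inner[symmetric] power2_eq_square)
  have A: "0 \<le> ?A" "?r \<noteq> ?t \<Longrightarrow> 0 < ?A"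
  proof -
    consider "?r < ?t" | "?r = ?t" | "?t < ?r" by linarith
    then have "0 \<le> ?A \<and> (?r \<noteq> ?t \<longrightarrow> 0 < ?A)"
      by cases (use Phi_less_iff[of ?r ?t] Phi_less_iff[of ?t ?r] in
        \<open>auto simp: zero_less_mult_iff zero_le_mult_iff\<close>)
    then show "0 \<le> ?A" "?r \<noteq> ?t \<Longrightarrow> 0 < ?A" by auto
  qed
  have CS: "v \<bullet> w \<le> ?r * ?t" by (rule norm_cauchy_schwarz)
  have B: "0 \<le> ?B"
  proof (cases "v = 0 \<or> w = 0")
    case False
    then show ?thesis using CS coeff_pos[of ?r] coeff_pos[of ?t] by (intro mult_nonneg_nonneg) auto
  qed auto
  show "0 \<le> (field v - field w) \<bullet> (v - w)" using eq A B by linarith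
  show "v = w" if "(field v - field w) \<bullet> (v - w) = 0"
  proof -
    have rt: "?r = ?t" using that eq A B by (metis add_pos_nonneg less_irrefl)
    have B0: "?B = 0" using that eq A B by linarith
    show ?thesis
    proof (cases "v = 0")
      case True then show ?thesis using rt by simp
    next
      case False
      then have "a ?r + a ?t > 0" using rt coeff_pos[of ?r] coeff_pos[of ?t] by (metis add_pos_pos zero_less_norm_iff)
      then have "v \<bullet> w = ?r * ?t" using B0 by simp
      then have "?r *\<^sub>R w = ?t *\<^sub>R v" using norm_cauchy_schwarz_eq by blast
      then show ?thesis using rt False by (metis norm_eq_zero scaleR_cancel_left)
    qed
  qed
qed

end

text \<open>The bound g \<le> 1 keeps the m-term below t^(s-1) on [0, 1]; monotonicity of t^(m-1)
  g(t) keeps the total flux strictly increasing, since the s-term is strict.\<close>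

lemma flux_profile_double_phase:
  fixes g :: "real \<Rightarrow> real"
  assumes "1 < s" "s < m" and g: "\<And>t. 0 \<le> t \<Longrightarrow> 0 \<le> g t" "\<And>t. 0 \<le> t \<Longrightarrow> g t \<le> 1"
    and mono: "\<And>x y. 0 \<le> x \<Longrightarrow> x \<le> y \<Longrightarrow> x powr (m - 1) * g x \<le> y powr (m - 1) * g y"
    and cont: "continuous_on {0..} g"
  shows "flux_profile (\<lambda>t. t powr (m - 2) * g t + t powr (s - 2)) s"
proof -
  let ?a = "\<lambda>t. t powr (m - 2) * g t + t powr (s - 2)"
  let ?F = "\<lambda>t. t powr (m - 1) * g t + t powr (s - 1)"
  have aF: "?a t * t = ?F t" if "0 \<le> t" for t
  proof (cases "t = 0")
    case False
    have "t powr (m - 2) * t = t powr (m - 1)" "t powr (s - 2) * t = t powr (s - 1)"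
      using powr_mult_base[of t "m - 2"] powr_mult_base[of t "s - 2"] that by (simp_all add: mult.commute)
    then show ?thesis by (simp add: algebra_simps)
  qed simp
  have sgn: "?a \<bar>t\<bar> * t = (if 0 \<le> t then ?F t else - ?F (- t))" for t
    using aF[of t] aF[of "- t"] by auto
  have mF: "?F x < ?F y" if "0 \<le> x" "x < y" for x y
    using mono[of x y] that \<open>1 < s\<close> by (intro add_le_less_mono powr_less_mono2) auto
  have F0: "?F 0 = 0" by simp
  have contF: "continuous_on {0..} ?F"
    using assms(1,2) by (intro continuous_intros continuous_on_powr' cont) auto
  show ?thesis
  proof
    show "1 < s" by fact
    have c: "continuous_on ({0..} \<union> {..0}) (\<lambda>t. if 0 \<le> t then ?F t else - ?F (- t))"
    proof (rule continuous_on_cases)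
      show "continuous_on {..0} (\<lambda>t. - ?F (- t))"
        by (intro continuous_on_minus continuous_on_compose2[OF contF] continuous_intros) auto
    qed (use contF in auto)
    have U: "{0..} \<union> {..0} = (UNIV :: real set)" by auto
    show "continuous_on UNIV (\<lambda>t. ?a \<bar>t\<bar> * t)"
      using c unfolding sgn U .
    show "strict_mono (\<lambda>t. ?a \<bar>t\<bar> * t)"
    proof (rule strict_monoI)
      fix x y :: real assume "x < y"
      then consider "0 \<le> x" | "x < 0" "0 \<le> y" | "x < 0" "y < 0" by linarith
      then show "?a \<bar>x\<bar> * x < ?a \<bar>y\<bar> * y"
      proof cases
        case 1 then show ?thesis unfolding sgn using mF[of x y] \<open>x < y\<close> by simp
      next
        case 2
        have "0 < ?F (- x)" using mF[of 0 "- x"] 2 by simp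
        moreover have "0 \<le> ?F y" using g(1)[of y] 2 by simp
        ultimately show ?thesis unfolding sgn using 2 by simp
      next
        case 3 then show ?thesis unfolding sgn using mF[of "- y" "- x"] \<open>x < y\<close> by simp
      qed
    qed
    fix t :: real assume t: "0 \<le> t"
    show "t powr (s - 1) \<le> ?a t * t"
      using aF[OF t] g(1)[OF t] by simp
    assume "t \<le> 1"
    have "t powr (m - 1) * g t \<le> t powr (m - 1) * 1"
      using g t by (intro mult_left_mono) auto
    also have "\<dots> \<le> t powr (s - 1)"
      using \<open>t \<le> 1\<close> t assms(2) by (cases "t = 0") (auto intro: powr_mono')
    finally show "?a t * t \<le> 2 * t powr (s - 1)"
      using aF[OF t] by simp
  qed
qed

lemma flux_profile_plain:
  assumes "1 < s" "s < m"
  shows "flux_profile (\<lambda>t. t powr (m - 2) * 1 + t powr (s - 2)) s"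
  using assms by (intro flux_profile_double_phase) (auto intro: powr_mono2)

lemma flux_profile_sqrt:
  assumes "1 < s" "s < m" "2 \<le> m"
  shows "flux_profile (\<lambda>t. t powr (m - 2) * (1 / sqrt (1 + t powr m)) + t powr (s - 2)) s"
proof (rule flux_profile_double_phase)
  show "continuous_on {0..} (\<lambda>t. 1 / sqrt (1 + t powr m))"
    using assms by (intro continuous_intros continuous_on_powr')
      (auto simp: add_pos_nonneg less_imp_neq[symmetric] add_nonneg_eq_0_iff)
next
  fix x y :: real assume xy: "0 \<le> x" "x \<le> y"
  show "x powr (m - 1) * (1 / sqrt (1 + x powr m)) \<le> y powr (m - 1) * (1 / sqrt (1 + y powr m))"
  proof (cases "x = 0")
    case False
    then have pos: "0 < x" "0 < y" using xy by auto
    \<comment> \<open>In this form monotonicity is visible: for m \<ge> 2 both exponents under the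
      root are nonpositive, so the radicand decreases in t.\<close>
    have D: "(t powr (m - 1) * (1 / sqrt (1 + t powr m)))
        = 1 / sqrt (t powr (2 - 2 * m) + t powr (2 - m))" if "0 < t" for t :: real
    proof -
      have "t powr (m - 1) = 1 / sqrt (t powr (2 - 2 * m))"
      proof -
        have "sqrt (t powr (2 - 2 * m)) = t powr (1 - m)"
          by (subst powr_half_sqrt[symmetric]) (auto simp: powr_powr diff_divide_distrib)
        then show ?thesis using that by (simp add: powr_minus_divide[symmetric])
      qed
      moreover have "t powr (2 - 2 * m) + t powr (2 - m) = t powr (2 - 2 * m) * (1 + t powr m)"
        by (simp add: algebra_simps powr_add[symmetric])
      ultimately show ?thesis by (simp add: real_sqrt_mult)
    qed
    have "y powr (2 - 2 * m) + y powr (2 - m) \<le> x powr (2 - 2 * m) + x powr (2 - m)"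
      using pos xy assms by (intro add_mono powr_mono2') auto
    moreover have "0 < y powr (2 - 2 * m) + y powr (2 - m)"
      using pos by (simp add: add_pos_pos)
    ultimately show ?thesis
      unfolding D[OF pos(1)] D[OF pos(2)] by (intro divide_left_mono) auto
  qed simp
next
  fix t :: real assume "0 \<le> t"
  have "1 \<le> sqrt (1 + t powr m)" by simp
  then show "1 / sqrt (1 + t powr m) \<le> 1"
    by (subst divide_le_eq_1_pos) linarith+
qed (use assms in auto)

section \<open>Weak form of radial vector fields\<close>

lemma gderiv_grad:
  fixes f :: "'a::euclidean_space \<Rightarrow> real"
  assumes "f differentiable (at x)"
  shows "GDERIV f x :> grad f x"
proof -
  obtain f' where f': "(f has_derivative f') (at x)"
    using assms by (auto simp: differentiable_def)
  then have lin: "linear f'" by (rule has_derivative_linear)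
  have "f' = (\<lambda>h. inner h (\<Sum>b\<in>Basis. f' b *\<^sub>R b))"
  proof
    fix h
    have "f' h = f' (\<Sum>b\<in>Basis. (h \<bullet> b) *\<^sub>R b)" by (simp add: euclidean_representation)
    also have "\<dots> = (\<Sum>b\<in>Basis. (h \<bullet> b) * f' b)"
      using lin by (simp add: linear_sum linear_cmul)
    finally show "f' h = inner h (\<Sum>b\<in>Basis. f' b *\<^sub>R b)"
      by (simp add: inner_sum_right mult.commute)
  qed
  then have "GDERIV f x :> (\<Sum>b\<in>Basis. f' b *\<^sub>R b)"
    using f' by (simp add: gderiv_def)
  then show ?thesis using grad_eqI[of f x] by simp
qed

lemma has_derivative_grad:
  fixes f :: "'a::euclidean_space \<Rightarrow> real"
  assumes "f differentiable (at x)"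
  shows "(f has_derivative (\<lambda>h. h \<bullet> grad f x)) (at x)"
  using gderiv_grad[OF assms] by (simp add: gderiv_def)

lemma GDERIV_differentiable:
  fixes f :: "'a::euclidean_space \<Rightarrow> real"
  shows "GDERIV f x :> D \<Longrightarrow> f differentiable (at x)"
  by (auto simp: gderiv_def differentiable_def)

lemma GDERIV_transform_open:
  fixes f :: "'a::euclidean_space \<Rightarrow> real"
  assumes "GDERIV f x :> D" "open S" "x \<in> S" "\<And>y. y \<in> S \<Longrightarrow> f y = g y"
  shows "GDERIV g x :> D"
  unfolding gderiv_def
  by (rule has_derivative_transform_within_open[OF assms(1)[unfolded gderiv_def] assms(2-3)]) (rule assms(4))

definition C1_on :: "'a::euclidean_space set \<Rightarrow> ('a \<Rightarrow> real) \<Rightarrow> bool" where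
  "C1_on S f \<longleftrightarrow> (\<forall>x\<in>S. f differentiable (at x)) \<and> continuous_on S (grad f)"

lemma Ck_on_1_iff_C1_on: "Ck_on 1 S f \<longleftrightarrow> C1_on S f"
proof -
  have "continuous_on S (grad f) \<longleftrightarrow> (\<forall>b\<in>Basis. continuous_on S (\<lambda>x. grad f x \<bullet> b))"
    by (rule continuous_on_componentwise)
  then show ?thesis by (simp add: C1_on_def)
qed

lemma C1_onI:
  assumes "\<And>x. x \<in> S \<Longrightarrow> GDERIV f x :> F x" "continuous_on S F"
  shows "C1_on S f"
proof -
  have "continuous_on S (grad f) \<longleftrightarrow> continuous_on S F"
    by (rule continuous_on_cong) (auto intro: grad_eqI assms(1))
  then show ?thesis
    using assms(2) GDERIV_differentiable[OF assms(1)] by (simp add: C1_on_def)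
qed

lemma C1_on_GDERIV: "C1_on S f \<Longrightarrow> x \<in> S \<Longrightarrow> GDERIV f x :> grad f x"
  by (auto simp: C1_on_def gderiv_grad)

lemma C1_on_continuous: "C1_on S f \<Longrightarrow> continuous_on S f"
  by (auto simp: C1_on_def intro!: continuous_at_imp_continuous_on differentiable_imp_continuous_within)

lemma C1_on_continuous_grad: "C1_on S f \<Longrightarrow> continuous_on S (grad f)"
  by (simp add: C1_on_def)

lemma grad_zero_outside:
  fixes f :: "'a::euclidean_space \<Rightarrow> real"
  assumes "closed K" "\<And>x. x \<notin> K \<Longrightarrow> f x = 0" "x \<notin> K"
  shows "GDERIV f x :> 0" "grad f x = 0"
proof -
  have "GDERIV (\<lambda>x. 0::real) x :> 0" by (rule GDERIV_const)
  then show "GDERIV f x :> 0"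
    by (rule GDERIV_transform_open[where S = "- K"]) (use assms in auto)
  then show "grad f x = 0" by (rule grad_eqI)
qed

text \<open>Meant for expressions that make sense only on the open set A, multiplied by a function
  supported in K. The open sets A and - K cover the space.\<close>

lemma continuous_on_glue_zero:
  fixes f :: "'a::topological_space \<Rightarrow> 'b::real_normed_vector"
  assumes "open A" "closed K" "K \<subseteq> A" "continuous_on A f" "\<And>x. x \<notin> K \<Longrightarrow> f x = 0"
  shows "continuous_on UNIV f"
proof -
  have "continuous_on (- K) f \<longleftrightarrow> continuous_on (- K) (\<lambda>x. 0 :: 'b)"
    using assms(5) by (intro continuous_on_cong) auto
  then have "continuous_on (- K) f" by simp
  then have "continuous_on (A \<union> - K) f"
    using assms by (intro continuous_on_open_Un) auto
  moreover have "A \<union> - K = UNIV" using assms(3) by auto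
  ultimately show ?thesis by simp
qed

lemma C1_on_glue_zero:
  assumes "open A" "closed K" "K \<subseteq> A" "C1_on A f" "\<And>x. x \<notin> K \<Longrightarrow> f x = 0"
  shows "C1_on UNIV f"
  unfolding C1_on_def
proof (intro conjI ballI)
  show "f differentiable (at x)" for x
  proof (cases "x \<in> K")
    case True then show ?thesis using assms(3,4) by (auto simp: C1_on_def)
  next
    case False
    then have "GDERIV f x :> 0" using grad_zero_outside(1)[OF assms(2)] assms(5) by blast
    then show ?thesis by (rule GDERIV_differentiable)
  qed
  show "continuous_on UNIV (grad f)"
    by (rule continuous_on_glue_zero[OF assms(1-3)])
      (use assms(4,5) grad_zero_outside(2)[OF assms(2)] in \<open>auto simp: C1_on_def\<close>)
qed

section \<open>Integrals of compactly supported functions and dilations\<close>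

lemma integrable_compact_support:
  fixes f :: "'a::euclidean_space \<Rightarrow> 'b::euclidean_space"
  assumes "continuous_on UNIV f" "compact K" "\<And>x. x \<notin> K \<Longrightarrow> f x = 0"
  shows "integrable lborel f"
proof -
  have "integrable lborel (\<lambda>x. indicator K x *\<^sub>R f x)"
    using assms by (intro borel_integrable_compact) (auto intro: continuous_on_subset)
  moreover have "(\<lambda>x. indicator K x *\<^sub>R f x) = f"
    using assms(3) by (auto simp: indicator_def)
  ultimately show ?thesis by simp
qed

lemma integral_compact_support:
  fixes f :: "'a::euclidean_space \<Rightarrow> real"
  assumes "continuous_on UNIV f" "K \<subseteq> cbox c d" "compact K" "\<And>x. x \<notin> K \<Longrightarrow> f x = 0"
  shows "(LINT x|lborel. f x) = integral (cbox c d) f"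
proof -
  have "integral UNIV f = (LINT x|lborel. f x)"
    using integrable_compact_support[OF assms(1,3,4)] by (rule integral_lborel)
  moreover have "integral UNIV (\<lambda>x. if x \<in> cbox c d then f x else 0) = integral (cbox c d) f"
    by (rule integral_restrict_UNIV)
  moreover have "(\<lambda>x. if x \<in> cbox c d then f x else 0) = f"
    by (rule ext) (use assms(2,4) in auto)
  ultimately show ?thesis by simp
qed

lemma lborel_integral_scaleR:
  fixes f :: "'a::euclidean_space \<Rightarrow> real"
  assumes [measurable]: "f \<in> borel_measurable borel" and "0 < c"
  shows "(LINT x|lborel. f x) = c ^ DIM('a) * (LINT x|lborel. f (c *\<^sub>R x))"
proof -
  have "(LINT x|lborel. f x)
      = (LINT x|density (distr lborel borel (\<lambda>x. 0 + c *\<^sub>R x)) (\<lambda>_. ennreal (\<bar>c\<bar> ^ DIM('a))). f x)"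
    by (rule arg_cong[where f = "\<lambda>M. LINT x|M. f x", OF lborel_affine]) (use \<open>0 < c\<close> in simp)
  also have "\<dots> = (LINT x|distr lborel borel (\<lambda>x. 0 + c *\<^sub>R x). \<bar>c\<bar> ^ DIM('a) * f x)"
    by (subst integral_density) auto
  also have "\<dots> = (LINT x|lborel. \<bar>c\<bar> ^ DIM('a) * f (0 + c *\<^sub>R x))"
    by (subst integral_distr) auto
  finally show ?thesis using \<open>0 < c\<close> by simp
qed

text \<open>The measure \<open>\<bar>x\<bar>\<^sup>-\<^sup>N dx\<close> is invariant under dilations, so the integral of \<open>h (\<lambda>x)\<close> against it
  does not depend on \<open>\<lambda>\<close>; the assertion is its derivative at \<open>\<lambda> = 1\<close>.\<close>

lemma dilation_identity:
  fixes h :: "'a::euclidean_space \<Rightarrow> real"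
  assumes C1: "C1_on UNIV h" and "0 < r"
    and supp: "\<And>x. norm x < r \<or> R < norm x \<Longrightarrow> h x = 0"
  shows "(LINT x|lborel. (x \<bullet> grad h x) / norm x ^ DIM('a)) = 0"
proof -
  let ?N = "DIM('a)"
  \<comment> \<open>\<open>w\<close> equals |x|^(-N) wherever some h(c x) with 1/2 < c < 2 is
    nonzero, and it has no singularity at the origin, as Leibniz's rule on a box requires.\<close>
  define w :: "'a \<Rightarrow> real" where "w x = 1 / (max (r / 2) (norm x)) ^ ?N" for x
  obtain d where d: "{x::'a. norm x \<le> 2 * R} \<subseteq> cbox (- d) d"
    using bounded_subset_cbox_symmetric[of "cball (0::'a) (2 * R)"] by (auto simp: mem_cball_0 subset_iff)
  define U where "U = {1/2<..<2::real}"
  have contw: "continuous_on S w" for S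
    unfolding w_def using \<open>0 < r\<close> by (intro continuous_intros) auto
  have conth: "continuous_on UNIV h" using C1 by (rule C1_on_continuous)
  have contg: "continuous_on UNIV (grad h)" using C1 by (rule C1_on_continuous_grad)
  have zero: "h (c *\<^sub>R x) = 0" if "c \<in> U" "norm x < r / 2 \<or> 2 * R < norm x" for c x
  proof (rule supp)
    have c: "1/2 < c" "c < 2" using that by (auto simp: U_def)
    have "c * norm x \<le> 2 * norm x" "(1/2) * norm x \<le> c * norm x"
      using mult_right_mono[of c 2 "norm x"] mult_right_mono[of "1/2" c "norm x"] c by auto
    then show "norm (c *\<^sub>R x) < r \<or> R < norm (c *\<^sub>R x)" using that(2) c by auto
  qed
  define J where "J c = integral (cbox (- d) d) (\<lambda>x. w x * h (c *\<^sub>R x))" for c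
  have J_const: "J c = (LINT x|lborel. h x / norm x ^ ?N)" if "c \<in> U" for c
  proof -
    have "0 < c" using that by (auto simp: U_def)
    have "J c = (LINT x|lborel. w x * h (c *\<^sub>R x))"
      unfolding J_def
    proof (rule integral_compact_support[symmetric])
      show "continuous_on UNIV (\<lambda>x. w x * h (c *\<^sub>R x))"
        by (intro continuous_intros contw continuous_on_compose2[OF conth]) auto
      show "{x. norm x \<le> 2 * R} \<subseteq> cbox (- d) d" by (rule d)
      show "compact {x::'a. norm x \<le> 2 * R}"
        using compact_cball[of "0::'a" "2 * R"] by (simp add: cball_def dist_norm)
    qed (use zero[OF that] in auto)
    also have "(\<lambda>x. w x * h (c *\<^sub>R x)) = (\<lambda>x. c ^ ?N * (h (c *\<^sub>R x) / norm (c *\<^sub>R x) ^ ?N))"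
    proof
      fix x :: 'a
      show "w x * h (c *\<^sub>R x) = c ^ ?N * (h (c *\<^sub>R x) / norm (c *\<^sub>R x) ^ ?N)"
      proof (cases "norm x < r / 2")
        case True then show ?thesis using zero[OF that, of x] by simp
      next
        case False
        then have "w x = 1 / norm x ^ ?N" by (simp add: w_def max_absorb2)
        then show ?thesis using \<open>0 < c\<close> by (simp add: power_mult_distrib)
      qed
    qed
    also have "(LINT x|lborel. c ^ ?N * (h (c *\<^sub>R x) / norm (c *\<^sub>R x) ^ ?N))
        = c ^ ?N * (LINT x|lborel. h (c *\<^sub>R x) / norm (c *\<^sub>R x) ^ ?N)"
      by (rule integral_mult_right_zero)
    also have "\<dots> = (LINT x|lborel. h x / norm x ^ ?N)"
    proof (rule lborel_integral_scaleR[symmetric])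
      have [measurable]: "h \<in> borel_measurable borel" by (rule borel_measurable_continuous_onI[OF conth])
      show "(\<lambda>x. h x / norm x ^ ?N) \<in> borel_measurable borel" by measurable
    qed fact
    finally show ?thesis .
  qed
  define D where "D = integral (cbox (- d) d) (\<lambda>x. w x * (x \<bullet> grad h (1 *\<^sub>R x)))"
  have "(J has_field_derivative D) (at 1 within U)"
    unfolding J_def D_def
  proof (rule leibniz_rule_field_derivative)
    fix c :: real and x :: 'a assume "c \<in> U"
    have "(h has_derivative (\<lambda>v. v \<bullet> grad h (c *\<^sub>R x))) (at (c *\<^sub>R x))"
      using C1 by (intro has_derivative_grad) (auto simp: C1_on_def)
    moreover have "((\<lambda>c. c *\<^sub>R x) has_derivative (\<lambda>e. e *\<^sub>R x)) (at c)"
      by (auto intro!: derivative_eq_intros)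
    ultimately have "((\<lambda>c. h (c *\<^sub>R x)) has_derivative (\<lambda>e. (e *\<^sub>R x) \<bullet> grad h (c *\<^sub>R x))) (at c)"
      by (rule has_derivative_compose[rotated])
    then have "((\<lambda>c. h (c *\<^sub>R x)) has_field_derivative (x \<bullet> grad h (c *\<^sub>R x))) (at c)"
      by (rule has_derivative_imp_has_field_derivative) simp
    then have "((\<lambda>c. w x * h (c *\<^sub>R x)) has_field_derivative (w x * (x \<bullet> grad h (c *\<^sub>R x)))) (at c)"
      by (rule DERIV_cmult)
    then show "((\<lambda>c. w x * h (c *\<^sub>R x)) has_field_derivative (w x * (x \<bullet> grad h (c *\<^sub>R x)))) (at c within U)"
      by (rule has_field_derivative_at_within)
  next
    fix c :: real
    show "(\<lambda>x. w x * h (c *\<^sub>R x)) integrable_on cbox (- d) d"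
      by (intro integrable_continuous continuous_intros contw continuous_on_compose2[OF conth]) auto
  next
    have "continuous_on (U \<times> cbox (- d) d) (\<lambda>p. w (snd p))"
      by (rule continuous_on_compose2[OF contw[of UNIV]]) (auto intro: continuous_intros)
    moreover have "continuous_on (U \<times> cbox (- d) d) (\<lambda>p. grad h (fst p *\<^sub>R snd p))"
      by (rule continuous_on_compose2[OF contg]) (auto intro!: continuous_intros)
    ultimately show "continuous_on (U \<times> cbox (- d) d) (\<lambda>(c, x). w x * (x \<bullet> grad h (c *\<^sub>R x)))"
      unfolding split_beta by (intro continuous_intros)
  qed (auto simp: U_def convex_real_interval)
  moreover have "at 1 within U = at (1 :: real)"
    by (rule at_within_open) (auto simp: U_def)
  ultimately have "(J has_field_derivative D) (at 1)" by simp
  moreover have "(J has_field_derivative 0) (at 1)"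
  proof (rule has_field_derivative_transform_within_open[where S = U])
    show "((\<lambda>_. LINT x|lborel. h x / norm x ^ ?N) has_field_derivative 0) (at 1)" by simp
  qed (use J_const in \<open>auto simp: U_def\<close>)
  ultimately have "D = 0" by (rule DERIV_unique)
  have gz: "grad h x = 0" if "norm x < r \<or> R < norm x" for x
  proof (rule grad_zero_outside(2))
    show "closed {x::'a. r \<le> norm x \<and> norm x \<le> R}"
      by (intro closed_Collect_conj closed_Collect_le continuous_intros)
  next
    fix y :: 'a assume "y \<notin> {x. r \<le> norm x \<and> norm x \<le> R}"
    then show "h y = 0" by (intro supp) auto
  qed (use that in auto)
  have "(LINT x|lborel. w x * (x \<bullet> grad h x)) = D"
    unfolding D_def scaleR_one
  proof (rule integral_compact_support)
    show "continuous_on UNIV (\<lambda>x. w x * (x \<bullet> grad h x))"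
      by (intro continuous_intros contw contg)
    show "{x. norm x \<le> 2 * R} \<subseteq> cbox (- d) d" by (rule d)
    show "compact {x::'a. norm x \<le> 2 * R}"
      using compact_cball[of "0::'a" "2 * R"] by (simp add: cball_def dist_norm)
    fix x :: 'a assume "x \<notin> {x. norm x \<le> 2 * R}"
    then have "0 < norm x \<longrightarrow> 0 < R \<longrightarrow> R < norm x" "2 * R < norm x" by auto
    then have "R < norm x" using norm_ge_zero[of x] by linarith
    then show "w x * (x \<bullet> grad h x) = 0" using gz by simp
  qed
  moreover have "(\<lambda>x. w x * (x \<bullet> grad h x)) = (\<lambda>x. (x \<bullet> grad h x) / norm x ^ ?N)"
  proof
    fix x :: 'a
    show "w x * (x \<bullet> grad h x) = (x \<bullet> grad h x) / norm x ^ ?N"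
      using gz[of x] \<open>0 < r\<close> by (cases "norm x < r") (auto simp: w_def max_def)
  qed
  ultimately show ?thesis using \<open>D = 0\<close> by simp
qed

text \<open>This is \<open>dilation_identity\<close> for h(x) = G(|x|) \<phi>(x). Divided by |x|^N,
  the product x . grad h falls into the two integrands: the radial field of size G(r) r^(1-N)
  against grad \<phi>, and its divergence G'(r) r^(1-N) against \<phi>.\<close>

lemma radial_field_weak:
  fixes \<phi> :: "'a::euclidean_space \<Rightarrow> real"
  assumes "0 < a"
    and G: "\<And>t. a < t \<Longrightarrow> t < b \<Longrightarrow> (G has_real_derivative G' t) (at t)"
    and G': "continuous_on {a<..<b} G'"
    and \<phi>: "C1_on UNIV \<phi>" and K: "compact K" "K \<subseteq> {x. a < norm x \<and> norm x < b}"
    and supp: "\<And>x. x \<notin> K \<Longrightarrow> \<phi> x = 0"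
  shows "(LINT x|lborel. G (norm x) / norm x ^ DIM('a) * (x \<bullet> grad \<phi> x))
      = - (LINT x|lborel. G' (norm x) / norm x ^ (DIM('a) - 1) * \<phi> x)"
proof -
  let ?A = "{x::'a. a < norm x \<and> norm x < b}" and ?N = "DIM('a)"
  have openA: "open ?A"
    by (intro open_Collect_conj open_Collect_less continuous_intros)
  have clK: "closed K" using K(1) by (rule compact_imp_closed)
  have gz: "grad \<phi> x = 0" if "x \<notin> K" for x
    by (rule grad_zero_outside(2)[OF clK supp that])
  have contG: "continuous_on {a<..<b} G"
    using G by (meson DERIV_isCont continuous_at_imp_continuous_on greaterThanLessThan_iff)
  have cG: "continuous_on ?A (\<lambda>x. G (norm x))" "continuous_on ?A (\<lambda>x. G' (norm x))"
    by (auto intro!: continuous_on_compose2[OF contG] continuous_on_compose2[OF G'] continuous_intros)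
  have c\<phi>: "continuous_on ?A \<phi>" "continuous_on ?A (grad \<phi>)"
    using C1_on_continuous[OF \<phi>] C1_on_continuous_grad[OF \<phi>] by (auto intro: continuous_on_subset)
  define h where "h x = G (norm x) * \<phi> x" for x
  define H where "H x = G (norm x) *\<^sub>R grad \<phi> x + \<phi> x *\<^sub>R (G' (norm x) *\<^sub>R (x /\<^sub>R norm x))" for x
  have nz: "x \<noteq> 0" "norm x \<noteq> 0" if "x \<in> ?A" for x
    using that \<open>0 < a\<close> by auto
  have gh: "GDERIV h x :> H x" if "x \<in> ?A" for x
  proof -
    have "GDERIV norm x :> x /\<^sub>R norm x"
      using GDERIV_norm[OF nz(1)[OF that]] by (simp add: sgn_div_norm)
    then have "GDERIV (\<lambda>x. G (norm x)) x :> G' (norm x) *\<^sub>R (x /\<^sub>R norm x)"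
      by (rule GDERIV_DERIV_compose) (use G that in auto)
    from GDERIV_mult[OF this C1_on_GDERIV[OF \<phi> UNIV_I]] show ?thesis
      unfolding h_def H_def by simp
  qed
  have cH: "continuous_on ?A H"
    unfolding H_def using nz by (intro continuous_intros cG c\<phi>) auto
  have "C1_on ?A h" using gh cH by (rule C1_onI)
  then have C1h: "C1_on UNIV h"
    by (rule C1_on_glue_zero[OF openA clK K(2)]) (simp add: h_def supp)
  have grad_h: "grad h x = H x" if "x \<in> ?A" for x by (rule grad_eqI[OF gh[OF that]])
  have grad_h0: "grad h x = 0" if "x \<notin> K" for x
    by (rule grad_zero_outside(2)[OF clK _ that]) (simp add: h_def supp)
  have "(LINT x|lborel. (x \<bullet> grad h x) / norm x ^ ?N) = 0"
  proof (rule dilation_identity[OF C1h \<open>0 < a\<close>])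
    fix x :: 'a assume "norm x < a \<or> b < norm x"
    then have "x \<notin> K" using K(2) by auto
    then show "h x = 0" by (simp add: h_def supp)
  qed
  moreover have "(x \<bullet> grad h x) / norm x ^ ?N
      = G (norm x) / norm x ^ ?N * (x \<bullet> grad \<phi> x) + G' (norm x) / norm x ^ (?N - 1) * \<phi> x" for x
  proof (cases "x \<in> K")
    case False then show ?thesis by (simp add: grad_h0 supp gz)
  next
    case True
    then have x: "x \<in> ?A" using K(2) by auto
    have eq: "norm x ^ ?N = norm x * norm x ^ (?N - 1)"
      by (metis DIM_positive Suc_diff_1 power_Suc)
    have "x \<bullet> (x /\<^sub>R norm x) = norm x"
      using nz[OF x] by (simp add: power2_norm_eq_inner[symmetric] power2_eq_square)
    then have "x \<bullet> H x = G (norm x) * (x \<bullet> grad \<phi> x) + norm x * (G' (norm x) * \<phi> x)"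
      by (simp only: H_def inner_add_right inner_scaleR_right mult_ac)
    then have "(x \<bullet> grad h x) / norm x ^ ?N
        = (G (norm x) * (x \<bullet> grad \<phi> x) + norm x * (G' (norm x) * \<phi> x)) / norm x ^ ?N"
      by (simp only: grad_h[OF x])
    also have "\<dots> = G (norm x) * (x \<bullet> grad \<phi> x) / norm x ^ ?N
        + norm x * (G' (norm x) * \<phi> x) / norm x ^ ?N"
      by (rule add_divide_distrib)
    also have "norm x * (G' (norm x) * \<phi> x) / norm x ^ ?N = G' (norm x) * \<phi> x / norm x ^ (?N - 1)"
      by (subst eq, rule mult_divide_mult_cancel_left) (rule nz(2)[OF x])
    finally show ?thesis
      by (simp only: times_divide_eq_left)
  qed
  moreover have "integrable lborel (\<lambda>x. G (norm x) / norm x ^ ?N * (x \<bullet> grad \<phi> x))"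
  proof (rule integrable_compact_support[OF _ K(1)])
    show "continuous_on UNIV (\<lambda>x. G (norm x) / norm x ^ ?N * (x \<bullet> grad \<phi> x))"
    proof (rule continuous_on_glue_zero[OF openA clK K(2)])
      show "continuous_on ?A (\<lambda>x. G (norm x) / norm x ^ ?N * (x \<bullet> grad \<phi> x))"
        by (intro continuous_intros cG c\<phi>) (use \<open>0 < a\<close> in auto)
    qed (simp add: gz)
  qed (simp add: gz)
  moreover have "integrable lborel (\<lambda>x. G' (norm x) / norm x ^ (?N - 1) * \<phi> x)"
  proof (rule integrable_compact_support[OF _ K(1)])
    show "continuous_on UNIV (\<lambda>x. G' (norm x) / norm x ^ (?N - 1) * \<phi> x)"
    proof (rule continuous_on_glue_zero[OF openA clK K(2)])
      show "continuous_on ?A (\<lambda>x. G' (norm x) / norm x ^ (?N - 1) * \<phi> x)"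
        by (intro continuous_intros cG c\<phi>) (use \<open>0 < a\<close> in auto)
    qed (simp add: supp)
  qed (simp add: supp)
  ultimately show ?thesis by simp
qed

section \<open>Smooth approximation\<close>

lemma Ck_on_SucI:
  assumes "\<And>x. GDERIV f x :> F x" "\<And>b. b \<in> Basis \<Longrightarrow> Ck_on k UNIV (\<lambda>x. F x \<bullet> b)"
  shows "Ck_on (Suc k) UNIV f"
proof -
  have "grad f = F" using grad_eqI[OF assms(1)] by blast
  then show ?thesis using assms(2) GDERIV_differentiable[OF assms(1)] by simp
qed

lemma Ck_on_SucD_GDERIV: "Ck_on (Suc k) UNIV f \<Longrightarrow> GDERIV f x :> grad f x"
  by (simp add: gderiv_grad)

lemma Ck_on_lower: "Ck_on (Suc k) UNIV f \<Longrightarrow> Ck_on k UNIV f"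
proof (induction k arbitrary: f)
  case 0
  then show ?case
    by (auto intro!: continuous_at_imp_continuous_on differentiable_imp_continuous_within)
next
  case (Suc k)
  then have "\<forall>x\<in>UNIV. f differentiable (at x)" "\<forall>b\<in>Basis. Ck_on (Suc k) UNIV (\<lambda>x. grad f x \<bullet> b)"
    unfolding Ck_on.simps(2)[of "Suc k"] by blast+
  then have "\<forall>x\<in>UNIV. f differentiable (at x)" "\<forall>b\<in>Basis. Ck_on k UNIV (\<lambda>x. grad f x \<bullet> b)"
    using Suc.IH by blast+
  then show ?case by (subst Ck_on.simps(2)) blast
qed

lemma Ck_on_add:
  "Ck_on k UNIV f \<Longrightarrow> Ck_on k UNIV g \<Longrightarrow> Ck_on k UNIV (\<lambda>x. f x + g x)"
proof (induction k arbitrary: f g)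
  case 0 then show ?case by (auto intro: continuous_on_add)
next
  case (Suc k)
  show ?case
  proof (rule Ck_on_SucI)
    show "GDERIV (\<lambda>x. f x + g x) x :> grad f x + grad g x" for x
      using Suc.prems by (intro GDERIV_add Ck_on_SucD_GDERIV)
    show "Ck_on k UNIV (\<lambda>x. (grad f x + grad g x) \<bullet> b)" if "b \<in> Basis" for b
      using Suc.prems that Suc.IH[of "\<lambda>x. grad f x \<bullet> b" "\<lambda>x. grad g x \<bullet> b"]
      by (simp add: inner_add_left)
  qed
qed

lemma Ck_on_mult:
  "Ck_on k UNIV f \<Longrightarrow> Ck_on k UNIV g \<Longrightarrow> Ck_on k UNIV (\<lambda>x. f x * g x)"
proof (induction k arbitrary: f g)
  case 0 then show ?case by (auto intro: continuous_on_mult)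
next
  case (Suc k)
  show ?case
  proof (rule Ck_on_SucI)
    show "GDERIV (\<lambda>x. f x * g x) x :> f x *\<^sub>R grad g x + g x *\<^sub>R grad f x" for x
      using Suc.prems by (intro GDERIV_mult Ck_on_SucD_GDERIV)
    fix b :: 'a assume b: "b \<in> Basis"
    have "Ck_on k UNIV f" "Ck_on k UNIV g"
      using Suc.prems by (auto dest!: Ck_on_lower simp del: Ck_on.simps)
    then have "Ck_on k UNIV (\<lambda>x. f x * (grad g x \<bullet> b) + g x * (grad f x \<bullet> b))"
      using Suc.prems b by (intro Ck_on_add Suc.IH) auto
    then show "Ck_on k UNIV (\<lambda>x. (f x *\<^sub>R grad g x + g x *\<^sub>R grad f x) \<bullet> b)"
      by (simp add: inner_add_left)
  qed
qed

lemma Ck_on_const: "Ck_on k UNIV (\<lambda>x. c)"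
proof (induction k arbitrary: c)
  case (Suc k)
  show ?case by (rule Ck_on_SucI[where F = "\<lambda>_. 0"]) (use Suc[of 0] in \<open>auto intro: GDERIV_const\<close>)
qed simp

lemma Ck_on_inner: "Ck_on k UNIV (\<lambda>x. x \<bullet> c)"
proof (cases k)
  case (Suc j)
  have "GDERIV (\<lambda>x. x \<bullet> c) x :> c" for x :: 'a
    by (auto simp: gderiv_def intro!: derivative_eq_intros)
  then show ?thesis unfolding Suc by (rule Ck_on_SucI) (rule Ck_on_const)
qed (auto intro: continuous_intros)

text \<open>For P = 1 this is the classical function exp(-1/t), flat at 0. The polynomial factor in
  1/t closes the family under differentiation.\<close>

definition flat :: "real poly \<Rightarrow> real \<Rightarrow> real" where
  "flat P t = (if 0 < t then poly P (1 / t) * exp (- (1 / t)) else 0)"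

lemma poly_over_exp_tendsto_0: "((\<lambda>x. poly P x * exp (- x)) \<longlongrightarrow> (0::real)) at_top"
proof -
  have "((\<lambda>x::real. \<Sum>i\<le>degree P. coeff P i * (x ^ i / exp x)) \<longlongrightarrow> (\<Sum>i\<le>degree P. coeff P i * 0)) at_top"
    by (intro tendsto_sum tendsto_mult tendsto_const tendsto_power_div_exp_0)
  moreover have "(\<Sum>i\<le>degree P. coeff P i * (x ^ i / exp x)) = poly P x * exp (- x)" for x
    by (simp add: poly_altdef sum_distrib_right exp_minus divide_inverse mult.assoc)
  ultimately show ?thesis by simp
qed

text \<open>With x = 1/t one has dx/dt = - x^2, hence the polynomial x^2 (P - P'). At t = 0 the
  exponential beats every power of 1/t, and the difference quotient tends to 0.\<close>

lemma DERIV_flat: "(flat P has_real_derivative flat ([:0, 0, 1:] * (P - pderiv P)) t) (at t)"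
proof -
  let ?E = "\<lambda>t. poly P (1 / t) * exp (- (1 / t))"
  consider "0 < t" | "t < 0" | "t = 0" by linarith
  then show ?thesis
  proof cases
    case 1
    have "(?E has_real_derivative flat ([:0, 0, 1:] * (P - pderiv P)) t) (at t)"
      unfolding flat_def using 1
      by (auto intro!: derivative_eq_intros DERIV_chain'[OF _ poly_DERIV] simp: field_simps power2_eq_square)
    then show ?thesis
      by (rule has_field_derivative_transform_within_open[where S = "{0<..}"]) (use 1 in \<open>auto simp: flat_def\<close>)
  next
    case 2
    have "((\<lambda>_. 0) has_real_derivative flat ([:0, 0, 1:] * (P - pderiv P)) t) (at t)"
      using 2 by (simp add: flat_def)
    then show ?thesis
      by (rule has_field_derivative_transform_within_open[where S = "{..<0}"]) (use 2 in \<open>auto simp: flat_def\<close>)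
  next
    case 3
    have "((\<lambda>y. (flat P y - flat P 0) / (y - 0)) \<longlongrightarrow> 0) (at 0)"
    proof (rule filterlim_split_at)
      have "((\<lambda>x. 0::real) \<longlongrightarrow> 0) (at_left 0)" by simp
      then show "((\<lambda>y. (flat P y - flat P 0) / (y - 0)) \<longlongrightarrow> 0) (at_left 0)"
        by (rule Lim_transform_eventually) (auto simp: flat_def eventually_at_left_field intro!: exI[of _ "-1"])
      have "((\<lambda>y. poly (pCons 0 P) (inverse y) * exp (- inverse y)) \<longlongrightarrow> 0) (at_right 0)"
        by (rule filterlim_compose[OF poly_over_exp_tendsto_0 filterlim_inverse_at_top_right])
      then show "((\<lambda>y. (flat P y - flat P 0) / (y - 0)) \<longlongrightarrow> 0) (at_right 0)"
        by (rule Lim_transform_eventually)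
          (auto simp: flat_def eventually_at_right_field field_simps intro!: exI[of _ 1])
    qed
    then show ?thesis using 3 by (simp add: has_field_derivative_iff flat_def)
  qed
qed

text \<open>The factors Q and P are free because differentiation changes both: each partial
  derivative is a sum of two terms of the same shape, so the induction on k closes.\<close>

lemma Ck_on_flat_norm:
  assumes "\<And>k. Ck_on k UNIV Q"
  shows "Ck_on k UNIV (\<lambda>x::'a::euclidean_space. Q x * flat P (c - x \<bullet> x))"
  using assms
proof (induction k arbitrary: Q P)
  case 0
  have "continuous_on UNIV (flat P)"
    using DERIV_flat DERIV_isCont by (blast intro: continuous_at_imp_continuous_on)
  then have "continuous_on UNIV (\<lambda>x::'a. flat P (c - x \<bullet> x))"
    by (rule continuous_on_compose2) (auto intro!: continuous_intros)
  moreover have "continuous_on UNIV Q" using 0[of 0] by simp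
  ultimately show ?case by (simp add: continuous_on_mult)
next
  case (Suc k)
  let ?P = "[:0, 0, 1:] * (P - pderiv P)"
  show ?case
  proof (rule Ck_on_SucI)
    fix x :: 'a
    have "GDERIV (\<lambda>x. c - x \<bullet> x) x :> (- 2) *\<^sub>R x"
      by (auto simp: gderiv_def inner_commute intro!: derivative_eq_intros)
    then have "GDERIV (\<lambda>x. flat P (c - x \<bullet> x)) x :> flat ?P (c - x \<bullet> x) *\<^sub>R ((- 2) *\<^sub>R x)"
      by (rule GDERIV_DERIV_compose) (rule DERIV_flat)
    then show "GDERIV (\<lambda>x. Q x * flat P (c - x \<bullet> x)) x
        :> Q x *\<^sub>R (flat ?P (c - x \<bullet> x) *\<^sub>R ((- 2) *\<^sub>R x)) + flat P (c - x \<bullet> x) *\<^sub>R grad Q x"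
      using Suc.prems[of 1] by (intro GDERIV_mult) (auto intro: gderiv_grad)
  next
    fix b :: 'a assume b: "b \<in> Basis"
    have "Ck_on k UNIV (\<lambda>x. (Q x * (x \<bullet> ((- 2) *\<^sub>R b))) * flat ?P (c - x \<bullet> x))"
      by (intro Suc.IH Ck_on_mult Suc.prems Ck_on_inner)
    moreover have "Ck_on k UNIV (\<lambda>x. (grad Q x \<bullet> b) * flat P (c - x \<bullet> x))"
      using Suc.prems[of "Suc _"] b by (intro Suc.IH) auto
    ultimately have "Ck_on k UNIV (\<lambda>x. (Q x * (x \<bullet> ((- 2) *\<^sub>R b))) * flat ?P (c - x \<bullet> x)
        + (grad Q x \<bullet> b) * flat P (c - x \<bullet> x))"
      by (rule Ck_on_add)
    then show "Ck_on k UNIV (\<lambda>x. (Q x *\<^sub>R (flat ?P (c - x \<bullet> x) *\<^sub>R ((- 2) *\<^sub>R x))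
        + flat P (c - x \<bullet> x) *\<^sub>R grad Q x) \<bullet> b)"
      by (simp only: inner_add_left inner_scaleR_left inner_scaleR_right mult_ac)
  qed
qed

lemma continuous_integral_pos:
  fixes g :: "'a::euclidean_space \<Rightarrow> real"
  assumes cont: "continuous_on UNIV g" and int: "integrable lborel g"
    and nonneg: "\<And>x. 0 \<le> g x" and "0 < g x0"
  shows "0 < (LINT x|lborel. g x)"
proof (rule ccontr)
  assume "\<not> ?thesis"
  then have "(LINT x|lborel. g x) = 0"
    using Bochner_Integration.integral_nonneg[of lborel g] nonneg by fastforce
  then have AE: "AE x in lborel. g x = 0"
    using integral_nonneg_eq_0_iff_AE[OF int] nonneg by simp
  have "open {x. 0 < g x}"
    by (intro open_Collect_less continuous_intros cont)
  then obtain r where r: "0 < r" "ball x0 r \<subseteq> {x. 0 < g x}"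
    using \<open>0 < g x0\<close> by (elim openE[of _ x0]) auto
  from AE have "AE x in lborel. x \<notin> ball x0 r"
    by eventually_elim (use r(2) in force)
  then have "emeasure lborel (ball x0 r) = 0"
    by (subst (asm) AE_iff_measurable[where N = "ball x0 r"]) auto
  then show False
    using r(1) unit_ball_vol_pos[OF of_nat_0_le_iff, of "DIM('a)"] zero_less_power[OF r(1), of "DIM('a)"]
    by (auto simp: emeasure_ball ennreal_eq_0_iff mult_le_0_iff)
qed

lemma smooth_bump_exists:
  assumes "0 < d"
  obtains \<rho> :: "'a::euclidean_space \<Rightarrow> real"
  where "\<And>k. Ck_on k UNIV \<rho>" "\<And>x. 0 \<le> \<rho> x" "\<And>x. d \<le> norm x \<Longrightarrow> \<rho> x = 0" "(LINT x|lborel. \<rho> x) = 1"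
proof -
  define \<beta> :: "'a \<Rightarrow> real" where "\<beta> x = flat 1 (d\<^sup>2 - x \<bullet> x)" for x
  have \<beta>: "Ck_on k UNIV \<beta>" for k
    using Ck_on_flat_norm[of "\<lambda>_. 1" k 1 "d\<^sup>2"] by (simp add: Ck_on_const \<beta>_def[abs_def])
  have nonneg: "0 \<le> \<beta> x" for x by (simp add: \<beta>_def flat_def)
  have sq: "x \<bullet> x < d\<^sup>2 \<longleftrightarrow> norm x < d" for x :: 'a
    using assms power2_less_imp_less[of "norm x" d] power_strict_mono[of "norm x" d 2]
    by (auto simp: power2_norm_eq_inner[symmetric])
  have zero: "\<beta> x = 0" if "d \<le> norm x" for x using sq[of x] that by (simp add: \<beta>_def flat_def)
  have pos: "0 < \<beta> x" if "norm x < d" for x using sq[of x] that by (simp add: \<beta>_def flat_def)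
  have cont: "continuous_on UNIV \<beta>" using \<beta>[of 0] by simp
  have int: "integrable lborel \<beta>"
    by (rule integrable_compact_support[OF cont compact_cball[of 0 d]]) (simp add: zero)
  have I: "0 < (LINT x|lborel. \<beta> x)"
    using pos[of 0] assms by (intro continuous_integral_pos[OF cont int nonneg, of 0]) simp
  show ?thesis
  proof
    show "Ck_on k UNIV (\<lambda>x. (1 / (LINT x|lborel. \<beta> x)) * \<beta> x)" for k
      by (intro Ck_on_mult Ck_on_const \<beta>)
  qed (use I nonneg zero in auto)
qed

section \<open>Mollification\<close>

lemma lborel_integral_reflect:
  fixes f :: "'a::euclidean_space \<Rightarrow> real"
  assumes [measurable]: "f \<in> borel_measurable borel"
  shows "(LINT y|lborel. f y) = (LINT z|lborel. f (x - z))"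
proof -
  have "(LINT y|lborel. f y)
      = (LINT y|density (distr lborel borel (\<lambda>z. x + (- 1) *\<^sub>R z)) (\<lambda>_. ennreal (\<bar>- 1\<bar> ^ DIM('a))). f y)"
    by (rule arg_cong[where f = "\<lambda>M. LINT y|M. f y", OF lborel_affine]) simp
  also have "\<dots> = (LINT y|distr lborel borel (\<lambda>z. x + (- 1) *\<^sub>R z). f y)"
    by (subst integral_density) auto
  also have "\<dots> = (LINT z|lborel. f (x + (- 1) *\<^sub>R z))"
    by (subst integral_distr) auto
  finally show ?thesis by simp
qed

text \<open>Integration over a fixed box allows differentiation under the integral sign. In the
  application the box contains the support of the factor that is not differentiated.\<close>

lemma GDERIV_convolution:
  fixes \<psi> \<eta> :: "'a::euclidean_space \<Rightarrow> real"
  assumes \<psi>: "continuous_on UNIV \<psi>" and \<eta>: "C1_on UNIV \<eta>"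
  shows "GDERIV (\<lambda>x. integral (cbox c d) (\<lambda>y. \<psi> y * \<eta> (x - y))) x
    :> integral (cbox c d) (\<lambda>y. \<psi> y *\<^sub>R grad \<eta> (x - y))"
proof -
  note cont = C1_on_continuous[OF \<eta>] C1_on_continuous_grad[OF \<eta>]
  let ?f = "\<lambda>x y. blinfun_inner_left (\<psi> y *\<^sub>R grad \<eta> (x - y))"
  have int: "(\<lambda>y. \<psi> y *\<^sub>R grad \<eta> (x - y)) integrable_on cbox c d"
    by (intro integrable_continuous continuous_intros continuous_on_compose2[OF \<psi>]
        continuous_on_compose2[OF cont(2)]) auto
  have "((\<lambda>x. integral (cbox c d) (\<lambda>y. \<psi> y * \<eta> (x - y))) has_derivative integral (cbox c d) (?f x))
      (at x within UNIV)"
  proof (rule leibniz_rule)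
    fix x y :: 'a
    have "(\<eta> has_derivative (\<lambda>v. v \<bullet> grad \<eta> (x - y))) (at (x - y))"
      using \<eta> by (intro has_derivative_grad) (auto simp: C1_on_def)
    moreover have "((\<lambda>x. x - y) has_derivative (\<lambda>v. v)) (at x)"
      by (auto intro!: derivative_eq_intros)
    ultimately have "((\<lambda>x. \<eta> (x - y)) has_derivative (\<lambda>v. v \<bullet> grad \<eta> (x - y))) (at x)"
      by (rule has_derivative_compose[rotated])
    then have "((\<lambda>x. \<psi> y * \<eta> (x - y)) has_derivative (\<lambda>v. \<psi> y * (v \<bullet> grad \<eta> (x - y)))) (at x)"
      by (rule has_derivative_mult_right)
    then show "((\<lambda>x. \<psi> y * \<eta> (x - y)) has_derivative blinfun_apply (?f x y)) (at x within UNIV)"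
      by simp
  next
    fix x :: 'a
    show "(\<lambda>y. \<psi> y * \<eta> (x - y)) integrable_on cbox c d"
      by (intro integrable_continuous continuous_intros continuous_on_compose2[OF \<psi>]
          continuous_on_compose2[OF cont(1)]) auto
  next
    show "continuous_on (UNIV \<times> cbox c d) (\<lambda>(x, y). ?f x y)"
      unfolding split_beta
      by (intro bounded_linear.continuous_on[OF bounded_linear_blinfun_inner_left] continuous_intros
          continuous_on_compose2[OF \<psi>] continuous_on_compose2[OF cont(2)]) auto
  qed auto
  moreover have "integral (cbox c d) (?f x) = blinfun_inner_left (integral (cbox c d) (\<lambda>y. \<psi> y *\<^sub>R grad \<eta> (x - y)))"
    using integral_linear[OF int bounded_linear_blinfun_inner_left] by (simp add: o_def)
  ultimately show ?thesis
    by (simp add: gderiv_def blinfun_inner_left.rep_eq[abs_def])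
qed

lemma Ck_on_convolution:
  fixes \<psi> \<eta> :: "'a::euclidean_space \<Rightarrow> real"
  assumes \<psi>: "continuous_on UNIV \<psi>" and "\<And>k. Ck_on k UNIV \<eta>"
  shows "Ck_on k UNIV (\<lambda>x. integral (cbox c d) (\<lambda>y. \<psi> y * \<eta> (x - y)))"
  using assms(2)
proof (induction k arbitrary: \<eta>)
  case 0
  have "C1_on UNIV \<eta>" using 0[of 1] Ck_on_1_iff_C1_on by blast
  from GDERIV_convolution[OF \<psi> this]
  show ?case
    using GDERIV_differentiable differentiable_imp_continuous_within
    by (fastforce intro: continuous_at_imp_continuous_on)
next
  case (Suc k)
  have C1: "C1_on UNIV \<eta>" using Suc.prems[of 1] Ck_on_1_iff_C1_on by blast
  show ?case
  proof (rule Ck_on_SucI)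
    show "GDERIV (\<lambda>x. integral (cbox c d) (\<lambda>y. \<psi> y * \<eta> (x - y))) x
      :> integral (cbox c d) (\<lambda>y. \<psi> y *\<^sub>R grad \<eta> (x - y))" for x
      by (rule GDERIV_convolution[OF \<psi> C1])
    fix b :: 'a assume b: "b \<in> Basis"
    have int: "(\<lambda>y. \<psi> y *\<^sub>R grad \<eta> (x - y)) integrable_on cbox c d" for x
      by (intro integrable_continuous continuous_intros continuous_on_compose2[OF \<psi>]
          continuous_on_compose2[OF C1_on_continuous_grad[OF C1]]) auto
    have "Ck_on k UNIV (\<lambda>x. integral (cbox c d) (\<lambda>y. \<psi> y * (grad \<eta> (x - y) \<bullet> b)))"
      using Suc.prems[of "Suc _"] b by (intro Suc.IH[where \<eta> = "\<lambda>x. grad \<eta> x \<bullet> b"]) auto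
    moreover have "integral (cbox c d) (\<lambda>y. \<psi> y *\<^sub>R grad \<eta> (x - y)) \<bullet> b
        = integral (cbox c d) (\<lambda>y. \<psi> y * (grad \<eta> (x - y) \<bullet> b))" for x
      using integral_component_eq[OF int, of x b] by simp
    ultimately show "Ck_on k UNIV (\<lambda>x. integral (cbox c d) (\<lambda>y. \<psi> y *\<^sub>R grad \<eta> (x - y)) \<bullet> b)"
      by simp
  qed
qed

lemma uniformly_continuous_compact_support:
  fixes f :: "'a::euclidean_space \<Rightarrow> 'b::real_normed_vector"
  assumes cont: "continuous_on UNIV f" and K: "compact K" "\<And>x. x \<notin> K \<Longrightarrow> f x = 0" and "0 < e"
  obtains d where "0 < d" "\<And>x z. norm z < d \<Longrightarrow> norm (f (x - z) - f x) < e"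
proof -
  \<comment> \<open>Enlarging K by the unit ball covers all pairs x, x - z with |z| \<le> 1 of which
    at least one lies in K; for the other pairs both values vanish.\<close>
  define K' where "K' = {x + y | x y. x \<in> K \<and> y \<in> cball 0 1}"
  have "compact K'" unfolding K'_def by (intro compact_sums K compact_cball)
  then have "uniformly_continuous_on K' f"
    by (intro compact_uniformly_continuous) (auto intro: continuous_on_subset[OF cont])
  then obtain d where d: "0 < d" "\<And>x y. x \<in> K' \<Longrightarrow> y \<in> K' \<Longrightarrow> dist y x < d \<Longrightarrow> dist (f y) (f x) < e"
    using \<open>0 < e\<close> by (rule uniformly_continuous_onE) blast
  show ?thesis
  proof
    show "0 < min d 1" using d by simp
    fix x z :: 'a assume z: "norm z < min d 1"
    have *: "u + v \<in> K'" if "u \<in> K" "norm v \<le> 1" for u v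
      using that unfolding K'_def by (intro CollectI exI[of _ u] exI[of _ v]) auto
    have "x \<in> K'" "x - z \<in> K'" if "x \<in> K \<or> x - z \<in> K"
      using that *[of x 0] *[of x "- z"] *[of "x - z" 0] *[of "x - z" z] z by auto
    then show "norm (f (x - z) - f x) < e"
      using d(2)[of x "x - z"] z K(2) \<open>0 < e\<close>
      by (cases "x \<in> K \<or> x - z \<in> K") (auto simp: dist_norm)
  qed
qed

text \<open>The convolution is used in two forms. With derivatives on the kernel it is smooth; after
  the reflection in \<open>swap\<close> they fall on \<phi>, so the gradient of \<theta> is the
  mollified gradient of \<phi> and converges uniformly.\<close>

lemma C1_approximation:
  fixes \<phi> :: "'a::euclidean_space \<Rightarrow> real"
  assumes \<phi>: "C1_on UNIV \<phi>" and K: "compact K" "\<And>x. x \<notin> K \<Longrightarrow> \<phi> x = 0"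
    and nonneg: "\<And>x. 0 \<le> \<phi> x" and "0 < e" "0 < d"
  obtains \<theta> where "\<And>k. Ck_on k UNIV \<theta>" "\<And>x. 0 \<le> \<theta> x"
    "\<And>x. \<theta> x \<noteq> 0 \<Longrightarrow> \<exists>y\<in>K. dist y x \<le> d"
    "\<And>x. \<bar>\<theta> x - \<phi> x\<bar> \<le> e" "\<And>x. norm (grad \<theta> x - grad \<phi> x) \<le> e"
proof -
  note c\<phi> = C1_on_continuous[OF \<phi>] and cg = C1_on_continuous_grad[OF \<phi>]
  have gz: "grad \<phi> x = 0" if "x \<notin> K" for x
    by (rule grad_zero_outside(2)[OF compact_imp_closed[OF K(1)] K(2) that])
  obtain d1 where d1: "0 < d1" "\<And>x z. norm z < d1 \<Longrightarrow> norm (\<phi> (x - z) - \<phi> x) < e"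
    using uniformly_continuous_compact_support[OF c\<phi> K \<open>0 < e\<close>] by blast
  obtain d2 where d2: "0 < d2" "\<And>x z. norm z < d2 \<Longrightarrow> norm (grad \<phi> (x - z) - grad \<phi> x) < e"
    using uniformly_continuous_compact_support[OF cg K(1) gz \<open>0 < e\<close>] by blast
  define r where "r = min d (min d1 d2)"
  have r: "0 < r" "r \<le> d" "r \<le> d1" "r \<le> d2" using d1 d2 \<open>0 < d\<close> by (auto simp: r_def)
  obtain \<rho> :: "'a \<Rightarrow> real" where \<rho>: "\<And>k. Ck_on k UNIV \<rho>" "\<And>x. 0 \<le> \<rho> x" "\<And>x. r \<le> norm x \<Longrightarrow> \<rho> x = 0"
    "(LINT x|lborel. \<rho> x) = 1"
    using smooth_bump_exists[OF r(1)] by blast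
  have c\<rho>: "continuous_on UNIV \<rho>" using \<rho>(1)[of 0] by simp
  obtain a where a: "K \<subseteq> cbox (- a) a"
    using bounded_subset_cbox_symmetric[OF compact_imp_bounded[OF K(1)]] by blast
  obtain b where b: "cball (0::'a) r \<subseteq> cbox (- b) b"
    using bounded_subset_cbox_symmetric[OF bounded_cball] by blast
  define \<theta> where "\<theta> x = integral (cbox (- a) a) (\<lambda>y. \<phi> y * \<rho> (x - y))" for x
  have cprod: "continuous_on UNIV (\<lambda>y. \<phi> y * \<rho> (x - y))" "continuous_on UNIV (\<lambda>z. \<rho> z * \<phi> (x - z))" for x
    by (intro continuous_intros continuous_on_compose2[OF c\<phi>] continuous_on_compose2[OF c\<rho>]; simp)+
  have swap: "\<theta> x = integral (cbox (- b) b) (\<lambda>z. \<rho> z * \<phi> (x - z))" for x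
  proof -
    have "\<theta> x = (LINT y|lborel. \<phi> y * \<rho> (x - y))"
      unfolding \<theta>_def by (rule integral_compact_support[symmetric, OF cprod(1) a K(1)]) (simp add: K(2))
    also have "\<dots> = (LINT z|lborel. \<phi> (x - z) * \<rho> (x - (x - z)))"
      by (rule lborel_integral_reflect) (rule borel_measurable_continuous_onI[OF cprod(1)])
    also have "\<dots> = (LINT z|lborel. \<rho> z * \<phi> (x - z))" by (simp add: mult.commute)
    also have "\<dots> = integral (cbox (- b) b) (\<lambda>z. \<rho> z * \<phi> (x - z))"
      by (rule integral_compact_support[OF cprod(2) b compact_cball]) (simp add: \<rho>(3))
    finally show ?thesis .
  qed
  have \<theta>_grad: "grad \<theta> x = integral (cbox (- b) b) (\<lambda>z. \<rho> z *\<^sub>R grad \<phi> (x - z))" for x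
    by (rule grad_eqI) (use GDERIV_convolution[OF c\<rho> \<phi>] in \<open>simp add: swap[abs_def]\<close>)
  have int\<rho>: "integral (cbox (- b) b) \<rho> = 1"
    using integral_compact_support[OF c\<rho> b compact_cball] \<rho> by simp
  have close: "norm (integral (cbox (- b) b) (\<lambda>z. \<rho> z *\<^sub>R f (x - z)) - f x) \<le> e"
    if cf: "continuous_on UNIV f" and f: "\<And>z. norm z < r \<Longrightarrow> norm (f (x - z) - f x) < e" for f :: "'a \<Rightarrow> 'b::euclidean_space" and x
  proof -
    have i1: "(\<lambda>z. \<rho> z *\<^sub>R f (x - z)) integrable_on cbox (- b) b"
      by (intro integrable_continuous continuous_intros continuous_on_compose2[OF cf]
          continuous_on_subset[OF c\<rho>]) auto
    have i2: "(\<lambda>z. \<rho> z *\<^sub>R f x) integrable_on cbox (- b) b"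
      by (intro integrable_continuous continuous_intros continuous_on_subset[OF c\<rho>]) auto
    have i3: "\<rho> integrable_on cbox (- b) b"
      by (intro integrable_continuous continuous_on_subset[OF c\<rho>]) auto
    have "integral (cbox (- b) b) (\<lambda>z. \<rho> z *\<^sub>R f x) = integral (cbox (- b) b) \<rho> *\<^sub>R f x"
      using integral_linear[OF i3 bounded_linear_scaleR_left[of "f x"]] by (simp add: o_def)
    then have "integral (cbox (- b) b) (\<lambda>z. \<rho> z *\<^sub>R f (x - z)) - f x
        = integral (cbox (- b) b) (\<lambda>z. \<rho> z *\<^sub>R f (x - z) - \<rho> z *\<^sub>R f x)"
      using int\<rho> by (simp add: Henstock_Kurzweil_Integration.integral_diff[OF i1 i2])
    also have "norm \<dots> \<le> integral (cbox (- b) b) (\<lambda>z. e * \<rho> z)"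
    proof (rule Henstock_Kurzweil_Integration.integral_norm_bound_integral)
      show "(\<lambda>z. \<rho> z *\<^sub>R f (x - z) - \<rho> z *\<^sub>R f x) integrable_on cbox (- b) b"
        using i1 i2 by (rule integrable_diff)
      show "(\<lambda>z. e * \<rho> z) integrable_on cbox (- b) b"
        using integrable_cmul[OF i3, of e] by simp
      show "norm (\<rho> z *\<^sub>R f (x - z) - \<rho> z *\<^sub>R f x) \<le> e * \<rho> z" for z
      proof (cases "norm z < r")
        case True
        have "norm (\<rho> z *\<^sub>R f (x - z) - \<rho> z *\<^sub>R f x) = \<rho> z * norm (f (x - z) - f x)"
          using \<rho>(2)[of z] by (simp flip: scaleR_diff_right)
        also have "\<dots> \<le> \<rho> z * e" using \<rho>(2) f[OF True] by (intro mult_left_mono) auto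
        finally show ?thesis by (simp add: mult.commute)
      qed (simp add: \<rho>(3))
    qed
    also have "\<dots> = e" using int\<rho> by simp
    finally show ?thesis .
  qed
  show ?thesis
  proof
    show "Ck_on k UNIV \<theta>" for k
      unfolding \<theta>_def[abs_def] by (rule Ck_on_convolution[OF c\<phi> \<rho>(1)])
    show "0 \<le> \<theta> x" for x
      unfolding \<theta>_def using nonneg \<rho>(2)
      by (intro Henstock_Kurzweil_Integration.integral_nonneg integrable_continuous
          continuous_on_subset[OF cprod(1)]) auto
    show "\<exists>y\<in>K. dist y x \<le> d" if "\<theta> x \<noteq> 0" for x
    proof (rule ccontr)
      assume *: "\<not> ?thesis"
      have "\<phi> y * \<rho> (x - y) = 0" for y
        using * K(2)[of y] \<rho>(3)[of "x - y"] r(2) by (cases "y \<in> K") (force simp: dist_norm norm_minus_commute)+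
      then have "(\<lambda>y. \<phi> y * \<rho> (x - y)) = (\<lambda>_. 0)" by (rule ext)
      then show False using that by (simp only: \<theta>_def Henstock_Kurzweil_Integration.integral_0)
    qed
    show "\<bar>\<theta> x - \<phi> x\<bar> \<le> e" for x
      using close[OF c\<phi>, of x] d1(2)[of _ x] r(3) by (simp add: swap)
    show "norm (grad \<theta> x - grad \<phi> x) \<le> e" for x
      using close[OF cg, of x] d2(2)[of _ x] r(4) by (simp add: \<theta>_grad)
  qed
qed

section \<open>Comparison principle\<close>

text \<open>Squaring makes the positive part continuously differentiable, so the comparison
  principle can be tested within the class C1.\<close>

lemma DERIV_max_square: "((\<lambda>y::real. (max 0 y)\<^sup>2) has_real_derivative 2 * max 0 y) (at y)"
proof -
  consider "0 < y" | "y < 0" | "y = 0" by linarith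
  then show ?thesis
  proof cases
    case 1
    have "((\<lambda>y::real. y\<^sup>2) has_real_derivative 2 * max 0 y) (at y)"
      using 1 by (auto intro!: derivative_eq_intros)
    then show ?thesis
      by (rule has_field_derivative_transform_within_open[where S = "{0<..}"]) (use 1 in auto)
  next
    case 2
    have "((\<lambda>y::real. 0) has_real_derivative 2 * max 0 y) (at y)"
      using 2 by simp
    then show ?thesis
      by (rule has_field_derivative_transform_within_open[where S = "{..<0}"]) (use 2 in auto)
  next
    case 3
    have "((\<lambda>y. ((max 0 y)\<^sup>2 - (max 0 0)\<^sup>2) / (y - 0)) \<longlongrightarrow> (0::real)) (at 0)"
    proof (rule Lim_null_comparison)
      show "((\<lambda>y. \<bar>y\<bar>) \<longlongrightarrow> (0::real)) (at 0)"
        by (rule tendsto_rabs_zero) (rule tendsto_ident_at)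
      show "\<forall>\<^sub>F y in at (0::real). norm (((max 0 y)\<^sup>2 - (max 0 0)\<^sup>2) / (y - 0)) \<le> \<bar>y\<bar>"
        by (rule always_eventually) (auto simp: max_def power2_eq_square)
    qed
    then show ?thesis using 3 by (simp add: has_field_derivative_iff)
  qed
qed

context flux_profile
begin

text \<open>Solutions are tested with smooth functions, comparison needs C1 functions. The mollified
  test functions have supports in one compact set \<open>K'\<close> and converge uniformly together
  with their gradients, while the field and F are integrable on \<open>K'\<close>.\<close>

lemma weak_identity_extends:
  fixes u :: "'a::euclidean_space \<Rightarrow> real"
  assumes S: "open S" and u: "C1_on S u"
    and F: "\<And>K. compact K \<Longrightarrow> K \<subseteq> S \<Longrightarrow> set_integrable lborel K F"
    and weak: "\<And>\<theta> K. (\<And>k. Ck_on k UNIV \<theta>) \<Longrightarrow> compact K \<Longrightarrow> K \<subseteq> S \<Longrightarrow> (\<And>x. x \<notin> K \<Longrightarrow> \<theta> x = 0) \<Longrightarrow>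
      (LINT x|lborel. field (grad u x) \<bullet> grad \<theta> x) = (LINT x|lborel. F x * \<theta> x)"
    and \<phi>: "C1_on UNIV \<phi>" and K: "compact K" "K \<subseteq> S" "\<And>x. x \<notin> K \<Longrightarrow> \<phi> x = 0"
    and nonneg: "\<And>x. 0 \<le> \<phi> x"
  shows "(LINT x|lborel. field (grad u x) \<bullet> grad \<phi> x) = (LINT x|lborel. F x * \<phi> x)"
proof -
  obtain d0 where d0: "0 < d0" "\<And>x y. x \<in> K \<Longrightarrow> y \<in> - S \<Longrightarrow> d0 \<le> dist x y"
    using separate_compact_closed[OF K(1), of "- S"] S K(2) by (auto simp: closed_open disjoint_eq_subset_Compl)
  \<comment> \<open>Half the distance from K to the complement of S, so that K enlarged by d still
    lies in S.\<close>
  define d where "d = d0 / 2"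
  define K' where "K' = {x + y | x y. x \<in> K \<and> y \<in> cball 0 d}"
  have cK': "compact K'" unfolding K'_def by (intro compact_sums K compact_cball)
  have nearK: "x \<in> K'" if "y \<in> K" "dist y x \<le> d" for x y
    unfolding K'_def
    by (intro CollectI exI[of _ y] exI[of _ "x - y"]) (use that in \<open>auto simp: dist_norm norm_minus_commute\<close>)
  have K'S: "K' \<subseteq> S"
  proof
    fix x assume "x \<in> K'"
    then obtain y z where yz: "x = y + z" "y \<in> K" "norm z \<le> d" by (auto simp: K'_def)
    then have "dist y x < d0" using d0(1) by (simp add: dist_norm d_def)
    then show "x \<in> S" using d0(2)[OF yz(2), of x] by auto
  qed
  have KK': "K \<subseteq> K'" using nearK d0(1) by (auto simp: d_def)
  define A where "A x = field (grad u x)" for x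
  have contA: "continuous_on S A"
    unfolding A_def using C1_on_continuous_grad[OF u]
    by (intro continuous_on_compose2[OF continuous_on_field[of UNIV]]) auto
  define CA where "CA = (LINT x:K'|lborel. norm (A x))"
  define CF where "CF = (LINT x:K'|lborel. \<bar>F x\<bar>)"
  have intA: "set_integrable lborel K' A"
    unfolding set_integrable_def
    by (rule borel_integrable_compact[OF cK']) (rule continuous_on_subset[OF contA K'S])
  have intF: "set_integrable lborel K' F" by (rule F[OF cK' K'S])
  have bdA: "integrable lborel (\<lambda>x. A x \<bullet> w x)"
      "\<bar>LINT x|lborel. A x \<bullet> w x\<bar> \<le> e * CA"
    if w: "continuous_on UNIV w" "\<And>x. norm (w x) \<le> e" "\<And>x. x \<notin> K' \<Longrightarrow> w x = 0" for w e
  proof -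
    have "continuous_on K' (\<lambda>x. A x \<bullet> w x)"
      by (intro continuous_intros continuous_on_subset[OF contA K'S] continuous_on_subset[OF w(1)]) auto
    then have "integrable lborel (\<lambda>x. indicator K' x *\<^sub>R (A x \<bullet> w x))"
      by (rule borel_integrable_compact[OF cK'])
    moreover have "(\<lambda>x. indicator K' x *\<^sub>R (A x \<bullet> w x)) = (\<lambda>x. A x \<bullet> w x)"
      by (rule ext) (use w(3) in \<open>auto simp: indicator_def\<close>)
    ultimately show int: "integrable lborel (\<lambda>x. A x \<bullet> w x)" by simp
    have "\<bar>LINT x|lborel. A x \<bullet> w x\<bar> \<le> (LINT x|lborel. e * (indicator K' x *\<^sub>R norm (A x)))"
    proof (rule Bochner_Integration.integral_abs_bound_integral[OF int])
      show "integrable lborel (\<lambda>x. e * (indicator K' x *\<^sub>R norm (A x)))"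
        using set_integrable_norm[OF intA] by (simp add: set_integrable_def)
      show "\<bar>A x \<bullet> w x\<bar> \<le> e * (indicator K' x *\<^sub>R norm (A x))" for x
      proof (cases "x \<in> K'")
        case True
        have "\<bar>A x \<bullet> w x\<bar> \<le> norm (A x) * norm (w x)" by (rule Cauchy_Schwarz_ineq2)
        also have "\<dots> \<le> norm (A x) * e" by (intro mult_left_mono w) auto
        finally show ?thesis using True by (simp add: mult.commute)
      qed (simp add: w(3))
    qed
    then show "\<bar>LINT x|lborel. A x \<bullet> w x\<bar> \<le> e * CA"
      by (simp add: CA_def set_lebesgue_integral_def)
  qed
  have bdF: "integrable lborel (\<lambda>x. F x * w x)"
      "\<bar>LINT x|lborel. F x * w x\<bar> \<le> e * CF"
    if w: "continuous_on UNIV w" "\<And>x. \<bar>w x\<bar> \<le> e" "\<And>x. x \<notin> K' \<Longrightarrow> w x = 0" for w e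
  proof -
    have [measurable]: "w \<in> borel_measurable borel" by (rule borel_measurable_continuous_onI[OF w(1)])
    have int': "integrable lborel (\<lambda>x. indicator K' x *\<^sub>R F x)"
      using intF by (simp add: set_integrable_def)
    have eq: "(\<lambda>x. F x * w x) = (\<lambda>x. (indicator K' x *\<^sub>R F x) * w x)"
      by (rule ext) (use w(3) in \<open>auto simp: indicator_def\<close>)
    have bd: "\<bar>(indicator K' x *\<^sub>R F x) * w x\<bar> \<le> e * \<bar>indicator K' x *\<^sub>R F x\<bar>" for x
      using mult_right_mono[OF w(2)[of x], of "\<bar>indicator K' x *\<^sub>R F x\<bar>"] by (simp add: abs_mult mult_ac)
    have inte: "integrable lborel (\<lambda>x. e * \<bar>indicator K' x *\<^sub>R F x\<bar>)"
      using int' by (intro integrable_mult_right integrable_abs)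
    show int: "integrable lborel (\<lambda>x. F x * w x)"
      unfolding eq
    proof (rule Bochner_Integration.integrable_bound[OF inte])
      show "(\<lambda>x. indicator K' x *\<^sub>R F x * w x) \<in> borel_measurable lborel"
        using borel_measurable_integrable[OF int'] by measurable
      show "AE x in lborel. norm (indicator K' x *\<^sub>R F x * w x) \<le> norm (e * \<bar>indicator K' x *\<^sub>R F x\<bar>)"
        using bd by (intro always_eventually allI) (simp only: real_norm_def, smt (verit))
    qed
    have "\<bar>LINT x|lborel. F x * w x\<bar> \<le> (LINT x|lborel. e * \<bar>indicator K' x *\<^sub>R F x\<bar>)"
      using int inte bd unfolding eq by (intro Bochner_Integration.integral_abs_bound_integral) auto
    then show "\<bar>LINT x|lborel. F x * w x\<bar> \<le> e * CF"
      by (simp add: CF_def set_lebesgue_integral_def abs_mult)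
  qed
  have gz: "grad \<phi> x = 0" if "x \<notin> K" for x
    by (rule grad_zero_outside(2)[OF compact_imp_closed[OF K(1)] K(3) that])
  have close: "\<bar>(LINT x|lborel. A x \<bullet> grad \<phi> x) - (LINT x|lborel. F x * \<phi> x)\<bar> \<le> e * (CA + CF)" if e: "0 < e" for e
  proof -
    obtain \<theta> where \<theta>: "\<And>k. Ck_on k UNIV \<theta>" "\<And>x. 0 \<le> \<theta> x"
      "\<And>x. \<theta> x \<noteq> 0 \<Longrightarrow> \<exists>y\<in>K. dist y x \<le> d"
      "\<And>x. \<bar>\<theta> x - \<phi> x\<bar> \<le> e" "\<And>x. norm (grad \<theta> x - grad \<phi> x) \<le> e"
      using C1_approximation[OF \<phi> K(1,3) nonneg e, of d] d0(1) unfolding d_def by (metis half_gt_zero)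
    have C1\<theta>: "C1_on UNIV \<theta>" using \<theta>(1)[of 1] Ck_on_1_iff_C1_on by blast
    have supp: "\<theta> x = 0" if "x \<notin> K'" for x using \<theta>(3)[of x] nearK that by blast
    have g\<theta>: "grad \<theta> x = 0" if "x \<notin> K'" for x
      by (rule grad_zero_outside(2)[OF compact_imp_closed[OF cK'] supp that])
    note c = C1_on_continuous[OF \<phi>] C1_on_continuous[OF C1\<theta>] C1_on_continuous_grad[OF \<phi>] C1_on_continuous_grad[OF C1\<theta>]
    have e1: "integrable lborel (\<lambda>x. A x \<bullet> (grad \<theta> x - grad \<phi> x))"
        "\<bar>LINT x|lborel. A x \<bullet> (grad \<theta> x - grad \<phi> x)\<bar> \<le> e * CA"
      by (rule bdA[OF continuous_on_diff[OF c(4,3)] \<theta>(5)]; use gz g\<theta> KK' in auto)+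
    have e2: "integrable lborel (\<lambda>x. F x * (\<theta> x - \<phi> x))"
        "\<bar>LINT x|lborel. F x * (\<theta> x - \<phi> x)\<bar> \<le> e * CF"
      by (rule bdF[OF continuous_on_diff[OF c(2,1)] \<theta>(4)]; use K(3) supp KK' in auto)+
    obtain B1 where "\<forall>x\<in>K. norm (grad \<phi> x) \<le> B1"
      using compact_imp_bounded[OF compact_continuous_image[OF continuous_on_subset[OF c(3)] K(1)]]
      by (auto simp: bounded_iff)
    then have B1: "norm (grad \<phi> x) \<le> max 0 B1" for x using gz[of x] by (cases "x \<in> K") auto
    obtain B2 where "\<forall>x\<in>K. \<bar>\<phi> x\<bar> \<le> B2"
      using compact_imp_bounded[OF compact_continuous_image[OF continuous_on_subset[OF c(1)] K(1)]]
      by (auto simp: bounded_iff)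
    then have B2: "\<bar>\<phi> x\<bar> \<le> max 0 B2" for x using K(3)[of x] by (cases "x \<in> K") auto
    have i1: "integrable lborel (\<lambda>x. A x \<bullet> grad \<phi> x)"
      by (rule bdA(1)[OF c(3) B1]) (use gz KK' in auto)
    have i2: "integrable lborel (\<lambda>x. F x * \<phi> x)"
      by (rule bdF(1)[OF c(1) B2]) (use K(3) KK' in auto)
    have "(LINT x|lborel. A x \<bullet> grad \<theta> x) = (LINT x|lborel. F x * \<theta> x)"
      unfolding A_def by (rule weak[OF \<theta>(1) cK' K'S supp])
    moreover have "(LINT x|lborel. A x \<bullet> grad \<theta> x)
        = (LINT x|lborel. A x \<bullet> (grad \<theta> x - grad \<phi> x)) + (LINT x|lborel. A x \<bullet> grad \<phi> x)"
      by (subst Bochner_Integration.integral_add[OF e1(1) i1, symmetric]) (simp add: inner_diff_right)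
    moreover have "(LINT x|lborel. F x * \<theta> x)
        = (LINT x|lborel. F x * (\<theta> x - \<phi> x)) + (LINT x|lborel. F x * \<phi> x)"
      by (subst Bochner_Integration.integral_add[OF e2(1) i2, symmetric]) (simp add: algebra_simps)
    ultimately show ?thesis using e1(2) e2(2) by (simp add: algebra_simps)
  qed
  have "\<bar>(LINT x|lborel. A x \<bullet> grad \<phi> x) - (LINT x|lborel. F x * \<phi> x)\<bar> \<le> 0"
  proof (rule ccontr)
    let ?D = "\<bar>(LINT x|lborel. A x \<bullet> grad \<phi> x) - (LINT x|lborel. F x * \<phi> x)\<bar>"
    assume "\<not> ?D \<le> 0"
    then have D: "0 < ?D" by simp
    have "?D \<le> 1 * (CA + CF)" by (rule close) simp
    then have C: "0 < CA + CF" using D by simp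
    \<comment> \<open>The error bound holds for every positive e; this value turns it into
      \<open>?D \<le> ?D / 2\<close>.\<close>
    have "?D \<le> (?D / (2 * (CA + CF))) * (CA + CF)" using C D by (intro close) simp
    also have "\<dots> = ?D / 2"
    proof -
      have "x / (2 * c) * c = x / 2" if "0 < c" for x c :: real using that by simp
      then show ?thesis using C by blast
    qed
    finally have "?D \<le> ?D / 2" .
    then show False using D by simp
  qed
  then show ?thesis by (simp add: A_def)
qed

text \<open>The test function is the square of the positive part of V - u - e. The shift e > 0 and
  the boundary inequalities push its support into the open annulus. The weak inequalities then give
  a nonpositive integral of the difference of the fields against grad \<phi>, whereas monotonicity
  makes the integrand nonnegative. So grad \<phi> = 0 and \<phi> is a constant.\<close>

lemma comparison:
  fixes u :: "'a::euclidean_space \<Rightarrow> real"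
  assumes lb: "0 < l" "l < b" and S: "open S" "{x. l \<le> norm x \<and> norm x \<le> b} \<subseteq> S" and u: "C1_on S u"
    and G: "\<And>t. l < t \<Longrightarrow> t < b \<Longrightarrow> (G has_real_derivative G' t) (at t)" "continuous_on {l<..<b} G'"
    and V: "\<And>t. l < t \<Longrightarrow> t < b \<Longrightarrow> (V has_real_derivative - Psi (G t / t ^ (DIM('a) - 1))) (at t)"
      "continuous_on {l..b} V"
    and super: "\<And>\<phi> K. C1_on UNIV \<phi> \<Longrightarrow> compact K \<Longrightarrow> K \<subseteq> {x. l < norm x \<and> norm x < b} \<Longrightarrow>
      (\<And>x. x \<notin> K \<Longrightarrow> \<phi> x = 0) \<Longrightarrow> (\<And>x. 0 \<le> \<phi> x) \<Longrightarrow>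
      (LINT x|lborel. G' (norm x) / norm x ^ (DIM('a) - 1) * \<phi> x) \<le> (LINT x|lborel. field (grad u x) \<bullet> grad \<phi> x)"
    and bd: "\<And>x. norm x = l \<Longrightarrow> V l \<le> u x" "\<And>x. norm x = b \<Longrightarrow> V b \<le> u x"
    and x: "l \<le> norm x" "norm x \<le> b"
  shows "V (norm x) \<le> u x"
proof (rule ccontr)
  let ?N = "DIM('a)" and ?A = "{x::'a. l < norm x \<and> norm x < b}" and ?B = "{x::'a. l \<le> norm x \<and> norm x \<le> b}"
  assume "\<not> V (norm x) \<le> u x"
  define e where "e = (V (norm x) - u x) / 2"
  have "0 < e" using \<open>\<not> V (norm x) \<le> u x\<close> by (simp add: e_def)
  define w where "w y = V (norm y) - u y - e" for y
  have wx: "0 < w x" using \<open>0 < e\<close> by (simp add: w_def e_def field_simps)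
  have AB: "?A \<subseteq> ?B" by auto
  have openA: "open ?A" by (intro open_Collect_conj open_Collect_less continuous_intros)
  have closedB: "closed ?B" by (intro closed_Collect_conj closed_Collect_le continuous_intros)
  have compB: "compact ?B"
    using compact_Int_closed[OF compact_cball[of 0 b] closedB] by (simp add: Int_def conj_ac)
  have cu: "continuous_on ?B u" by (rule continuous_on_subset[OF C1_on_continuous[OF u] S(2)])
  have cw: "continuous_on ?B w"
    unfolding w_def by (intro continuous_intros cu continuous_on_compose2[OF V(2)]) auto
  define K where "K = {y \<in> ?B. 0 \<le> w y}"
  have "closed K"
    using continuous_closed_preimage[OF cw closedB closed_atLeast[of 0]]
    by (simp add: K_def vimage_def Int_def)
  then have compK: "compact K"
    using compact_Int_closed[OF compB, of K] by (simp add: K_def Int_def conj_ac)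
  have KA: "K \<subseteq> ?A"
  proof
    fix y assume y: "y \<in> K"
    have "norm y \<noteq> l" using bd(1)[of y] y \<open>0 < e\<close> by (auto simp: K_def w_def)
    moreover have "norm y \<noteq> b" using bd(2)[of y] y \<open>0 < e\<close> by (auto simp: K_def w_def)
    ultimately show "y \<in> ?A" using y by (auto simp: K_def)
  qed
  define \<phi> where "\<phi> y = (if y \<in> ?A then (max 0 (w y))\<^sup>2 else 0)" for y
  have supp: "\<phi> y = 0" if "y \<notin> K" for y
    using that by (auto simp: \<phi>_def K_def)
  have \<phi>_nonneg: "0 \<le> \<phi> y" for y by (auto simp: \<phi>_def)
  have nzA: "y \<noteq> 0" "0 < norm y" if "y \<in> ?A" for y using that lb by auto
  define gv where "gv y = (- Psi (G (norm y) / norm y ^ (?N - 1))) *\<^sub>R (y /\<^sub>R norm y)" for y :: 'a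
  have gv: "GDERIV (\<lambda>y. V (norm y)) y :> gv y" if y: "y \<in> ?A" for y
  proof -
    have "GDERIV norm y :> y /\<^sub>R norm y"
      using GDERIV_norm[OF nzA(1)[OF y]] by (simp add: sgn_div_norm)
    then show ?thesis unfolding gv_def
      by (rule GDERIV_DERIV_compose) (use V(1) y in auto)
  qed
  have gu: "GDERIV u y :> grad u y" if "y \<in> ?A" for y
    using C1_on_GDERIV[OF u] that S(2) AB by blast
  define h where "h y = (2 * max 0 (w y)) *\<^sub>R (gv y - grad u y)" for y
  have g\<phi>A: "GDERIV \<phi> y :> h y" if y: "y \<in> ?A" for y
  proof -
    have "GDERIV w y :> gv y - grad u y - 0"
      unfolding w_def[abs_def] by (intro GDERIV_diff gv gu y GDERIV_const)
    then have "GDERIV (\<lambda>y. (max 0 (w y))\<^sup>2) y :> (2 * max 0 (w y)) *\<^sub>R (gv y - grad u y - 0)"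
      by (rule GDERIV_DERIV_compose) (rule DERIV_max_square)
    then have "GDERIV (\<lambda>y. (max 0 (w y))\<^sup>2) y :> h y" by (simp add: h_def)
    then show ?thesis
      by (rule GDERIV_transform_open[OF _ openA y]) (simp add: \<phi>_def)
  qed
  have cG: "continuous_on {l<..<b} G"
    using G(1) by (meson DERIV_isCont continuous_at_imp_continuous_on greaterThanLessThan_iff)
  have cgv: "continuous_on ?A gv"
    unfolding gv_def using lb
    by (intro continuous_intros continuous_on_compose2[OF cG]) auto
  have cgu: "continuous_on ?A (grad u)"
    using C1_on_continuous_grad[OF u] S(2) AB by (auto intro: continuous_on_subset)
  have ch: "continuous_on ?A h"
    unfolding h_def by (intro continuous_intros cgv cgu continuous_on_subset[OF cw AB])
  have C1\<phi>: "C1_on UNIV \<phi>"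
    by (rule C1_on_glue_zero[OF openA \<open>closed K\<close> KA C1_onI[OF g\<phi>A ch] supp])
  have g\<phi>: "grad \<phi> y = h y" if "y \<in> ?A" for y by (rule grad_eqI[OF g\<phi>A[OF that]])
  have g\<phi>0: "grad \<phi> y = 0" if "y \<notin> K" for y
    by (rule grad_zero_outside(2)[OF \<open>closed K\<close> supp that])
  have fgv: "field (gv y) = - ((G (norm y) / norm y ^ ?N) *\<^sub>R y)" if y: "y \<in> ?A" for y
  proof -
    have "field (gv y) = Phi (- Psi (G (norm y) / norm y ^ (?N - 1))) *\<^sub>R (y /\<^sub>R norm y)"
      unfolding gv_def by (rule field_scaleR_unit) (use nzA[OF y] in simp)
    also have "\<dots> = - ((G (norm y) / (norm y ^ (?N - 1) * norm y)) *\<^sub>R y)"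
      by (simp add: divide_inverse)
    also have "norm y ^ (?N - 1) * norm y = norm y ^ ?N"
      by (metis DIM_positive Suc_diff_1 power_Suc2)
    finally show ?thesis .
  qed
  have Lv: "(LINT y|lborel. G (norm y) / norm y ^ ?N * (y \<bullet> grad \<phi> y))
      = - (LINT y|lborel. G' (norm y) / norm y ^ (?N - 1) * \<phi> y)"
    by (rule radial_field_weak[OF lb(1) G C1\<phi> compK KA supp])
  have Lu: "(LINT y|lborel. G' (norm y) / norm y ^ (?N - 1) * \<phi> y) \<le> (LINT y|lborel. field (grad u y) \<bullet> grad \<phi> y)"
    by (rule super[OF C1\<phi> compK KA supp \<phi>_nonneg])
  define I where "I y = (field (gv y) - field (grad u y)) \<bullet> grad \<phi> y" for y
  have I0: "I y = 0" if "y \<notin> K" for y using g\<phi>0[OF that] by (simp add: I_def)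
  have cf: "continuous_on ?A (\<lambda>y. field (gv y))" "continuous_on ?A (\<lambda>y. field (grad u y))"
    by (auto intro: continuous_on_compose2[OF continuous_on_field[of UNIV]] cgv cgu)
  have cg\<phi>: "continuous_on ?A (grad \<phi>)" using C1_on_continuous_grad[OF C1\<phi>] by (rule continuous_on_subset) simp
  have cont1: "continuous_on UNIV (\<lambda>y. field (gv y) \<bullet> grad \<phi> y)"
    by (rule continuous_on_glue_zero[OF openA \<open>closed K\<close> KA]) (use g\<phi>0 in \<open>auto intro!: continuous_on_inner cf cg\<phi>\<close>)
  have cont2: "continuous_on UNIV (\<lambda>y. field (grad u y) \<bullet> grad \<phi> y)"
    by (rule continuous_on_glue_zero[OF openA \<open>closed K\<close> KA]) (use g\<phi>0 in \<open>auto intro!: continuous_on_inner cf cg\<phi>\<close>)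
  have int1: "integrable lborel (\<lambda>y. field (gv y) \<bullet> grad \<phi> y)"
    by (rule integrable_compact_support[OF cont1 compK]) (simp add: g\<phi>0)
  have int2: "integrable lborel (\<lambda>y. field (grad u y) \<bullet> grad \<phi> y)"
    by (rule integrable_compact_support[OF cont2 compK]) (simp add: g\<phi>0)
  have I_eq: "I = (\<lambda>y. field (gv y) \<bullet> grad \<phi> y - field (grad u y) \<bullet> grad \<phi> y)"
    by (auto simp: I_def inner_diff_left)
  have contI: "continuous_on UNIV I" unfolding I_eq by (intro continuous_on_diff cont1 cont2)
  have intI: "integrable lborel I" unfolding I_eq by (intro Bochner_Integration.integrable_diff int1 int2)
  have "(LINT y|lborel. field (gv y) \<bullet> grad \<phi> y) = - (LINT y|lborel. G (norm y) / norm y ^ ?N * (y \<bullet> grad \<phi> y))"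
  proof -
    have "field (gv y) \<bullet> grad \<phi> y = - (G (norm y) / norm y ^ ?N * (y \<bullet> grad \<phi> y))" for y
    proof (cases "y \<in> K")
      case True
      then have "y \<in> ?A" using KA by blast
      then show ?thesis by (simp add: fgv)
    qed (simp add: g\<phi>0)
    then show ?thesis by simp
  qed
  then have LI: "(LINT y|lborel. I y) \<le> 0"
    unfolding I_eq using Lv Lu by (simp add: Bochner_Integration.integral_diff[OF int1 int2])
  have Inn: "I y = (2 * max 0 (w y)) * ((field (gv y) - field (grad u y)) \<bullet> (gv y - grad u y))" if "y \<in> ?A" for y
    using g\<phi>[OF that] by (simp add: I_def h_def)
  have I_nonneg: "0 \<le> I y" for y
  proof (cases "y \<in> K")
    case True
    then have "y \<in> ?A" using KA by blast
    then show ?thesis unfolding Inn[OF \<open>y \<in> ?A\<close>] by (intro mult_nonneg_nonneg field_monotone(1)) auto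
  qed (simp add: I0)
  have I_zero: "I y = 0" for y
    using continuous_integral_pos[OF contI intI I_nonneg, of y] I_nonneg[of y] LI by force
  have "grad \<phi> y = 0" for y
  proof (cases "y \<in> K \<and> 0 < w y")
    case True
    then have y: "y \<in> ?A" using KA by blast
    have "(field (gv y) - field (grad u y)) \<bullet> (gv y - grad u y) = 0"
      using Inn[OF y] I_zero[of y] True by simp
    then have "gv y = grad u y" by (rule field_monotone(2))
    then show ?thesis using g\<phi>[OF y] by (simp add: h_def)
  next
    case False
    show ?thesis
    proof (cases "y \<in> K")
      case True
      then have "y \<in> ?A" "w y \<le> 0" using KA False by auto
      then show ?thesis using g\<phi>[of y] by (simp add: h_def)
    qed (rule g\<phi>0)
  qed
  then have "(\<phi> has_derivative (\<lambda>h. 0)) (at y within UNIV)" for y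
    using has_derivative_grad[of \<phi> y] C1\<phi> by (simp add: C1_on_def)
  then obtain c where c: "\<And>y. \<phi> y = c"
    using has_derivative_zero_constant[OF convex_UNIV, of \<phi>] by auto
  \<comment> \<open>A point of norm b + 1 lies outside the support, so the constant is 0.\<close>
  obtain b0 :: 'a where "b0 \<in> Basis" using nonempty_Basis by blast
  then have "(b + 1) *\<^sub>R b0 \<notin> K" using lb by (auto simp: K_def)
  then have "c = 0" using supp c by metis
  moreover have "x \<in> K" using x wx by (simp add: K_def)
  then have "x \<in> ?A" using KA by blast
  then have "\<phi> x = (w x)\<^sup>2" using wx by (simp add: \<phi>_def)
  ultimately show False using c[of x] wx by simp
qed

end

section \<open>Barriers for exterior supersolutions\<close>

lemma powr_integral_bound:
  fixes b0 :: real
  assumes "0 < b0" "0 < l" "l \<le> b"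
  shows "(\<lambda>t. t powr (- 1 - b0)) integrable_on {l..b}"
    and "integral {l..b} (\<lambda>t. t powr (- 1 - b0)) \<le> l powr (- b0) / b0"
proof -
  have "((\<lambda>t. t powr (- 1 - b0)) has_integral ((- (b powr (- b0) / b0)) - (- (l powr (- b0) / b0)))) {l..b}"
  proof (rule fundamental_theorem_of_calculus)
    fix t assume "t \<in> {l..b}"
    then have "0 < t" using assms by auto
    then have "((\<lambda>t. - (t powr (- b0) / b0)) has_real_derivative t powr (- 1 - b0)) (at t within {l..b})"
      using assms by (auto intro!: derivative_eq_intros simp: minus_diff_commute[of b0 1])
    then show "((\<lambda>t. - (t powr (- b0) / b0)) has_vector_derivative t powr (- 1 - b0)) (at t within {l..b})"
      by (simp add: has_real_derivative_iff_has_vector_derivative)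
  qed (use assms in auto)
  then show "(\<lambda>t. t powr (- 1 - b0)) integrable_on {l..b}"
    and "integral {l..b} (\<lambda>t. t powr (- 1 - b0)) \<le> l powr (- b0) / b0"
    using assms by (auto simp: has_integral_integrable integral_unique)
qed

locale exterior_supersolution = flux_profile a s for a :: "real \<Rightarrow> real" and s :: real +
  fixes u F :: "'a::euclidean_space \<Rightarrow> real" and N :: nat
  assumes N_eq: "N = DIM('a)" and s_less_dim: "s < real N"
    and u_C1: "C1_on (- cball 0 1) u"
    and u_pos: "\<And>x. 1 < norm x \<Longrightarrow> 0 < u x"
    and F_nonneg: "\<And>x. 1 < norm x \<Longrightarrow> 0 \<le> F x"
    and F_integrable: "\<And>K. compact K \<Longrightarrow> K \<subseteq> - cball 0 1 \<Longrightarrow> set_integrable lborel K F"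
    and super: "\<And>\<phi> K. C1_on UNIV \<phi> \<Longrightarrow> compact K \<Longrightarrow> K \<subseteq> - cball 0 1 \<Longrightarrow>
      (\<And>x. x \<notin> K \<Longrightarrow> \<phi> x = 0) \<Longrightarrow> (\<And>x. 0 \<le> \<phi> x) \<Longrightarrow>
      (LINT x|lborel. F x * \<phi> x) \<le> (LINT x|lborel. field (grad u x) \<bullet> grad \<phi> x)"
begin

text \<open>|x|^(-decay) is the fundamental solution of the s-Laplacian up to a factor; a constant
  flux forces this rate.\<close>

definition decay :: real where "decay = (real N - s) / (s - 1)"
definition \<gamma> :: real where "\<gamma> = 1 / (s - 1)"
text \<open>The factor 2^N collects what \<open>flux_barrier_value\<close> loses: 2^(N-1) from the
  doubled radius and 2 from \<open>Psi_lower\<close>.\<close>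

definition c0 :: real where "c0 = (1 / 2 ^ N) powr \<gamma>"

lemma decay_pos: "0 < decay"
  using s_less_dim s_gt_1 by (simp add: decay_def)

lemma gamma_pos: "0 < \<gamma>"
  using s_gt_1 by (simp add: \<gamma>_def)

lemma c0_pos: "0 < c0"
  by (simp add: c0_def)

lemma dim_ge_2: "2 \<le> N"
proof -
  have "1 < real N" using s_less_dim s_gt_1 by linarith
  then show ?thesis by simp
qed

lemma gamma_dim: "(real N - 1) * \<gamma> = 1 + decay"
  using s_gt_1 by (simp add: \<gamma>_def decay_def field_simps)

lemma gamma_cancel: "(s - 1) * \<gamma> = 1"
  using s_gt_1 by (simp add: \<gamma>_def)

lemma decay_cancel: "decay * (s - 1) = real N - s"
  using s_gt_1 by (simp add: decay_def)

lemma power_dim_powr: "0 < t \<Longrightarrow> (t ^ (N - 1)) powr \<gamma> = t powr (1 + decay)"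
  using dim_ge_2 by (simp add: powr_realpow[symmetric] powr_powr gamma_dim of_nat_diff)

text \<open>\<open>comparison\<close> for the barrier written as C minus its accumulated slope.
  Since F is only compared with G' |x|^(1-N) pointwise, G can be any flux whose source stays below
  F.\<close>

lemma barrier_below:
  assumes l: "1 < l" "l < b"
    and G: "\<And>t. l < t \<Longrightarrow> t < b \<Longrightarrow> (G has_real_derivative G' t) (at t)" "continuous_on {l<..<b} G'"
      "continuous_on {l..b} G"
    and FG: "\<And>x. l < norm x \<Longrightarrow> norm x < b \<Longrightarrow> G' (norm x) / norm x ^ (N - 1) \<le> F x"
    and bd: "\<And>x. norm x = l \<Longrightarrow> C \<le> u x"
      "\<And>x. norm x = b \<Longrightarrow> C - integral {l..b} (\<lambda>t. Psi (G t / t ^ (N - 1))) \<le> u x"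
    and x: "l \<le> norm x" "norm x \<le> b"
  shows "C - integral {l..norm x} (\<lambda>t. Psi (G t / t ^ (N - 1))) \<le> u x"
proof -
  let ?p = "\<lambda>t. Psi (G t / t ^ (N - 1))"
  let ?A = "{x::'a. l < norm x \<and> norm x < b}"
  define V where "V t = C - integral {l..t} ?p" for t
  have cp: "continuous_on {l..b} ?p"
    using l by (intro continuous_intros G(3)) auto
  have intd: "((\<lambda>t. integral {l..t} ?p) has_real_derivative ?p t) (at t within {l..b})" if "t \<in> {l..b}" for t
    by (rule integral_has_real_derivative[OF cp that])
  have dV: "(V has_real_derivative - ?p t) (at t within {l..b})" if "t \<in> {l..b}" for t
    unfolding V_def using intd[OF that] by (auto intro!: derivative_eq_intros)
  have "V (norm x) \<le> u x"
  proof (rule comparison[where 'a = 'a, folded N_eq, where S = "- cball 0 1" and u = u and l = l and b = b and G = G and G' = G'])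
    show "{x. l \<le> norm x \<and> norm x \<le> b} \<subseteq> - cball 0 1" using l by auto
    show "(V has_real_derivative - ?p t) (at t)" if t: "l < t" "t < b" for t
      using dV[of t] t at_within_Icc_at[of l t b] by auto
    show "continuous_on {l..b} V"
      by (rule DERIV_continuous_on) (rule dV)
    show "V l \<le> u x" if "norm x = l" for x using bd(1)[OF that] by (simp add: V_def)
    show "V b \<le> u x" if "norm x = b" for x using bd(2)[OF that] by (simp add: V_def)
    fix \<phi> :: "'a \<Rightarrow> real" and K
    assume \<phi>: "C1_on UNIV \<phi>" "compact K" "K \<subseteq> ?A" "\<And>x. x \<notin> K \<Longrightarrow> \<phi> x = 0" "\<And>x. 0 \<le> \<phi> x"
    have openA: "open ?A" by (intro open_Collect_conj open_Collect_less continuous_intros)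
    have K1: "K \<subseteq> - cball 0 1" using \<phi>(3) l by auto
    have c\<phi>: "continuous_on UNIV \<phi>" by (rule C1_on_continuous[OF \<phi>(1)])
    have "(LINT x|lborel. G' (norm x) / norm x ^ (N - 1) * \<phi> x) \<le> (LINT x|lborel. F x * \<phi> x)"
    proof (rule Bochner_Integration.integral_mono)
      show "integrable lborel (\<lambda>x. G' (norm x) / norm x ^ (N - 1) * \<phi> x)"
      proof (rule integrable_compact_support[OF _ \<phi>(2)])
        show "continuous_on UNIV (\<lambda>x. G' (norm x) / norm x ^ (N - 1) * \<phi> x)"
        proof (rule continuous_on_glue_zero[OF openA compact_imp_closed[OF \<phi>(2)] \<phi>(3)])
          show "continuous_on ?A (\<lambda>x. G' (norm x) / norm x ^ (N - 1) * \<phi> x)"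
            using l by (intro continuous_intros continuous_on_compose2[OF G(2)]
                continuous_on_subset[OF c\<phi>]) auto
        qed (simp add: \<phi>(4))
      qed (simp add: \<phi>(4))
      obtain B where B: "\<forall>x\<in>K. \<bar>\<phi> x\<bar> \<le> B"
        using compact_imp_bounded[OF compact_continuous_image[OF continuous_on_subset[OF c\<phi>] \<phi>(2)]]
        by (auto simp: bounded_iff)
      have intF: "integrable lborel (\<lambda>x. indicator K x *\<^sub>R F x)"
        using F_integrable[OF \<phi>(2) K1] by (simp add: set_integrable_def)
      have m\<phi>: "\<phi> \<in> borel_measurable borel" by (rule borel_measurable_continuous_onI[OF c\<phi>])
      have "integrable lborel (\<lambda>x. (indicator K x *\<^sub>R F x) * \<phi> x)"
      proof (rule Bochner_Integration.integrable_bound)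
        show "integrable lborel (\<lambda>x. B * (indicator K x *\<^sub>R F x))"
          by (rule integrable_mult_right) (rule intF)
        show "(\<lambda>x. (indicator K x *\<^sub>R F x) * \<phi> x) \<in> borel_measurable lborel"
          using borel_measurable_integrable[OF intF] m\<phi> by measurable
        have "\<bar>(indicator K x *\<^sub>R F x) * \<phi> x\<bar> \<le> \<bar>B * (indicator K x *\<^sub>R F x)\<bar>" for x
        proof (cases "x \<in> K")
          case True
          then have "\<bar>\<phi> x\<bar> \<le> \<bar>B\<bar>" using B by force
          then show ?thesis using True
            by (simp add: abs_mult mult.commute[of "\<bar>F x\<bar>"] mult_right_mono)
        qed simp
        then show "AE x in lborel. norm ((indicator K x *\<^sub>R F x) * \<phi> x) \<le> norm (B * (indicator K x *\<^sub>R F x))"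
          by simp
      qed
      moreover have "(\<lambda>x. (indicator K x *\<^sub>R F x) * \<phi> x) = (\<lambda>x. F x * \<phi> x)"
        by (rule ext) (use \<phi>(4) in \<open>auto simp: indicator_def\<close>)
      ultimately show "integrable lborel (\<lambda>x. F x * \<phi> x)" by simp
      fix x :: 'a
      show "G' (norm x) / norm x ^ (N - 1) * \<phi> x \<le> F x * \<phi> x"
      proof (cases "x \<in> K")
        case True
        then have "x \<in> ?A" using \<phi>(3) by blast
        then show ?thesis using FG[of x] \<phi>(5)[of x] by (intro mult_right_mono) auto
      qed (simp add: \<phi>(4))
    qed
    also have "\<dots> \<le> (LINT x|lborel. field (grad u x) \<bullet> grad \<phi> x)"
      by (rule super[OF \<phi>(1,2) K1 \<phi>(4,5)])
    finally show "(LINT x|lborel. G' (norm x) / norm x ^ (N - 1) * \<phi> x)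
      \<le> (LINT x|lborel. field (grad u x) \<bullet> grad \<phi> x)" .
  qed (use l x G u_C1 in auto)
  then show ?thesis by (simp add: V_def)
qed

text \<open>With the outer sphere at radius 2 |x|, the barrier is 0 there and u > 0. At x there
  remains the integral of the slope over [|x|, 2 |x|], bounded below by the flux at the left end and
  the power of the radius at the right end.\<close>

lemma flux_barrier:
  assumes l: "1 < l"
    and G: "\<And>t. l < t \<Longrightarrow> (G has_real_derivative G' t) (at t)" "continuous_on {l<..} G'"
      "continuous_on {l..} G"
    and Gnn: "0 \<le> G l" and Gmono: "\<And>x y. l \<le> x \<Longrightarrow> x \<le> y \<Longrightarrow> G x \<le> G y"
    and FG: "\<And>x. l < norm x \<Longrightarrow> G' (norm x) / norm x ^ (N - 1) \<le> F x"
    and bd: "\<And>x. norm x = l \<Longrightarrow> \<mu> \<le> u x"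
      "\<And>b. l < b \<Longrightarrow> integral {l..b} (\<lambda>t. Psi (G t / t ^ (N - 1))) \<le> \<mu>"
    and x: "l \<le> norm x"
  shows "norm x * Psi (G (norm x) / (2 * norm x) ^ (N - 1)) \<le> u x"
proof -
  let ?p = "\<lambda>t. Psi (G t / t ^ (N - 1))"
  let ?t = "norm x"
  let ?b = "2 * ?t"
  have lb: "l < ?b" using l x by simp
  have cp: "continuous_on {l..} ?p"
    using l by (intro continuous_intros G(3)) auto
  have intp: "?p integrable_on {c..d}" if "l \<le> c" for c d
    by (rule integrable_continuous_interval) (rule continuous_on_subset[OF cp], use that in auto)
  have "integral {l..?b} ?p - integral {l..?t} ?p \<le> u x"
  proof (rule barrier_below[where G' = G' and b = ?b])
    show "continuous_on {l<..<2 * norm x} G'" by (rule continuous_on_subset[OF G(2)]) auto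
    show "continuous_on {l..2 * norm x} G" by (rule continuous_on_subset[OF G(3)]) auto
    show "integral {l..?b} ?p \<le> u y" if "norm y = l" for y
      using bd(1)[OF that] bd(2)[OF lb] by linarith
    show "integral {l..?b} ?p - integral {l..?b} ?p \<le> u y" if "norm y = ?b" for y
      using u_pos[of y] that lb l by simp
  qed (use l lb x G(1) FG in auto)
  moreover have "integral {l..?t} ?p + integral {?t..?b} ?p = integral {l..?b} ?p"
    by (rule Henstock_Kurzweil_Integration.integral_combine) (use x intp in auto)
  moreover have "integral {?t..?b} (\<lambda>_. Psi (G ?t / ?b ^ (N - 1))) \<le> integral {?t..?b} ?p"
  proof (rule integral_le)
    fix \<tau> assume \<tau>: "\<tau> \<in> {?t..?b}"
    have "0 \<le> G ?t" using Gnn Gmono[of l ?t] x by simp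
    moreover have "G ?t \<le> G \<tau>" using Gmono[of ?t \<tau>] \<tau> x by simp
    moreover have "\<tau> ^ (N - 1) \<le> ?b ^ (N - 1)" using \<tau> x l by (intro power_mono) auto
    moreover have "0 < \<tau> ^ (N - 1)" using \<tau> x l by (intro zero_less_power) auto
    ultimately show "Psi (G ?t / ?b ^ (N - 1)) \<le> ?p \<tau>"
      unfolding Psi_le_iff by (intro frac_le) auto
  qed (use x intp in auto)
  ultimately show ?thesis by simp
qed

text \<open>The bound on E keeps the argument of \<open>Psi\<close> in [0, 1], the range of
  \<open>Psi_lower\<close>.\<close>

lemma flux_barrier_value:
  assumes "0 < t" "0 \<le> E" "E \<le> (2 * t) ^ (N - 1)"
  shows "c0 * E powr \<gamma> * t powr (- decay) \<le> t * Psi (E / (2 * t) ^ (N - 1))"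
proof -
  have "(E / (2 * t) ^ (N - 1) / 2) powr \<gamma> \<le> Psi (E / (2 * t) ^ (N - 1))"
    unfolding \<gamma>_def using assms by (intro Psi_lower) (auto simp: divide_le_eq)
  then have "t * (E / (2 * t) ^ (N - 1) / 2) powr \<gamma> \<le> t * Psi (E / (2 * t) ^ (N - 1))"
    using assms by (intro mult_left_mono) auto
  moreover have "E / (2 * t) ^ (N - 1) / 2 = (1 / 2 ^ N) * E / t ^ (N - 1)"
  proof -
    have "(2::real) ^ N = 2 * 2 ^ (N - 1)" using dim_ge_2 by (metis Suc_diff_1 power_Suc pos2 order_less_le_trans)
    then show ?thesis by (simp add: power_mult_distrib)
  qed
  moreover have "t * ((1 / 2 ^ N) * E / t ^ (N - 1)) powr \<gamma> = c0 * E powr \<gamma> * t powr (- decay)"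
  proof -
    have "t * ((1 / 2 ^ N) * E / t ^ (N - 1)) powr \<gamma> = c0 * E powr \<gamma> * (t / t powr (1 + decay))"
      unfolding power_dim_powr[OF assms(1), symmetric] c0_def powr_divide powr_mult by simp
    moreover have "t / t powr (1 + decay) = t powr (- decay)"
      using assms by (simp add: powr_add powr_minus field_simps)
    ultimately show ?thesis by (simp only:)
  qed
  ultimately show ?thesis by (simp only:)
qed

lemma Psi_flux_upper:
  assumes "0 < t" "0 \<le> E" shows "Psi (E / t ^ (N - 1)) \<le> E powr \<gamma> * t powr (- 1 - decay)"
proof -
  have "Psi (E / t ^ (N - 1)) \<le> (E / t ^ (N - 1)) powr \<gamma>"
    unfolding \<gamma>_def using assms by (intro Psi_upper) auto
  also have "\<dots> = E powr \<gamma> / t powr (1 + decay)"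
    using power_dim_powr[OF assms(1)] by (simp add: powr_divide)
  also have "\<dots> = E powr \<gamma> * t powr (- 1 - decay)"
    using powr_minus_divide[of t "1 + decay"] by simp
  finally show ?thesis .
qed

lemma constant_flux_integral:
  assumes "0 < l" "l \<le> b" "0 \<le> E"
  shows "integral {l..b} (\<lambda>t. Psi (E / t ^ (N - 1))) \<le> E powr \<gamma> * (l powr (- decay) / decay)"
proof -
  have "integral {l..b} (\<lambda>t. Psi (E / t ^ (N - 1))) \<le> integral {l..b} (\<lambda>t. E powr \<gamma> * t powr (- 1 - decay))"
  proof (rule integral_le)
    show "(\<lambda>t. Psi (E / t ^ (N - 1))) integrable_on {l..b}"
      using assms by (intro integrable_continuous_interval continuous_intros) auto
    show "(\<lambda>t. E powr \<gamma> * t powr (- 1 - decay)) integrable_on {l..b}"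
      using integrable_cmul[OF powr_integral_bound(1)[OF decay_pos assms(1,2)], of "E powr \<gamma>"] by simp
  qed (use assms Psi_flux_upper in auto)
  also have "\<dots> = E powr \<gamma> * integral {l..b} (\<lambda>t. t powr (- 1 - decay))"
    by simp
  also have "\<dots> \<le> E powr \<gamma> * (l powr (- decay) / decay)"
    using powr_integral_bound(2)[OF decay_pos assms(1,2)] by (intro mult_left_mono) auto
  finally show ?thesis .
qed

lemma decay_from_sphere:
  assumes l: "1 < l" and \<mu>: "0 < \<mu>" "decay * \<mu> \<le> l" and bd: "\<And>x. norm x = l \<Longrightarrow> \<mu> \<le> u x"
    and x: "l \<le> norm x"
  shows "c0 * decay * \<mu> * l powr decay * norm x powr (- decay) \<le> u x"
proof -
  \<comment> \<open>The constant flux for which the upper estimate of the total drop of the barrier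
    beyond radius l is exactly \<mu>. The condition \<open>decay * \<mu> \<le> l\<close> becomes E
    \<le> l^(N-1).\<close>
  define E where "E = (decay * \<mu> * l powr decay) powr (s - 1)"
  have E\<gamma>: "E powr \<gamma> = decay * \<mu> * l powr decay"
    using decay_pos \<mu> gamma_cancel by (simp add: E_def powr_powr)
  have "E = (decay * \<mu>) powr (s - 1) * (l powr decay) powr (s - 1)"
    unfolding E_def by (rule powr_mult)
  also have "\<dots> \<le> l powr (s - 1) * l powr (real N - s)"
    using decay_pos \<mu> s_gt_1 l decay_cancel
    by (intro mult_mono powr_mono2) (auto simp: powr_powr)
  also have "\<dots> = l ^ (N - 1)"
    using l dim_ge_2 by (simp add: powr_add[symmetric] powr_realpow[symmetric] of_nat_diff)
  also have "\<dots> \<le> (2 * norm x) ^ (N - 1)"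
    using x l by (intro power_mono) auto
  finally have E_le: "E \<le> (2 * norm x) ^ (N - 1)" .
  have "norm x * Psi (E / (2 * norm x) ^ (N - 1)) \<le> u x"
  proof (rule flux_barrier[where l = l and G' = "\<lambda>_. 0" and \<mu> = \<mu>])
    fix b assume "l < b"
    then have "integral {l..b} (\<lambda>t. Psi (E / t ^ (N - 1))) \<le> E powr \<gamma> * (l powr (- decay) / decay)"
      using l by (intro constant_flux_integral) (auto simp: E_def)
    also have "\<dots> = \<mu>"
      using decay_pos l by (simp add: E\<gamma> powr_minus field_simps)
    finally show "integral {l..b} (\<lambda>t. Psi (E / t ^ (N - 1))) \<le> \<mu>" .
  qed (use l x bd F_nonneg in \<open>auto simp: E_def\<close>)
  moreover have "c0 * E powr \<gamma> * norm x powr (- decay) \<le> norm x * Psi (E / (2 * norm x) ^ (N - 1))"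
    using E_le x l by (intro flux_barrier_value) (auto simp: E_def)
  ultimately show ?thesis by (simp add: E\<gamma> mult_ac)
qed

text \<open>If u \<ge> M on |x| = R, the barrier with constant flux -E that vanishes on |x| = 2 lies
  below u: it is at most M at R because its slope is integrable at infinity, which also makes M
  independent of R. But E is chosen so large that at radius 4 the barrier reaches at least 2 u(x1),
  contradicting the value of u at x1.\<close>

lemma spherical_minimum_bounded:
  obtains M where "0 < M" "\<And>R. 4 < R \<Longrightarrow> \<exists>x. norm x = R \<and> u x < M"
proof -
  obtain x1 :: 'a where x1: "norm x1 = 4" using vector_choose_size[of 4] by auto
  have ux1: "0 < u x1" using u_pos[of x1] x1 by simp
  define E where "E = 4 ^ (N - 1) * Phi (u x1)"
  have "0 < Phi (u x1)" using ux1 Phi_less_iff[of 0 "u x1"] by simp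
  then have E: "0 < E" by (simp add: E_def)
  define M where "M = E powr \<gamma> * (2 powr (- decay) / decay)"
  show ?thesis
  proof
    show "0 < M" using E decay_pos by (simp add: M_def)
    fix R :: real assume R: "4 < R"
    show "\<exists>x. norm x = R \<and> u x < M"
    proof (rule ccontr)
      assume "\<not> ?thesis"
      then have big: "M \<le> u x" if "norm x = R" for x using that by force
      have eq: "integral {c..d} (\<lambda>t. Psi (- E / t ^ (N - 1))) = - integral {c..d} (\<lambda>t. Psi (E / t ^ (N - 1)))" for c d
        by simp
      have "0 - integral {2..norm x1} (\<lambda>t. Psi (- E / t ^ (N - 1))) \<le> u x1"
      proof (rule barrier_below[where G' = "\<lambda>_. 0" and b = R and G = "\<lambda>_. - E"])
        show "0 - integral {2..R} (\<lambda>t. Psi (- E / t ^ (N - 1))) \<le> u x" if "norm x = R" for x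
          unfolding eq using constant_flux_integral[of 2 R E] E R big[OF that] by (simp add: M_def)
        show "0 \<le> u x" if "norm x = 2" for x using u_pos[of x] that by simp
      qed (use R x1 F_nonneg in auto)
      then have "integral {2..4} (\<lambda>t. Psi (E / t ^ (N - 1))) \<le> u x1"
        unfolding eq x1 by simp
      moreover have "integral {2..4::real} (\<lambda>_. u x1) \<le> integral {2..4} (\<lambda>t. Psi (E / t ^ (N - 1)))"
      proof (rule integral_le)
        show "(\<lambda>t. Psi (E / t ^ (N - 1))) integrable_on {2..4}"
          by (intro integrable_continuous_interval continuous_intros) auto
        fix t :: real assume t: "t \<in> {2..4}"
        have "t ^ (N - 1) \<le> 4 ^ (N - 1)" using t by (intro power_mono) auto
        moreover have "0 < t ^ (N - 1)" using t by (intro zero_less_power) auto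
        ultimately have "E / 4 ^ (N - 1) \<le> E / t ^ (N - 1)"
          using E by (intro divide_left_mono) auto
        then have "Psi (Phi (u x1)) \<le> Psi (E / t ^ (N - 1))"
          unfolding Psi_le_iff by (simp add: E_def)
        then show "u x1 \<le> Psi (E / t ^ (N - 1))" by simp
      qed auto
      ultimately show False using ux1 by simp
    qed
  qed
qed

lemma sphere_lower_bound:
  obtains \<mu> where "0 < \<mu>" "decay * \<mu> \<le> 2" "\<And>x. norm x = 2 \<Longrightarrow> \<mu> \<le> u x"
proof -
  have "compact (sphere (0::'a) 2)" by (rule compact_sphere)
  moreover have "sphere (0::'a) 2 \<noteq> {}"
  proof -
    obtain x :: 'a where "norm x = 2" using vector_choose_size[of 2] by auto
    then have "x \<in> sphere 0 2" by simp
    then show ?thesis by blast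
  qed
  moreover have "continuous_on (sphere 0 2) u"
    by (rule continuous_on_subset[OF C1_on_continuous[OF u_C1]]) auto
  ultimately obtain z where z: "z \<in> sphere 0 2" "\<forall>y\<in>sphere 0 2. u z \<le> u y"
    using continuous_attains_inf by blast
  show ?thesis
  proof
    \<comment> \<open>The cap 2 / decay provides the smallness condition of
      \<open>decay_from_sphere\<close> at radius 2.\<close>
    show "0 < min (u z) (2 / decay)" using z u_pos[of z] decay_pos by simp
    show "decay * min (u z) (2 / decay) \<le> 2"
      using decay_pos mult_left_mono[of "min (u z) (2 / decay)" "2 / decay" decay] by simp
    show "min (u z) (2 / decay) \<le> u x" if "norm x = 2" for x
      using z(2) that by (auto simp: min_le_iff_disj)
  qed
qed

lemma initial_decay:
  obtains W where "0 < W" "\<And>x. 2 \<le> norm x \<Longrightarrow> W * norm x powr (- decay) \<le> u x"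
proof -
  obtain \<mu> where \<mu>: "0 < \<mu>" "decay * \<mu> \<le> 2" "\<And>x. norm x = 2 \<Longrightarrow> \<mu> \<le> u x"
    using sphere_lower_bound by blast
  show ?thesis
  proof
    show "0 < c0 * decay * \<mu> * 2 powr decay" using c0_pos decay_pos \<mu> by simp
    show "c0 * decay * \<mu> * 2 powr decay * norm x powr (- decay) \<le> u x" if "2 \<le> norm x" for x
      by (rule decay_from_sphere[OF _ \<mu>]) (use that in auto)
  qed
qed

end

text \<open>The constant c does not depend on r or W, so the implication from decay to source can be
  iterated; e > s - 1 makes each round more than linear in W.\<close>

locale superlinear_supersolution = exterior_supersolution a s u F N
  for a :: "real \<Rightarrow> real" and s :: real and u F :: "'a::euclidean_space \<Rightarrow> real" and N :: nat +
  fixes c e :: real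
  assumes c_pos: "0 < c" and e_gt: "s - 1 < e"
    and growth: "\<And>r W x. 2 \<le> r \<Longrightarrow> 0 < W \<Longrightarrow> (\<And>y. r \<le> norm y \<Longrightarrow> W * norm y powr (- decay) \<le> u y) \<Longrightarrow>
      r < norm x \<Longrightarrow> c * W powr e / norm x ^ N \<le> F x"
begin

text \<open>A source of size \<open>\<bar>x\<bar>\<^sup>-\<^sup>N\<close> has logarithmically growing flux, which improves the decay bound
  by an unbounded factor.\<close>

lemma decay_improved:
  fixes W :: real
  obtains r where "2 \<le> r" "\<And>x. r \<le> norm x \<Longrightarrow> W * norm x powr (- decay) \<le> u x"
proof -
  obtain \<mu> where \<mu>: "0 < \<mu>" "decay * \<mu> \<le> 2" "\<And>x. norm x = 2 \<Longrightarrow> \<mu> \<le> u x"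
    using sphere_lower_bound by blast
  obtain W0 where W0: "0 < W0" "\<And>x. 2 \<le> norm x \<Longrightarrow> W0 * norm x powr (- decay) \<le> u x"
    using initial_decay by blast
  \<comment> \<open>The logarithm is absorbed by t^\<theta> / \<theta>. Since \<theta> \<gamma> =
    decay / 2, this costs half of the decay exponent and the slope stays integrable.\<close>
  define \<theta> where "\<theta> = (real N - s) / 2"
  have \<theta>: "0 < \<theta>" "\<theta> * \<gamma> = decay / 2" using s_less_dim by (simp_all add: \<theta>_def \<gamma>_def decay_def)
  \<comment> \<open>The three bounds serve in turn to keep the flux below (2 |x|)^(N-1), to keep the
    barrier source below F, and to keep the total drop of the barrier below \<mu>.\<close>
  define \<kappa> where "\<kappa> = min 1 (min (c * W0 powr e) (\<theta> * (\<mu> * (decay / 2) * 2 powr (decay / 2)) powr (s - 1)))"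
  have \<kappa>: "0 < \<kappa>" "\<kappa> \<le> 1" "\<kappa> \<le> c * W0 powr e" "\<kappa> \<le> \<theta> * (\<mu> * (decay / 2) * 2 powr (decay / 2)) powr (s - 1)"
    using c_pos W0 \<theta> \<mu> decay_pos by (auto simp: \<kappa>_def)
  have \<kappa>': "(\<kappa> / \<theta>) powr \<gamma> \<le> \<mu> * (decay / 2) * 2 powr (decay / 2)"
  proof -
    have "\<kappa> / \<theta> \<le> (\<mu> * (decay / 2) * 2 powr (decay / 2)) powr (s - 1)"
      using \<kappa>(4) \<theta>(1) by (simp add: divide_le_eq mult.commute)
    then have "(\<kappa> / \<theta>) powr \<gamma> \<le> ((\<mu> * (decay / 2) * 2 powr (decay / 2)) powr (s - 1)) powr \<gamma>"
      using \<kappa>(1) \<theta>(1) gamma_pos by (intro powr_mono2) auto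
    also have "\<dots> = \<mu> * (decay / 2) * 2 powr (decay / 2)"
      using \<mu>(1) decay_pos gamma_cancel by (simp add: powr_powr)
    finally show ?thesis .
  qed
  have log_bound: "norm x * Psi (\<kappa> * ln (norm x / 2) / (2 * norm x) ^ (N - 1)) \<le> u x" if x: "2 \<le> norm x" for x
  proof (rule flux_barrier[where l = 2 and G' = "\<lambda>t. \<kappa> / t" and G = "\<lambda>t. \<kappa> * ln (t / 2)" and \<mu> = \<mu>])
    show "((\<lambda>t. \<kappa> * ln (t / 2)) has_real_derivative \<kappa> / t) (at t)" if "2 < t" for t
      using that by (auto intro!: derivative_eq_intros)
    show "continuous_on {2<..} (\<lambda>t. \<kappa> / t)" by (intro continuous_intros) auto
    show "continuous_on {2..} (\<lambda>t. \<kappa> * ln (t / 2))" by (intro continuous_intros) auto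
    show "\<kappa> * ln (y / 2) \<le> \<kappa> * ln (z / 2)" if "2 \<le> y" "y \<le> z" for y z
      using that \<kappa>(1) by (intro mult_left_mono) auto
    show "\<kappa> / norm y / norm y ^ (N - 1) \<le> F y" if y: "2 < norm y" for y
    proof -
      have "norm y * norm y ^ (N - 1) = norm y ^ N"
        using dim_ge_2 by (metis Suc_diff_1 power_Suc pos2 order_less_le_trans)
      then have "\<kappa> / norm y / norm y ^ (N - 1) = \<kappa> / norm y ^ N" by (simp only: divide_divide_eq_left)
      also have "\<dots> \<le> c * W0 powr e / norm y ^ N"
        using \<kappa>(3) by (intro divide_right_mono) auto
      also have "\<dots> \<le> F y" by (rule growth[OF order_refl W0(1) W0(2) y])
      finally show ?thesis .
    qed
    fix b :: real assume b: "2 < b"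
    have "integral {2..b} (\<lambda>t. Psi (\<kappa> * ln (t / 2) / t ^ (N - 1)))
        \<le> integral {2..b} (\<lambda>t. (\<kappa> / \<theta>) powr \<gamma> * t powr (- 1 - decay / 2))"
    proof (rule integral_le)
      show "(\<lambda>t. Psi (\<kappa> * ln (t / 2) / t ^ (N - 1))) integrable_on {2..b}"
        by (intro integrable_continuous_interval continuous_intros) auto
      show "(\<lambda>t. (\<kappa> / \<theta>) powr \<gamma> * t powr (- 1 - decay / 2)) integrable_on {2..b}"
        using integrable_cmul[OF powr_integral_bound(1)[of "decay / 2" 2 b], of "(\<kappa> / \<theta>) powr \<gamma>"] decay_pos b by simp
      fix t assume t: "t \<in> {2..b}"
      have "ln (t / 2) \<le> ln t" using t by simp
      also have "\<dots> \<le> t powr \<theta> / \<theta>" by (rule ln_powr_bound) (use t \<theta> in auto)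
      finally have "\<kappa> * ln (t / 2) \<le> (\<kappa> / \<theta>) * t powr \<theta>"
        using \<kappa>(1) mult_left_mono[of "ln (t / 2)" "t powr \<theta> / \<theta>" \<kappa>] by simp
      then have "Psi (\<kappa> * ln (t / 2) / t ^ (N - 1)) \<le> Psi ((\<kappa> / \<theta>) * t powr \<theta> / t ^ (N - 1))"
        unfolding Psi_le_iff using t by (intro divide_right_mono) auto
      also have "\<dots> \<le> ((\<kappa> / \<theta>) * t powr \<theta>) powr \<gamma> * t powr (- 1 - decay)"
        using t \<kappa> \<theta> by (intro Psi_flux_upper) auto
      also have "\<dots> = (\<kappa> / \<theta>) powr \<gamma> * (t powr (decay / 2) * t powr (- 1 - decay))"
        by (simp only: powr_mult powr_powr \<theta>(2) mult.assoc)
      also have "t powr (decay / 2) * t powr (- 1 - decay) = t powr (- 1 - decay / 2)"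
        by (simp add: powr_add[symmetric] minus_diff_commute[of "decay / 2" 1])
      finally show "Psi (\<kappa> * ln (t / 2) / t ^ (N - 1)) \<le> (\<kappa> / \<theta>) powr \<gamma> * t powr (- 1 - decay / 2)" .
    qed
    also have "\<dots> = (\<kappa> / \<theta>) powr \<gamma> * integral {2..b} (\<lambda>t. t powr (- 1 - decay / 2))" by simp
    also have "\<dots> \<le> (\<mu> * (decay / 2) * 2 powr (decay / 2)) * (2 powr (- (decay / 2)) / (decay / 2))"
      using powr_integral_bound[of "decay / 2" 2 b] decay_pos b \<kappa>' \<mu>(1)
      by (intro mult_mono Henstock_Kurzweil_Integration.integral_nonneg) auto
    also have "\<dots> = \<mu>"
      using decay_pos by (simp add: powr_minus field_simps)
    finally show "integral {2..b} (\<lambda>t. Psi (\<kappa> * ln (t / 2) / t ^ (N - 1))) \<le> \<mu>" .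
  qed (use x \<mu> in auto)
  \<comment> \<open>Solves c0 (\<kappa> \<Lambda>)^\<gamma> = max 1 W; beyond radius 2 exp \<Lambda>
    the logarithm is at least \<Lambda>.\<close>
  define \<Lambda> where "\<Lambda> = (max 1 W / c0) powr (s - 1) / \<kappa>"
  have \<Lambda>: "0 < \<Lambda>" using c0_pos \<kappa>(1) by (simp add: \<Lambda>_def)
  define r where "r = 2 * exp \<Lambda>"
  show ?thesis
  proof
    show "2 \<le> r" using \<Lambda> by (simp add: r_def)
    fix x :: 'a assume x: "r \<le> norm x"
    have x2: "2 \<le> norm x" using x \<open>2 \<le> r\<close> by linarith
    have "exp \<Lambda> \<le> norm x / 2" using x by (simp add: r_def)
    then have L: "\<Lambda> \<le> ln (norm x / 2)" using x2 by (subst ln_ge_iff) auto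
    have "0 < norm x / 2" using x2 by linarith
    then have "ln (norm x / 2) \<le> norm x / 2" using ln_le_minus_one[of "norm x / 2"] by linarith
    then have "\<kappa> * ln (norm x / 2) \<le> 1 * (norm x / 2)"
      using \<kappa> x2 by (intro mult_mono) auto
    also have "\<dots> \<le> (2 * norm x) ^ 1" using x2 by simp
    also have "\<dots> \<le> (2 * norm x) ^ (N - 1)"
      using dim_ge_2 x2 by (intro power_increasing) auto
    finally have le: "\<kappa> * ln (norm x / 2) \<le> (2 * norm x) ^ (N - 1)" .
    have "W \<le> max 1 W" by simp
    also have "\<dots> = c0 * (\<kappa> * \<Lambda>) powr \<gamma>"
      using c0_pos \<kappa>(1) gamma_cancel by (simp add: \<Lambda>_def powr_powr)
    also have "\<dots> \<le> c0 * (\<kappa> * ln (norm x / 2)) powr \<gamma>"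
      using c0_pos \<kappa>(1) \<Lambda> L gamma_pos by (intro mult_left_mono powr_mono2) auto
    finally have "W * norm x powr (- decay) \<le> c0 * (\<kappa> * ln (norm x / 2)) powr \<gamma> * norm x powr (- decay)"
      by (intro mult_right_mono) auto
    also have "\<dots> \<le> norm x * Psi (\<kappa> * ln (norm x / 2) / (2 * norm x) ^ (N - 1))"
      using x2 le \<kappa>(1) by (intro flux_barrier_value) auto
    also have "\<dots> \<le> u x" by (rule log_bound[OF x2])
    finally show "W * norm x powr (- decay) \<le> u x" .
  qed
qed

text \<open>The barrier is the radial function with constant source \<open>f\<close> that vanishes on the inner sphere and
  whose flux changes sign at radius \<open>2 r\<close>; the outer radius is so large that it is nonpositive there.\<close>

lemma annulus_lower_bound:
  assumes r: "1 < r" and f: "0 < f" "f * r \<le> 1"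
    and Ff: "\<And>x. r < norm x \<Longrightarrow> norm x < (2 ^ (N + 1) + 1) * r \<Longrightarrow> f \<le> F x"
    and x: "norm x = 2 * r"
  shows "r / 2 * (f * r / (4 * real N)) powr \<gamma> \<le> u x"
proof -
  define L :: real where "L = 2 ^ (N + 1) + 1"
  have L: "(4::real) \<le> 2 ^ N" "2 ^ (N + 1) = 2 * (2::real) ^ N" 
    using power_increasing[OF dim_ge_2, of "2::real"] by simp_all
  \<comment> \<open>The primitive of f t^(N-1) with zero at 2 r.\<close>
  define G where "G t = f * (t ^ N - (2 * r) ^ N) / real N" for t
  define h where "h t = G t / t ^ (N - 1)" for t
  have N0: "0 < real N" using dim_ge_2 by simp
  have pN: "t ^ N = t * t ^ (N - 1)" for t :: real
    using dim_ge_2 by (metis Suc_diff_1 power_Suc pos2 order_less_le_trans)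
  have h_eq: "h t = f * (t - 2 * r * (2 * r / t) ^ (N - 1)) / real N" if "0 < t" for t
    using that by (simp add: h_def G_def pN power_divide field_simps)
  \<comment> \<open>\<open>- P\<close> bounds h from below. The rise of the barrier over [r, 2 r] is
    therefore at most r Psi(P), and it is repaid over the last stretch of width r, where h \<ge> P.
    This fixes the outer factor 2^(N+1) + 1.\<close>
  define P where "P = f * (2 ^ N * r) / real N"
  have contG: "continuous_on A G" for A unfolding G_def by (intro continuous_intros) (use N0 in auto)
  have conth: "continuous_on {r..L * r} h"
    unfolding h_def using r by (intro continuous_intros contG) auto
  have intp: "(\<lambda>t. Psi (h t)) integrable_on {c..d}" if "r \<le> c" "d \<le> L * r" for c d
    by (rule integrable_continuous_interval) (rule continuous_on_Psi', rule continuous_on_subset[OF conth], use that in auto)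
  have ratio: "(2 * r / t) ^ (N - 1) \<le> 2 ^ (N - 1)" if "r \<le> t" for t
    using that r by (intro power_mono) (auto simp: divide_le_eq)
  have h_low: "- P \<le> h t" if "r \<le> t" for t
  proof -
    have "2 * r * (2 * r / t) ^ (N - 1) \<le> 2 * r * 2 ^ (N - 1)"
      using ratio[OF that] r by (intro mult_left_mono) auto
    also have "\<dots> = 2 ^ N * r" using pN[of 2] by simp
    finally have "- (2 ^ N * r) \<le> t - 2 * r * (2 * r / t) ^ (N - 1)" using that r by linarith
    then have "f * (- (2 ^ N * r)) / real N \<le> f * (t - 2 * r * (2 * r / t) ^ (N - 1)) / real N"
      using f N0 by (intro divide_right_mono mult_left_mono) auto
    then show ?thesis using h_eq[of t] that r by (simp add: P_def)
  qed
  have h_mid: "f * (t - 2 * r) / real N \<le> h t" if "2 * r \<le> t" for t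
  proof -
    have "(2 * r / t) ^ (N - 1) \<le> 1" using that r by (intro power_le_one) (auto simp: divide_le_eq)
    then have "t - 2 * r \<le> t - 2 * r * (2 * r / t) ^ (N - 1)"
      using mult_left_mono[of "(2 * r / t) ^ (N - 1)" 1 "2 * r"] r by simp
    then show ?thesis
      using h_eq[of t] that r f N0 by (auto intro!: divide_right_mono mult_left_mono)
  qed
  have h_neg: "h t \<le> - (f * (2 * r - t) / real N)" if "r \<le> t" "t \<le> 2 * r" for t
  proof -
    have "1 \<le> (2 * r / t) ^ (N - 1)" using that r by (intro one_le_power) (auto simp: le_divide_eq)
    then have "t - 2 * r * (2 * r / t) ^ (N - 1) \<le> - (2 * r - t)"
      using mult_left_mono[of 1 "(2 * r / t) ^ (N - 1)" "2 * r"] r by simp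
    then have "f * (t - 2 * r * (2 * r / t) ^ (N - 1)) / real N \<le> f * (- (2 * r - t)) / real N"
      using f N0 by (intro divide_right_mono mult_left_mono) auto
    also have "f * (- (2 * r - t)) / real N = - (f * (2 * r - t) / real N)"
      by (simp only: mult_minus_right minus_divide_left)
    finally show ?thesis using h_eq[of t] that r by simp
  qed
  have Lr: "2 * r \<le> (L - 1) * r" "(L - 1) * r \<le> L * r" "2 * r \<le> L * r"
    using r L by (auto simp: L_def intro!: mult_right_mono)
  have split: "integral {c..d} (\<lambda>t. Psi (h t)) + integral {d..b} (\<lambda>t. Psi (h t)) = integral {c..b} (\<lambda>t. Psi (h t))"
    if "r \<le> c" "c \<le> d" "d \<le> b" "b \<le> L * r" for b c d
    by (rule Henstock_Kurzweil_Integration.integral_combine) (use that intp in auto)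
  have i1: "- (r * Psi P) \<le> integral {r..2 * r} (\<lambda>t. Psi (h t))"
  proof -
    have "integral {r..2 * r} (\<lambda>_. Psi (- P)) \<le> integral {r..2 * r} (\<lambda>t. Psi (h t))"
      by (rule integral_le) (use intp Lr r h_low in \<open>auto simp del: Psi_minus\<close>)
    then show ?thesis using r by simp
  qed
  have i2: "0 \<le> integral {2 * r..(L - 1) * r} (\<lambda>t. Psi (h t))"
  proof (rule Henstock_Kurzweil_Integration.integral_nonneg)
    fix t assume t: "t \<in> {2 * r..(L - 1) * r}"
    have "0 \<le> f * (t - 2 * r) / real N" using t f by simp
    then show "0 \<le> Psi (h t)" using h_mid[of t] t by simp
  qed (use intp Lr r in auto)
  have i3: "r * Psi P \<le> integral {(L - 1) * r..L * r} (\<lambda>t. Psi (h t))"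
  proof -
    have "integral {(L - 1) * r..L * r} (\<lambda>_. Psi P) \<le> integral {(L - 1) * r..L * r} (\<lambda>t. Psi (h t))"
    proof (rule integral_le)
      fix t assume t: "t \<in> {(L - 1) * r..L * r}"
      have "2 ^ N * r \<le> (2 * 2 ^ N - 2) * r" using L r by (intro mult_right_mono) auto
      also have "\<dots> \<le> t - 2 * r" using t L by (simp add: L_def algebra_simps)
      finally have "P \<le> f * (t - 2 * r) / real N"
        unfolding P_def using f N0 by (intro divide_right_mono mult_left_mono) auto
      then show "Psi P \<le> Psi (h t)" using h_mid[of t] t Lr by simp
    qed (use intp Lr r in auto)
    then show ?thesis using Lr r by (simp add: algebra_simps)
  qed
  have total: "0 \<le> integral {r..L * r} (\<lambda>t. Psi (h t))"
    using i1 i2 i3 split[of r "2 * r" "L * r"] split[of "2 * r" "(L - 1) * r" "L * r"] Lr r by simp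
  have "0 - integral {r..norm x} (\<lambda>t. Psi (G t / t ^ (N - 1))) \<le> u x"
  proof (rule barrier_below[where b = "L * r" and G' = "\<lambda>t. f * t ^ (N - 1)"])
    show "r < L * r" using Lr r by linarith
    show "(G has_real_derivative f * t ^ (N - 1)) (at t)" for t
      unfolding G_def using N0 by (auto intro!: derivative_eq_intros)
    show "f * norm y ^ (N - 1) / norm y ^ (N - 1) \<le> F y" if "r < norm y" "norm y < L * r" for y
    proof -
      have "y \<noteq> 0" using that r by auto
      then show ?thesis using Ff[of y] that by (simp add: L_def)
    qed
    show "0 - integral {r..L * r} (\<lambda>t. Psi (G t / t ^ (N - 1))) \<le> u y" if "norm y = L * r" for y
      using total u_pos[of y] that Lr r by (simp add: h_def)
    show "0 \<le> u y" if "norm y = r" for y using u_pos[of y] that r by simp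
    show "continuous_on {r<..<L * r} (\<lambda>t. f * t ^ (N - 1))" by (intro continuous_intros)
  qed (use r x Lr contG in auto)
  then have u_ge: "- integral {r..2 * r} (\<lambda>t. Psi (h t)) \<le> u x" by (simp add: x h_def)
  \<comment> \<open>On the outer half of [r, 2 r] only the sign of h is used; the inner half, where
    h \<le> - f r / (2 N), yields the explicit bound.\<close>
  have "integral {3 / 2 * r..2 * r} (\<lambda>t. Psi (h t)) \<le> 0"
  proof -
    have "integral {3 / 2 * r..2 * r} (\<lambda>t. Psi (h t)) \<le> integral {3 / 2 * r..2 * r} (\<lambda>t. 0)"
    proof (rule integral_le)
      fix t assume t: "t \<in> {3 / 2 * r..2 * r}"
      have "0 \<le> f * (2 * r - t) / real N" using t f by simp
      then have "h t \<le> 0" using h_neg[of t] t r by simp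
      then show "Psi (h t) \<le> 0" using Psi_le_iff[of "h t" 0] by simp
    qed (use intp Lr r in auto)
    then show ?thesis by simp
  qed
  moreover have "integral {r..3 / 2 * r} (\<lambda>t. Psi (h t)) \<le> - (r / 2 * Psi (f * r / (2 * real N)))"
  proof -
    have "integral {r..3 / 2 * r} (\<lambda>t. Psi (h t)) \<le> integral {r..3 / 2 * r} (\<lambda>t. Psi (- (f * r / (2 * real N))))"
    proof (rule integral_le)
      fix t assume t: "t \<in> {r..3 / 2 * r}"
      have "f * (r / 2) / real N \<le> f * (2 * r - t) / real N"
        using t f N0 by (intro divide_right_mono mult_left_mono) auto
      then have "h t \<le> - (f * r / (2 * real N))" using h_neg[of t] t r by (simp add: field_simps)
      then show "Psi (h t) \<le> Psi (- (f * r / (2 * real N)))" by (simp only: Psi_le_iff)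
    qed (use intp Lr r in auto)
    then show ?thesis using r by (simp add: algebra_simps)
  qed
  moreover have "(f * r / (4 * real N)) powr \<gamma> \<le> Psi (f * r / (2 * real N))"
  proof -
    have "f * r / (2 * real N) \<le> 1" using f N0 dim_ge_2 by (simp add: divide_le_eq)
    then have "(f * r / (2 * real N) / 2) powr \<gamma> \<le> Psi (f * r / (2 * real N))"
      unfolding \<gamma>_def using f r by (intro Psi_lower) auto
    then show ?thesis by simp
  qed
  then have scaled: "r / 2 * (f * r / (4 * real N)) powr \<gamma> \<le> r / 2 * Psi (f * r / (2 * real N))"
    using r by (intro mult_left_mono) auto
  moreover have "integral {r..3 / 2 * r} (\<lambda>t. Psi (h t)) + integral {3 / 2 * r..2 * r} (\<lambda>t. Psi (h t))
      = integral {r..2 * r} (\<lambda>t. Psi (h t))"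
    by (rule split) (use r Lr in auto)
  ultimately show ?thesis
    using scaled u_ge by linarith
qed

text \<open>The annulus barrier bounds u on |x| = 2 r, and \<open>decay_from_sphere\<close> carries
  the bound outward. A source W^e r^(-N) gives the value W^(e \<gamma>) r^(-decay) on that sphere.
  The cap f \<le> 1 / r is never active for r \<ge> R, since it would force u \<ge> M on a whole
  sphere.\<close>

lemma decay_step:
  obtains C R where "0 < C" "2 \<le> R"
    "\<And>r W x. R \<le> r \<Longrightarrow> 0 < W \<Longrightarrow> (\<And>y. r \<le> norm y \<Longrightarrow> W * norm y powr (- decay) \<le> u y) \<Longrightarrow>
      2 * r \<le> norm x \<Longrightarrow> C * W powr (e * \<gamma>) * norm x powr (- decay) \<le> u x"
proof -
  obtain M where M: "0 < M" "\<And>R. 4 < R \<Longrightarrow> \<exists>x. norm x = R \<and> u x < M"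
    using spherical_minimum_bounded by blast
  define L :: real where "L = 2 ^ (N + 1) + 1"
  have L: "1 < L" by (simp add: L_def)
  have N0: "0 < real N" using dim_ge_2 by simp
  define k where "k = (1 / (4 * real N)) powr \<gamma> / 2"
  have k: "0 < k" using N0 by (simp add: k_def)
  \<comment> \<open>M / k rules out the cap on f, decay * M gives the smallness condition of
    \<open>decay_from_sphere\<close>, and 3 makes 2 r > 4, the range of the bound on spherical
    minima.\<close>
  define R where "R = max 3 (max (M / k) (decay * M))"
  define B where "B = (c / L ^ N) powr \<gamma> * k"
  have B: "0 < B" using c_pos L k by (simp add: B_def)
  show ?thesis
  proof
    show "0 < c0 * decay * B * 2 powr decay" using c0_pos decay_pos B by simp
    show "2 \<le> R" by (simp add: R_def)
    fix r W :: real and x :: 'a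
    assume r: "R \<le> r" and W: "0 < W" and lower: "\<And>y. r \<le> norm y \<Longrightarrow> W * norm y powr (- decay) \<le> u y"
      and x: "2 * r \<le> norm x"
    have r3: "3 \<le> r" "M / k \<le> r" "decay * M \<le> r" using r by (auto simp: R_def)
    \<comment> \<open>The smallest value on the annulus of the lower bound for F, cut off at 1 / r
      to ensure \<open>f * r \<le> 1\<close>.\<close>
    define f where "f = min (1 / r) (c * W powr e / (L * r) ^ N)"
    have f: "0 < f" "f * r \<le> 1"
    proof -
      show "0 < f" using r3 c_pos W L by (auto simp: f_def)
      have "f * r \<le> 1 / r * r" using r3 by (intro mult_right_mono) (auto simp: f_def)
      then show "f * r \<le> 1" using r3 by simp
    qed
    define \<mu> where "\<mu> = r / 2 * (f * r / (4 * real N)) powr \<gamma>"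
    have bd: "\<mu> \<le> u y" if "norm y = 2 * r" for y
      unfolding \<mu>_def
    proof (rule annulus_lower_bound[OF _ f _ that])
      show "1 < r" using r3 by simp
      fix z :: 'a assume z: "r < norm z" "norm z < (2 ^ (N + 1) + 1) * r"
      have zL: "norm z < L * r" using z(2) by (simp add: L_def)
      have "f \<le> c * W powr e / (L * r) ^ N" by (simp add: f_def)
      also have "\<dots> \<le> c * W powr e / norm z ^ N"
        using z(1) zL r3 c_pos L by (intro divide_left_mono power_mono mult_pos_pos zero_less_power) auto
      also have "\<dots> \<le> F z" by (rule growth[OF _ W lower z(1)]) (use r3 in auto)
      finally show "f \<le> F z" .
    qed
    have \<mu>_eq: "\<mu> = k * r * (f * r) powr \<gamma>"
      by (simp add: \<mu>_def k_def powr_divide)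
    have \<mu>: "0 < \<mu>" using k r3 f by (simp add: \<mu>_eq)
    have \<mu>M: "\<mu> < M"
    proof -
      obtain y where "norm y = 2 * r" "u y < M" using M(2)[of "2 * r"] r3 by auto
      then show ?thesis using bd[of y] by linarith
    qed
    have "f \<noteq> 1 / r"
    proof
      assume "f = 1 / r"
      then have "\<mu> = k * r" using r3 by (simp add: \<mu>_eq)
      moreover have "M \<le> k * r" using r3(2) k by (simp add: divide_le_eq mult.commute)
      ultimately show False using \<mu>M by linarith
    qed
    then have f_eq: "f = c * W powr e / (L * r) ^ N" by (auto simp: f_def min_def)
    have "\<mu> = B * W powr (e * \<gamma>) * r powr (- decay)"
    proof -
      have "f * r = (c / L ^ N) * W powr e / r ^ (N - 1)"
      proof -
        have "r ^ N = r * r ^ (N - 1)"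
          using dim_ge_2 by (metis Suc_diff_1 power_Suc pos2 order_less_le_trans)
        then show ?thesis using r3 by (simp add: f_eq power_mult_distrib)
      qed
      then have "(f * r) powr \<gamma> = (c / L ^ N) powr \<gamma> * W powr (e * \<gamma>) / r powr (1 + decay)"
        using power_dim_powr[of r] r3 by (simp only: powr_divide powr_mult powr_powr)
      moreover have "r / r powr (1 + decay) = r powr (- decay)"
        using r3 by (simp add: powr_add powr_minus field_simps)
      moreover have "\<mu> = k * (c / L ^ N) powr \<gamma> * W powr (e * \<gamma>) * (r / r powr (1 + decay))"
        by (simp add: \<mu>_eq calculation(1))
      ultimately show ?thesis by (simp only: B_def mult_ac)
    qed
    then have "c0 * decay * B * 2 powr decay * W powr (e * \<gamma>)
        = c0 * decay * \<mu> * (2 * r) powr decay"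
      using r3 by (simp add: powr_mult powr_minus field_simps)
    moreover have "c0 * decay * \<mu> * (2 * r) powr decay * norm x powr (- decay) \<le> u x"
    proof (rule decay_from_sphere[OF _ \<mu> _ bd x])
      have "decay * \<mu> \<le> decay * M" using \<mu>M decay_pos by simp
      then show "decay * \<mu> \<le> 2 * r" using r3 by linarith
    qed (use r3 in auto)
    ultimately show "c0 * decay * B * 2 powr decay * W powr (e * \<gamma>) * norm x powr (- decay) \<le> u x"
      by (simp only:)
  qed
qed

text \<open>Once W satisfies C W^\<eta> = Q, each doubling of the radius multiplies the constant by
  at least Q. On |x| = 2^k r this gives u \<ge> W 2^k r^(-decay), which exceeds every bound on
  spherical minima.\<close>

theorem no_superlinear_supersolution: False
proof -
  obtain C R where CR: "0 < C" "2 \<le> R"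
    "\<And>r W x. R \<le> r \<Longrightarrow> 0 < W \<Longrightarrow> (\<And>y. r \<le> norm y \<Longrightarrow> W * norm y powr (- decay) \<le> u y) \<Longrightarrow>
      2 * r \<le> norm x \<Longrightarrow> C * W powr (e * \<gamma>) * norm x powr (- decay) \<le> u x"
    using decay_step by blast
  obtain M where M: "0 < M" "\<And>R. 4 < R \<Longrightarrow> \<exists>x. norm x = R \<and> u x < M"
    using spherical_minimum_bounded by blast
  define \<eta> where "\<eta> = e * \<gamma> - 1"
  have \<eta>: "0 < \<eta>" using e_gt s_gt_1 by (simp add: \<eta>_def \<gamma>_def field_simps)
  \<comment> \<open>2^decay offsets the loss in |x|^(-decay) under doubling, and the remaining 2 is
    the gain per step.\<close>
  define Q where "Q = 2 powr (decay + 1)"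
  have Q: "1 \<le> Q" using decay_pos by (simp add: Q_def ge_one_powr_ge_zero)
  define W where "W = (Q / C) powr (1 / \<eta>)"
  have W: "0 < W" "C * W powr \<eta> = Q" using CR(1) Q \<eta> by (auto simp: W_def powr_powr)
  obtain r0 where r0: "2 \<le> r0" "\<And>x. r0 \<le> norm x \<Longrightarrow> W * norm x powr (- decay) \<le> u x"
    using decay_improved by blast
  define r where "r = max R (max r0 5)"
  have r: "R \<le> r" "r0 \<le> r" "5 \<le> r" by (auto simp: r_def)
  have iter: "W * Q ^ k * norm x powr (- decay) \<le> u x" if "2 ^ k * r \<le> norm x" for k x
    using that
  proof (induction k arbitrary: x)
    case 0
    then show ?case using r0(2)[of x] r by simp
  next
    case (Suc k)
    have pos: "0 < W * Q ^ k" using W Q by simp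
    have "1 * r \<le> 2 ^ k * r" using r by (intro mult_right_mono) auto
    then have "R \<le> 2 ^ k * r" using r by linarith
    then have "C * (W * Q ^ k) powr (e * \<gamma>) * norm x powr (- decay) \<le> u x"
      using Suc pos by (intro CR(3)[of "2 ^ k * r"]) (auto simp: mult_ac)
    moreover have "W * Q ^ Suc k \<le> C * (W * Q ^ k) powr (e * \<gamma>)"
    proof -
      have "1 \<le> Q ^ k" using Q by (rule one_le_power)
      then have "W \<le> W * Q ^ k" using W by (simp add: mult_le_cancel_left1)
      then have "W powr \<eta> \<le> (W * Q ^ k) powr \<eta>" using W \<eta> by (intro powr_mono2) auto
      then have "Q \<le> C * (W * Q ^ k) powr \<eta>" using W(2) CR(1) by (metis mult_left_mono less_imp_le)
      then have "(W * Q ^ k) * Q \<le> (W * Q ^ k) * (C * (W * Q ^ k) powr \<eta>)"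
        using pos by (intro mult_left_mono) auto
      also have "\<dots> = C * ((W * Q ^ k) powr 1 * (W * Q ^ k) powr \<eta>)" using pos by simp
      also have "\<dots> = C * (W * Q ^ k) powr (e * \<gamma>)"
        unfolding powr_add[symmetric] by (simp add: \<eta>_def)
      finally show ?thesis by (simp add: mult_ac)
    qed
    then have "W * Q ^ Suc k * norm x powr (- decay) \<le> C * (W * Q ^ k) powr (e * \<gamma>) * norm x powr (- decay)"
      by (intro mult_right_mono) auto
    ultimately show ?case by linarith
  qed
  obtain k :: nat where k: "M * r powr decay / W < 2 ^ k"
    using real_arch_pow[of 2 "M * r powr decay / W"] by auto
  have "1 * r \<le> 2 ^ k * r" using r by (intro mult_right_mono) auto
  then have "4 < 2 ^ k * r" using r by linarith
  then obtain x where x: "norm x = 2 ^ k * r" "u x < M" using M(2) by blast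
  have "W * Q ^ k * (2 ^ k * r) powr (- decay) < M" using iter[of k x] x by simp
  moreover have "Q ^ k * (2 ^ k * r) powr (- decay) = 2 ^ k * r powr (- decay)"
  proof -
    have "Q ^ k = 2 ^ k * (2 ^ k) powr decay"
      by (simp add: Q_def powr_add power_mult_distrib powr_power powr_realpow[symmetric] powr_powr mult.commute)
    then show ?thesis using r by (simp add: powr_mult powr_minus)
  qed
  ultimately have "W * (2 ^ k * r powr (- decay)) < M" by (simp add: mult.assoc)
  then have "2 ^ k < M * r powr decay / W"
    using W r by (simp add: powr_minus field_simps)
  then show False using k by simp
qed

end

section \<open>Integrability of powers and local bounds of Riesz potentials\<close>

lemma norm_le_of_nonneg: "0 \<le> x \<Longrightarrow> x \<le> y \<Longrightarrow> norm x \<le> norm (y::real)"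
  by simp

section \<open>Transfer from \<open>lebesgue\<close> to \<open>lborel\<close>\<close>

lemma lebesgue_measurable_AE:
  fixes f g :: "'a::euclidean_space \<Rightarrow> real"
  assumes [measurable]: "g \<in> borel_measurable borel" and AE: "AE x in lborel. f x = g x"
  shows "f \<in> borel_measurable lebesgue"
proof (rule measurableI)
  fix B :: "real set" assume B [measurable]: "B \<in> sets borel"
  have "Measurable.pred lebesgue (\<lambda>x. f x \<in> B \<and> f x \<noteq> g x)"
    by (rule sets_completion_AE) (use AE in \<open>auto elim: eventually_mono\<close>)
  moreover have "Measurable.pred lebesgue (\<lambda>x. f x \<noteq> g x)"
    by (rule sets_completion_AE) (use AE in \<open>auto elim: eventually_mono\<close>)
  moreover have "Measurable.pred lebesgue (\<lambda>x. g x \<in> B)"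
    by (rule measurable_completion) measurable
  ultimately have "{x. f x \<in> B \<and> f x \<noteq> g x} \<union> ({x. g x \<in> B} - {x. f x \<noteq> g x}) \<in> sets lebesgue"
    by (intro sets.Un sets.Diff) (simp_all add: pred_def)
  moreover have "{x. f x \<in> B \<and> f x \<noteq> g x} \<union> ({x. g x \<in> B} - {x. f x \<noteq> g x}) = f -` B \<inter> space lebesgue"
    by auto
  ultimately show "f -` B \<inter> space lebesgue \<in> sets lebesgue" by simp
qed simp

text \<open>Since u is arbitrary on the unit sphere, the integrands of the weak form agree with
  Borel functions only almost everywhere; by this lemma they can be replaced by them.\<close>

lemma lebesgue_integral_AE:
  fixes f g :: "'a::euclidean_space \<Rightarrow> real"
  assumes g: "g \<in> borel_measurable borel" and AE: "AE x in lborel. f x = g x"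
  shows "integrable lebesgue f \<longleftrightarrow> integrable lborel g" and "(LINT x|lebesgue. f x) = (LINT x|lborel. g x)"
proof -
  have f: "f \<in> borel_measurable lebesgue" by (rule lebesgue_measurable_AE[OF assms])
  have g': "g \<in> borel_measurable lebesgue" using g by (intro measurable_completion) simp
  have AE': "AE x in lebesgue. f x = g x" by (rule AE_completion[OF AE])
  show "integrable lebesgue f \<longleftrightarrow> integrable lborel g"
    using integrable_cong_AE[OF f g' AE'] integrable_completion[of g lborel] g by simp
  show "(LINT x|lebesgue. f x) = (LINT x|lborel. g x)"
    using integral_cong_AE[OF f g' AE'] integral_completion[of g lborel] g by simp
qed

lemma AE_not_unit_sphere: "AE y in lborel. norm (y::'a::euclidean_space) \<noteq> 1"
proof -
  have "sphere (0::'a) 1 \<in> null_sets lborel"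
    using negligible_sphere[of "0::'a" 1] by (simp add: null_sets_completion_iff negligible_iff_null_sets negligible_convex_frontier)
  then have "AE y in lborel. y \<notin> sphere (0::'a) 1" by (rule AE_not_in)
  then show ?thesis by simp
qed

section \<open>Integrability of powers of the norm\<close>

lemma dyadic_power_bound:
  fixes z :: "'a::euclidean_space"
  assumes "z \<noteq> 0"
  shows "norm z < 1 \<Longrightarrow> 0 < a \<Longrightarrow> \<exists>k::nat. norm z \<le> (1/2) ^ k \<and> norm z powr (- a) \<le> (2 powr a) ^ (k + 1)"
    and "1 \<le> norm z \<Longrightarrow> 0 < a \<Longrightarrow> \<exists>k::nat. norm z \<le> 2 ^ (k + 1) \<and> norm z powr (- a) \<le> (2 powr (- a)) ^ k"
proof -
  assume z: "norm z < 1" and a: "0 < a"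
  obtain n where "(1/2) ^ n < norm z" using real_arch_pow_inv[of "norm z" "1/2"] assms by auto
  \<comment> \<open>With n = k + 1 minimal, z lies in the dyadic shell 2^(-k-1) < |z| \<le>
    2^(-k).\<close>
  define n where "n = (LEAST n::nat. (1/2) ^ n < norm z)"
  have n: "(1/2) ^ n < norm z" unfolding n_def by (rule LeastI) fact
  have "n \<noteq> 0" using n z by (cases n) auto
  then obtain k where k: "n = Suc k" by (cases n) auto
  have "\<not> (1/2) ^ k < norm z" using not_less_Least[of k "\<lambda>n. (1/2) ^ n < norm z"] k by (simp add: n_def)
  moreover have "norm z powr (- a) \<le> ((1/2) ^ n) powr (- a)"
    using n a by (intro powr_mono2') auto
  moreover have "((1/2) ^ n) powr (- a) = (2 powr a) ^ (k + 1)"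
  proof -
    have "(1/2::real) ^ n = 2 powr (- real n)"
      by (simp add: powr_minus powr_realpow power_one_over inverse_eq_divide)
    then have "((1/2) ^ n) powr (- a) = 2 powr (real n * a)" by (simp add: powr_powr)
    also have "\<dots> = (2 powr a) powr real n" by (simp add: powr_powr mult.commute)
    also have "\<dots> = (2 powr a) ^ (k + 1)" by (simp only: k powr_realpow powr_gt_zero) (simp add: powr_realpow)
    finally show ?thesis .
  qed
  ultimately show "\<exists>k::nat. norm z \<le> (1/2) ^ k \<and> norm z powr (- a) \<le> (2 powr a) ^ (k + 1)" by force
next
  assume z: "1 \<le> norm z" and a: "0 < a"
  obtain n where "norm z < 2 ^ n" using real_arch_pow[of 2 "norm z"] by auto
  define n where "n = (LEAST n::nat. norm z < 2 ^ n)"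
  have n: "norm z < 2 ^ n" unfolding n_def by (rule LeastI) fact
  have "n \<noteq> 0" using n z by (cases n) auto
  then obtain k where k: "n = Suc k" by (cases n) auto
  have "\<not> norm z < 2 ^ k" using not_less_Least[of k "\<lambda>n. norm z < 2 ^ n"] k by (simp add: n_def)
  then have "norm z powr (- a) \<le> (2 ^ k) powr (- a)"
    using a by (intro powr_mono2') auto
  moreover have "(2 ^ k) powr (- a) = (2 powr (- a)) ^ k"
    by (simp add: powr_realpow[symmetric] powr_powr mult.commute)
  ultimately show "\<exists>k::nat. norm z \<le> 2 ^ (k + 1) \<and> norm z powr (- a) \<le> (2 powr (- a)) ^ k"
    using n k by (auto intro!: exI[of _ k])
qed

text \<open>f is dominated by the sum over k of D d^k on the ball of radius R b^k, and these
  integrals form a geometric series of ratio d b^N. The choice b < 1 treats a singularity at 0, b >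
  1 a tail at infinity.\<close>

lemma nn_integral_dyadic_finite:
  fixes f :: "'a::euclidean_space \<Rightarrow> real"
  assumes [measurable]: "f \<in> borel_measurable borel"
    and f: "\<And>z. z \<noteq> 0 \<Longrightarrow> f z \<noteq> 0 \<Longrightarrow> \<exists>k::nat. norm z \<le> R * b ^ k \<and> f z \<le> D * d ^ k"
    and nonneg: "\<And>z. 0 \<le> f z" and pos: "0 < R" "0 < b" "0 \<le> D" "0 \<le> d" and conv: "d * b ^ DIM('a) < 1"
  shows "integrable lborel f"
proof -
  have [measurable]: "cball (0::'a) r \<in> sets borel" for r by simp
  define c where "c = D * (unit_ball_vol (real DIM('a)) * R ^ DIM('a))"
  have c: "0 \<le> c" using pos by (simp add: c_def)
  have "(\<integral>\<^sup>+z. ennreal (f z) \<partial>lborel) \<le> (\<integral>\<^sup>+z. (\<Sum>k. ennreal (D * d ^ k) * indicator (cball 0 (R * b ^ k)) z) \<partial>(lborel :: 'a measure))"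
  proof (rule nn_integral_mono_AE)
    have "AE z::'a in lborel. z \<noteq> 0" by (rule AE_lborel_singleton)
    then show "AE z::'a in lborel. ennreal (f z) \<le> (\<Sum>k. ennreal (D * d ^ k) * indicator (cball 0 (R * b ^ k)) z)"
    proof eventually_elim
      case (elim z)
      show ?case
      proof (cases "f z = 0")
        case False
        then obtain k where k: "norm z \<le> R * b ^ k" "f z \<le> D * d ^ k" using f elim by blast
        then have "ennreal (f z) \<le> ennreal (D * d ^ k) * indicator (cball 0 (R * b ^ k)) z"
          by (simp add: ennreal_leI)
        also have "\<dots> \<le> (\<Sum>k. ennreal (D * d ^ k) * indicator (cball 0 (R * b ^ k)) z)"
        proof -
          have "F k \<le> suminf F" for F :: "nat \<Rightarrow> ennreal"
            using sum_le_suminf[of F "{k}"] by simp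
          then show ?thesis .
        qed
        finally show ?thesis .
      qed simp
    qed
  qed
  also have "\<dots> = (\<Sum>k. \<integral>\<^sup>+z. ennreal (D * d ^ k) * indicator (cball 0 (R * b ^ k)) z \<partial>(lborel :: 'a measure))"
    by (rule nn_integral_suminf) measurable
  also have "\<dots> = (\<Sum>k. ennreal (c * (d * b ^ DIM('a)) ^ k))"
  proof (intro suminf_cong)
    fix k
    have "(\<integral>\<^sup>+z. ennreal (D * d ^ k) * indicator (cball 0 (R * b ^ k)) z \<partial>(lborel :: 'a measure))
        = ennreal (D * d ^ k) * ennreal (unit_ball_vol (real DIM('a)) * (R * b ^ k) ^ DIM('a))"
      using pos by (simp add: nn_integral_cmult emeasure_cball)
    also have "\<dots> = ennreal (D * d ^ k * (unit_ball_vol (real DIM('a)) * (R * b ^ k) ^ DIM('a)))"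
      using pos by (intro ennreal_mult[symmetric]) auto
    also have "D * d ^ k * (unit_ball_vol (real DIM('a)) * (R * b ^ k) ^ DIM('a)) = c * (d * b ^ DIM('a)) ^ k"
    proof -
      have "(b ^ k) ^ DIM('a) = (b ^ DIM('a)) ^ k" by (simp add: power_mult[symmetric] mult.commute)
      then show ?thesis unfolding c_def power_mult_distrib by (simp only: mult_ac)
    qed
    finally show "(\<integral>\<^sup>+z. ennreal (D * d ^ k) * indicator (cball 0 (R * b ^ k)) z \<partial>(lborel :: 'a measure))
      = ennreal (c * (d * b ^ DIM('a)) ^ k)" .
  qed
  also have "\<dots> = ennreal (\<Sum>k. c * (d * b ^ DIM('a)) ^ k)"
    using c pos conv by (intro suminf_ennreal2 summable_mult summable_geometric) auto
  also have "\<dots> < \<infinity>" by simp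
  finally show ?thesis
    using nonneg by (intro integrableI_nonneg) auto
qed

lemma integrable_norm_powr_cball:
  assumes "0 < a" "a < real DIM('a)"
  shows "integrable lborel (\<lambda>z::'a::euclidean_space. indicator (ball 0 1) z * norm z powr (- a))"
proof (rule nn_integral_dyadic_finite[where R = 1 and b = "1/2" and D = "2 powr a" and d = "2 powr a"])
  have [measurable]: "ball (0::'a) 1 \<in> sets borel" by simp
  show "(\<lambda>z::'a. indicator (ball 0 1) z * norm z powr (- a)) \<in> borel_measurable borel" by measurable
  show "2 powr a * (1/2) ^ DIM('a) < 1"
    using assms by (simp add: power_divide powr_realpow[symmetric] divide_less_eq)
  fix z :: 'a assume "z \<noteq> 0" "indicator (ball 0 1) z * norm z powr (- a) \<noteq> 0"
  then have "norm z < 1" by (auto simp: indicator_def split: if_splits)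
  with dyadic_power_bound(1)[OF \<open>z \<noteq> 0\<close> this assms(1)]
  show "\<exists>k. norm z \<le> 1 * (1/2) ^ k \<and> indicator (ball 0 1) z * norm z powr (- a) \<le> 2 powr a * (2 powr a) ^ k"
    by simp
qed auto

lemma integrable_norm_powr_outside:
  assumes "real DIM('a) < a"
  shows "integrable lborel (\<lambda>z::'a::euclidean_space. indicator (- ball 0 1) z * norm z powr (- a))"
proof (rule nn_integral_dyadic_finite[where R = 2 and b = 2 and D = 1 and d = "2 powr (- a)"])
  show "(\<lambda>z::'a. indicator (- ball 0 1) z * norm z powr (- a)) \<in> borel_measurable borel" by measurable
  have "2 powr (- a) * 2 ^ DIM('a) = 2 powr (real DIM('a) - a)"
    by (simp add: powr_realpow[symmetric] powr_add[symmetric])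
  also have "\<dots> < 2 powr 0" using assms by (intro powr_less_mono) auto
  finally show "2 powr (- a) * 2 ^ DIM('a) < 1" by simp
  fix z :: 'a assume "z \<noteq> 0" "indicator (- ball 0 1) z * norm z powr (- a) \<noteq> 0"
  then have "1 \<le> norm z" by (auto simp: indicator_def split: if_splits)
  moreover have "0 < a" using assms by (meson of_nat_0_le_iff le_less_trans)
  ultimately obtain k where "norm z \<le> 2 ^ (k + 1) \<and> norm z powr (- a) \<le> (2 powr (- a)) ^ k"
    using dyadic_power_bound(2)[OF \<open>z \<noteq> 0\<close>] by blast
  then show "\<exists>k. norm z \<le> 2 * 2 ^ k \<and> indicator (- ball 0 1) z * norm z powr (- a) \<le> 1 * (2 powr (- a)) ^ k"
    using \<open>1 \<le> norm z\<close> by (intro exI[of _ k]) auto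
qed auto

text \<open>Dilation by 2 maps |x| \<ge> 1 onto |x| \<ge> 2 and preserves |x|^(-N) dx. Finite
  integrals over both sets would be equal, although they differ by the positive integral over the
  shell between.\<close>

lemma not_integrable_critical:
  "\<not> integrable lborel (\<lambda>z::'a::euclidean_space. indicator (- ball 0 2) z * (1 / norm z ^ DIM('a)))"
proof
  let ?f = "\<lambda>z::'a. indicator (- ball 0 2) z * (1 / norm z ^ DIM('a))"
  let ?g = "\<lambda>z::'a. indicator (- ball 0 1) z * (1 / norm z ^ DIM('a))"
  assume int: "integrable lborel ?f"
  have [measurable]: "?f \<in> borel_measurable borel" "?g \<in> borel_measurable borel" by measurable
  have "(LINT z|lborel. ?f z) = 2 ^ DIM('a) * (LINT z|lborel. ?f (2 *\<^sub>R z))"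
    by (rule lborel_integral_scaleR) auto
  also have "\<dots> = (LINT z|lborel. 2 ^ DIM('a) * ?f (2 *\<^sub>R z))"
    by (rule integral_mult_right_zero[symmetric])
  also have "(\<lambda>z::'a. 2 ^ DIM('a) * ?f (2 *\<^sub>R z)) = ?g"
    by (rule ext) (auto simp: indicator_def power_mult_distrib)
  finally have eq: "(LINT z|lborel. ?f z) = (LINT z|lborel. ?g z)" .
  have intA: "integrable lborel (\<lambda>z::'a. indicator (cball 0 2 - ball 0 1) z *\<^sub>R (1 / norm z ^ DIM('a)))"
    by (rule borel_integrable_compact) (auto intro!: continuous_intros compact_diff)
  have "integrable lborel (\<lambda>z. ?f z + indicator (cball 0 2 - ball 0 1) z *\<^sub>R (1 / norm z ^ DIM('a)))"
    using int intA by (rule Bochner_Integration.integrable_add)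
  then have intg: "integrable lborel ?g"
    by (rule Bochner_Integration.integrable_bound) (auto simp: indicator_def)
  have intd: "integrable lborel (\<lambda>z. ?g z - ?f z)" using intg int by (rule Bochner_Integration.integrable_diff)
  have "(LINT z|lborel. ?g z - ?f z) = 0"
    using Bochner_Integration.integral_diff[OF intg int] eq by simp
  moreover have nn: "0 \<le> ?g z - ?f z" for z by (auto simp: indicator_def)
  ultimately have "AE z in lborel. ?g z - ?f z = 0"
    using integral_nonneg_eq_0_iff_AE[OF intd] by simp
  then have "AE z in lborel. z \<notin> ball (0::'a) 2 - cball 0 1"
    by eventually_elim (auto simp: indicator_def split: if_splits)
  then have "emeasure lborel (ball (0::'a) 2 - cball 0 1) = 0"
    by (subst (asm) AE_iff_measurable[where N = "ball (0::'a) 2 - cball 0 1"]) auto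
  moreover obtain b :: 'a where b: "norm b = 3/2" using vector_choose_size[of "3/2"] by auto
  have "ball b (1/2) \<subseteq> ball (0::'a) 2 - cball 0 1"
  proof
    fix y assume "y \<in> ball b (1/2)"
    then have "norm (b - y) < 1/2" by (simp add: dist_norm)
    then have "norm y < 2" "1 < norm y"
      using b norm_triangle_ineq4[of b "b - y"] norm_triangle_ineq[of y "b - y"] by auto
    then show "y \<in> ball 0 2 - cball 0 1" by simp
  qed
  then have "emeasure lborel (ball b (1/2)) \<le> emeasure lborel (ball (0::'a) 2 - cball 0 1)"
    by (intro emeasure_mono) auto
  ultimately have "emeasure lborel (ball b (1/2)) = 0" by simp
  moreover have "0 < (1/2::real) ^ DIM('a)" by simp
  ultimately show False
    using unit_ball_vol_pos[OF of_nat_0_le_iff, of "DIM('a)"]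
    by (auto simp: emeasure_ball ennreal_eq_0_iff mult_le_0_iff)
qed

section \<open>Riesz potentials and the Borel form of the problem\<close>

lemma lborel_eq_reflect: "lborel = distr lborel borel (\<lambda>z. x - z :: 'a::euclidean_space)"
proof -
  have "lborel = density (distr lborel borel (\<lambda>z. x + (- 1) *\<^sub>R z)) (\<lambda>_. ennreal (\<bar>- 1\<bar> ^ DIM('a)))"
    by (rule lborel_affine) simp
  also have "\<dots> = distr lborel borel (\<lambda>z. x - z)" by (simp add: density_1)
  finally show ?thesis .
qed

lemma integrable_reflect:
  fixes f :: "'a::euclidean_space \<Rightarrow> real"
  assumes "integrable lborel f"
  shows "integrable lborel (\<lambda>y. f (x - y))"
proof -
  have "integrable (distr lborel borel (\<lambda>z. x - z)) f"
    using assms by (subst lborel_eq_reflect[of x, symmetric])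
  then show ?thesis
    using assms by (subst (asm) integrable_distr_eq) auto
qed

text \<open>Split at distance d from x. Near x the density is bounded on a compact neighbourhood of
  C and the kernel is integrable because \<alpha> < N; farther away the kernel is at most a multiple
  of 1 / (1 + |y|^\<alpha>), uniformly for x in C.\<close>

lemma riesz_potential_locally_bounded:
  fixes v :: "'a::euclidean_space \<Rightarrow> real"
  assumes v [measurable]: "v \<in> borel_measurable borel" and v_nonneg: "\<And>y. 0 \<le> v y"
    and int: "integrable lborel (\<lambda>y. v y / (1 + norm y powr \<alpha>))" and \<alpha>: "0 < \<alpha>" "\<alpha> < real DIM('a)"
    and S: "open S" "compact C" "C \<subseteq> S"
    and loc: "\<And>K. compact K \<Longrightarrow> K \<subseteq> S \<Longrightarrow> \<exists>B. \<forall>y\<in>K. v y \<le> B"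
  shows "\<And>x. x \<in> C \<Longrightarrow> integrable lborel (\<lambda>y. v y / norm (x - y) powr \<alpha>)"
    and "\<exists>B. \<forall>x\<in>C. (LINT y|lborel. v y / norm (x - y) powr \<alpha>) \<le> B"
proof -
  obtain d0 where d0: "0 < d0" "\<And>x y. x \<in> C \<Longrightarrow> y \<in> - S \<Longrightarrow> d0 \<le> dist x y"
    using separate_compact_closed[OF S(2), of "- S"] S by (auto simp: closed_open disjoint_eq_subset_Compl)
  define d where "d = min 1 (d0 / 2)"
  have d: "0 < d" "d \<le> 1" "d < d0" using d0 by (auto simp: d_def)
  define C' where "C' = {x + y | x y. x \<in> C \<and> y \<in> cball 0 d}"
  have cC': "compact C'" unfolding C'_def by (intro compact_sums S compact_cball)
  have "C' \<subseteq> S"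
  proof
    fix z assume "z \<in> C'"
    then obtain x y where xy: "z = x + y" "x \<in> C" "norm y \<le> d" by (auto simp: C'_def)
    then have "dist x z < d0" using d by (simp add: dist_norm)
    then show "z \<in> S" using d0(2)[OF xy(2), of z] by auto
  qed
  from loc[OF cC' this] obtain B where B: "\<And>y. y \<in> C' \<Longrightarrow> v y \<le> B" by blast
  obtain R where R: "0 < R" "\<And>x. x \<in> C \<Longrightarrow> norm x \<le> R"
    using compact_imp_bounded[OF S(2)] by (auto simp: bounded_pos)
  \<comment> \<open>For |x - y| = t \<ge> d the first term makes D t^\<alpha> dominate the summand
    1, the second makes it dominate |y|^\<alpha>, since |y| \<le> R + t \<le> (R / d + 1) t.\<close>
  define D where "D = d powr (- \<alpha>) + (R / d + 1) powr \<alpha>"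
  have D: "0 \<le> D" by (simp add: D_def)
  define I1 where "I1 z = indicator (ball 0 1) z * norm z powr (- \<alpha>)" for z :: 'a
  define I2 where "I2 y = v y / (1 + norm y powr \<alpha>)" for y
  have I1: "integrable lborel I1" unfolding I1_def by (rule integrable_norm_powr_cball[OF \<alpha>])
  have I1n: "0 \<le> I1 z" for z by (simp add: I1_def)
  have I2n: "0 \<le> I2 y" for y using v_nonneg by (simp add: I2_def)
  have I2: "integrable lborel I2" using int by (simp add: I2_def[abs_def])
  have bound: "v y / norm (x - y) powr \<alpha> \<le> \<bar>B\<bar> * I1 (x - y) + D * I2 y" if x: "x \<in> C" for x y
  proof (cases "norm (x - y) < d")
    case True
    have "y \<in> C'"
      unfolding C'_def using x True
      by (intro CollectI exI[of _ x] exI[of _ "y - x"]) (auto simp: norm_minus_commute)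
    then have "v y \<le> \<bar>B\<bar>" using B by force
    then have "v y / norm (x - y) powr \<alpha> \<le> \<bar>B\<bar> * norm (x - y) powr (- \<alpha>)"
      unfolding powr_minus_divide by (simp add: divide_right_mono)
    also have "norm (x - y) powr (- \<alpha>) = I1 (x - y)"
      using True d by (simp add: I1_def)
    finally show ?thesis using D I2n[of y] by (simp add: add_increasing2)
  next
    case False
    define t where "t = norm (x - y)"
    have t: "d \<le> t" using False by (simp add: t_def)
    have "1 \<le> (t / d) powr \<alpha>" using t d \<alpha> by (intro ge_one_powr_ge_zero) (auto simp: le_divide_eq)
    then have a1: "1 \<le> d powr (- \<alpha>) * t powr \<alpha>"
      using t d by (simp add: powr_divide powr_minus field_simps)
    have "R * 1 \<le> R * (t / d)" using R(1) t d by (intro mult_left_mono) (auto simp: le_divide_eq)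
    then have "norm x \<le> R * (t / d)" using R(2)[OF x] by linarith
    have "norm y \<le> norm x + t" using norm_triangle_ineq4[of x "x - y"] by (simp add: t_def)
    also have "\<dots> \<le> R * (t / d) + t"
      using \<open>norm x \<le> R * (t / d)\<close> by simp
    also have "\<dots> = (R / d + 1) * t" by (simp add: algebra_simps)
    finally have "norm y powr \<alpha> \<le> ((R / d + 1) * t) powr \<alpha>" using \<alpha> by (intro powr_mono2) auto
    then have "norm y powr \<alpha> \<le> (R / d + 1) powr \<alpha> * t powr \<alpha>" by (simp add: powr_mult)
    with a1 have "1 + norm y powr \<alpha> \<le> D * t powr \<alpha>" by (simp add: D_def algebra_simps)
    moreover have "0 < t" using t d by linarith
    moreover have "0 < 1 + norm y powr \<alpha>" by (simp add: add_pos_nonneg)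
    ultimately have "1 / t powr \<alpha> \<le> D / (1 + norm y powr \<alpha>)" by (simp add: field_simps)
    then have "v y * (1 / t powr \<alpha>) \<le> v y * (D / (1 + norm y powr \<alpha>))"
      using v_nonneg by (intro mult_left_mono)
    then have "v y / t powr \<alpha> \<le> D * I2 y" by (simp add: I2_def mult.commute)
    then show ?thesis using I1n[of "x - y"] by (simp add: t_def add_increasing)
  qed
  have intb: "integrable lborel (\<lambda>y. \<bar>B\<bar> * I1 (x - y) + D * I2 y)" for x
    by (intro Bochner_Integration.integrable_add integrable_mult_right integrable_reflect I1 I2)
  have m: "(\<lambda>y. v y / norm (x - y) powr \<alpha>) \<in> borel_measurable lborel" for x by measurable
  show int_x: "integrable lborel (\<lambda>y. v y / norm (x - y) powr \<alpha>)" if "x \<in> C" for x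
  proof (rule Bochner_Integration.integrable_bound[OF intb[of x] m])
    show "AE y in lborel. norm (v y / norm (x - y) powr \<alpha>) \<le> norm (\<bar>B\<bar> * I1 (x - y) + D * I2 y)"
      using bound[OF that] v_nonneg by (intro always_eventually allI) (smt (verit) real_norm_def divide_nonneg_nonneg powr_ge_zero)
  qed
  have mI1: "I1 \<in> borel_measurable borel" using borel_measurable_integrable[OF I1] by simp
  show "\<exists>B. \<forall>x\<in>C. (LINT y|lborel. v y / norm (x - y) powr \<alpha>) \<le> B"
  proof (intro exI ballI)
    fix x assume x: "x \<in> C"
    have "(LINT y|lborel. v y / norm (x - y) powr \<alpha>) \<le> (LINT y|lborel. \<bar>B\<bar> * I1 (x - y) + D * I2 y)"
      by (rule Bochner_Integration.integral_mono[OF int_x[OF x] intb bound[OF x]])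
    also have "\<dots> = \<bar>B\<bar> * (LINT y|lborel. I1 (x - y)) + D * (LINT y|lborel. I2 y)"
      by (subst Bochner_Integration.integral_add) (auto intro!: integrable_mult_right integrable_reflect I1 I2)
    also have "(LINT y|lborel. I1 (x - y)) = (LINT y|lborel. I1 y)"
      by (rule lborel_integral_reflect[symmetric, OF mI1])
    finally show "(LINT y|lborel. v y / norm (x - y) powr \<alpha>) \<le> \<bar>B\<bar> * (LINT y|lborel. I1 y) + D * (LINT y|lborel. I2 y)" .
  qed
qed

text \<open>The cut removes the unit sphere as well, where u is arbitrary, so that continuity of u
  outside the closed ball suffices for Borel measurability.\<close>

definition ext_power :: "real \<Rightarrow> ('a::euclidean_space \<Rightarrow> real) \<Rightarrow> 'a \<Rightarrow> real" where
  "ext_power p u y = indicator (- cball 0 1) y * u y powr p"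

definition riesz :: "real \<Rightarrow> ('a::euclidean_space \<Rightarrow> real) \<Rightarrow> 'a \<Rightarrow> real" where
  "riesz \<alpha> v x = (LINT y|lborel. v y / norm (x - y) powr \<alpha>)"

lemma ext_power_nonneg: "0 \<le> ext_power p u y"
  by (simp add: ext_power_def)

lemma ext_power_measurable:
  fixes u :: "'a::euclidean_space \<Rightarrow> real"
  assumes "continuous_on (- cball 0 1) u" "\<And>x. x \<in> - cball 0 1 \<Longrightarrow> 0 < u x"
  shows "ext_power p u \<in> borel_measurable borel"
proof -
  have "continuous_on (- cball 0 1) (\<lambda>y. u y powr p)"
    using assms by (intro continuous_intros) (auto simp: less_imp_neq[symmetric])
  then have "(\<lambda>y. indicator (- cball 0 1) y *\<^sub>R (u y powr p)) \<in> borel_measurable borel"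
    by (intro borel_measurable_continuous_on_indicator) auto
  then show ?thesis by (simp add: ext_power_def[abs_def])
qed

lemma riesz_measurable [measurable]:
  assumes [measurable]: "v \<in> borel_measurable borel"
  shows "riesz \<alpha> v \<in> borel_measurable borel"
  unfolding riesz_def[abs_def] by measurable

lemma ext_conv_eq_riesz:
  fixes u :: "'a::euclidean_space \<Rightarrow> real"
  assumes [measurable]: "ext_power p u \<in> borel_measurable borel"
  shows "ext_conv \<alpha> (\<lambda>y. u y powr p) x = riesz \<alpha> (ext_power p u) x"
  unfolding ext_conv_def riesz_def set_lebesgue_integral_def
proof (rule lebesgue_integral_AE(2))
  show "AE y in lborel. indicator (- ball 0 1) y *\<^sub>R (u y powr p / norm (x - y) powr \<alpha>)
      = ext_power p u y / norm (x - y) powr \<alpha>"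
    using AE_not_unit_sphere by eventually_elim (auto simp: ext_power_def indicator_def)
qed measurable

lemma solution_integrable_iff:
  fixes u :: "'a::euclidean_space \<Rightarrow> real"
  assumes [measurable]: "ext_power p u \<in> borel_measurable borel"
  shows "set_integrable lebesgue (- ball 0 1) (\<lambda>y. u y powr p / (1 + norm y powr \<alpha>)) \<longleftrightarrow>
    integrable lborel (\<lambda>y. ext_power p u y / (1 + norm y powr \<alpha>))"
  unfolding set_integrable_def
proof (rule lebesgue_integral_AE(1))
  show "AE y in lborel. indicator (- ball 0 1) y *\<^sub>R (u y powr p / (1 + norm y powr \<alpha>))
      = ext_power p u y / (1 + norm y powr \<alpha>)"
    using AE_not_unit_sphere by eventually_elim (auto simp: ext_power_def indicator_def)
qed measurable

lemma lebesgue_weak_form: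
  fixes f h :: "'a::euclidean_space \<Rightarrow> real"
  assumes [measurable]: "h \<in> borel_measurable borel" and "\<And>x. 1 < norm x \<Longrightarrow> f x = h x" "\<And>x. norm x \<le> 1 \<Longrightarrow> h x = 0"
  shows "(LINT x:(- ball 0 1)|lebesgue. f x) = (LINT x|lborel. h x)"
  unfolding set_lebesgue_integral_def
proof (rule lebesgue_integral_AE(2))
  show "AE x in lborel. indicator (- ball 0 1) x *\<^sub>R f x = h x"
    using AE_not_unit_sphere
  proof eventually_elim
    case (elim x)
    then show ?case using assms(2,3)[of x] by (cases "norm x < 1") (auto simp: indicator_def)
  qed
qed measurable

lemma test_function_onI:
  fixes \<theta> :: "'a::euclidean_space \<Rightarrow> real"
  assumes "\<And>k. Ck_on k UNIV \<theta>" "compact K" "K \<subseteq> S" "\<And>x. x \<notin> K \<Longrightarrow> \<theta> x = 0"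
  shows "test_function_on S \<theta>"
proof -
  have "closure {x. \<theta> x \<noteq> 0} \<subseteq> K"
    using assms by (intro closure_minimal compact_imp_closed) auto
  moreover have "bounded {x. \<theta> x \<noteq> 0}"
    by (rule bounded_subset[OF compact_imp_bounded[OF assms(2)]]) (use assms(4) in auto)
  ultimately show ?thesis
    using assms by (auto simp: test_function_on_def compact_closure)
qed

section \<open>Necessity of the conditions\<close>

lemma ext_power_locally_bounded:
  fixes u :: "'a::euclidean_space \<Rightarrow> real"
  assumes "continuous_on (- cball 0 1) u" "\<And>x. x \<in> - cball 0 1 \<Longrightarrow> 0 < u x"
    and "compact K" "K \<subseteq> - cball 0 1"
  shows "\<exists>B. \<forall>y\<in>K. ext_power p u y \<le> B"
proof -
  have "continuous_on K (\<lambda>y. u y powr p)"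
    using assms by (intro continuous_intros) (auto simp: less_imp_neq[symmetric] intro: continuous_on_subset)
  then have "bounded ((\<lambda>y. u y powr p) ` K)"
    using assms(3) by (intro compact_imp_bounded compact_continuous_image)
  then obtain B where "\<forall>y\<in>K. \<bar>u y powr p\<bar> \<le> B" by (auto simp: bounded_iff)
  then show ?thesis using assms(4) by (intro exI[of _ B]) (auto simp: ext_power_def indicator_def)
qed

lemma riesz_lower_bound:
  fixes v :: "'a::euclidean_space \<Rightarrow> real"
  assumes v_nonneg: "\<And>y. 0 \<le> v y" and int: "integrable lborel (\<lambda>y. v y / norm (x - y) powr \<alpha>)"
    and low: "\<And>y. y \<in> cball z \<rho> \<Longrightarrow> \<eta> \<le> v y" "\<And>y. y \<in> cball z \<rho> \<Longrightarrow> norm (x - y) \<le> D"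
    and "0 \<le> \<eta>" "0 < D" "0 < \<alpha>" "0 \<le> \<rho>"
  shows "\<eta> * D powr (- \<alpha>) * (unit_ball_vol (real DIM('a)) * \<rho> ^ DIM('a)) \<le> riesz \<alpha> v x"
proof -
  have "(LINT y|lborel. indicator (cball z \<rho>) y *\<^sub>R (\<eta> * D powr (- \<alpha>))) \<le> riesz \<alpha> v x"
    unfolding riesz_def
  proof (rule integral_mono_AE[OF _ int])
    show "integrable lborel (\<lambda>y. indicator (cball z \<rho>) y *\<^sub>R (\<eta> * D powr (- \<alpha>)))"
      by (rule borel_integrable_compact) auto
    \<comment> \<open>at \<open>y = x\<close> the integrand is a quotient by zero, hence zero\<close>
    have "AE y in lborel. y \<noteq> x" by (rule AE_lborel_singleton)
    then show "AE y in lborel. indicator (cball z \<rho>) y *\<^sub>R (\<eta> * D powr (- \<alpha>)) \<le> v y / norm (x - y) powr \<alpha>"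
    proof eventually_elim
      case (elim y)
      show ?case
      proof (cases "y \<in> cball z \<rho>")
        case True
        have "norm (x - y) powr \<alpha> \<le> D powr \<alpha>" using low(2)[OF True] assms by (intro powr_mono2) auto
        moreover have "0 < norm (x - y) powr \<alpha>" using elim by simp
        ultimately have "\<eta> / D powr \<alpha> \<le> v y / norm (x - y) powr \<alpha>"
          using low(1)[OF True] assms by (intro frac_le) auto
        then show ?thesis using True by (simp add: powr_minus_divide)
      qed (use v_nonneg in simp)
    qed
  qed
  moreover have "(LINT y|lborel. indicator (cball z \<rho>) y *\<^sub>R (\<eta> * D powr (- \<alpha>)))
      = \<eta> * D powr (- \<alpha>) * (unit_ball_vol (real DIM('a)) * \<rho> ^ DIM('a))"
    using content_cball[OF \<open>0 \<le> \<rho>\<close>, of z] by (simp add: mult.commute)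
  ultimately show ?thesis by (simp only:)
qed

locale exterior_solution = flux_profile "\<lambda>t. t powr (m - 2) * g t + t powr (s - 2)" s
  for g :: "real \<Rightarrow> real" and m s :: real +
  fixes \<alpha> p q :: real and u :: "'a::euclidean_space \<Rightarrow> real"
  assumes sol: "positive_C1_solution g m s \<alpha> p q u"
    and alpha: "0 < \<alpha>" "\<alpha> < real DIM('a)" and s_dim: "s < real DIM('a)"
    and pq: "s - 1 < p" "s - 1 < q"
begin

abbreviation "v \<equiv> ext_power p u"
definition "F x = riesz \<alpha> v x * ext_power q u x"

lemma u_C1: "C1_on (- cball 0 1) u"
proof -
  have "Ck_on 1 (- cball 0 1) u" using sol unfolding positive_C1_solution_def by (elim conjE)
  then show ?thesis by (simp only: Ck_on_1_iff_C1_on)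
qed

lemma u_pos: "x \<in> - cball 0 1 \<Longrightarrow> 0 < u x"
  using sol unfolding positive_C1_solution_def by blast

lemma ext_power_borel [measurable]: "ext_power r u \<in> borel_measurable borel"
  by (rule ext_power_measurable[OF C1_on_continuous[OF u_C1] u_pos])

lemma v_integrable: "integrable lborel (\<lambda>y. v y / (1 + norm y powr \<alpha>))"
proof -
  have "set_integrable lebesgue (- ball 0 1) (\<lambda>y. u y powr p / (1 + norm y powr \<alpha>))"
    using sol unfolding positive_C1_solution_def by (elim conjE)
  then show ?thesis by (simp only: solution_integrable_iff[OF ext_power_borel])
qed

lemma F_measurable [measurable]: "F \<in> borel_measurable borel"
  unfolding F_def[abs_def] by measurable

lemma F_eq: "1 < norm x \<Longrightarrow> F x = ext_conv \<alpha> (\<lambda>y. u y powr p) x * u x powr q"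
  unfolding F_def ext_conv_eq_riesz[OF ext_power_borel] by (simp add: ext_power_def)

lemmas riesz_bounds = riesz_potential_locally_bounded[OF ext_power_borel ext_power_nonneg v_integrable alpha
    _ _ _ ext_power_locally_bounded[OF C1_on_continuous[OF u_C1] u_pos]]

lemma riesz_integrable: "1 < norm x \<Longrightarrow> integrable lborel (\<lambda>y. v y / norm (x - y) powr \<alpha>)"
  by (rule riesz_bounds(1)[of "- cball 0 1" "{x}"]) auto

lemma riesz_nonneg: "0 \<le> riesz \<alpha> v x"
  unfolding riesz_def by (intro Bochner_Integration.integral_nonneg divide_nonneg_nonneg ext_power_nonneg) auto

lemma F_nonneg: "0 \<le> F x"
  unfolding F_def by (intro mult_nonneg_nonneg riesz_nonneg ext_power_nonneg)

lemma F_integrable: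
  assumes K: "compact K" "K \<subseteq> - cball 0 1"
  shows "set_integrable lborel K F"
proof -
  obtain B1 where B1: "\<forall>x\<in>K. riesz \<alpha> v x \<le> B1"
    using riesz_bounds(2)[of "- cball 0 1" K] K unfolding riesz_def by auto
  obtain B2 where B2: "\<forall>x\<in>K. ext_power q u x \<le> B2"
    using ext_power_locally_bounded[OF C1_on_continuous[OF u_C1] u_pos K] by blast
  have [measurable]: "K \<in> sets borel" using K(1) by (rule borel_compact)
  show ?thesis
    unfolding set_integrable_def
  proof (rule Bochner_Integration.integrable_bound)
    show "integrable lborel (\<lambda>x. indicator K x *\<^sub>R (B1 * B2))"
      by (rule borel_integrable_compact[OF K(1)]) auto
    have "norm (indicator K x *\<^sub>R F x) \<le> norm (indicator K x *\<^sub>R (B1 * B2))" for x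
    proof (cases "x \<in> K")
      case True
      have "F x \<le> B1 * B2"
        unfolding F_def using B1 B2 True riesz_nonneg[of x] ext_power_nonneg[of q u x]
        by (intro mult_mono) (auto intro: order_trans)
      then show ?thesis using F_nonneg[of x] True by simp
    qed simp
    then show "AE x in lborel. norm (indicator K x *\<^sub>R F x) \<le> norm (indicator K x *\<^sub>R (B1 * B2))" by simp
  qed measurable
qed

lemma weak_smooth:
  assumes \<theta>: "\<And>k. Ck_on k UNIV \<theta>" and K: "compact K" "K \<subseteq> - cball 0 1" "\<And>x. x \<notin> K \<Longrightarrow> \<theta> x = 0"
  shows "(LINT x|lborel. field (grad u x) \<bullet> grad \<theta> x) = (LINT x|lborel. F x * \<theta> x)"
proof -
  have clK: "closed K" using K(1) by (rule compact_imp_closed)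
  have C1: "C1_on UNIV \<theta>" using \<theta>[of 1] Ck_on_1_iff_C1_on by blast
  have gz: "grad \<theta> x = 0" if "x \<notin> K" for x
    by (rule grad_zero_outside(2)[OF clK K(3) that])
  have cont: "continuous_on UNIV (\<lambda>x. field (grad u x) \<bullet> grad \<theta> x)"
  proof (rule continuous_on_glue_zero[of "- cball 0 1" K])
    show "continuous_on (- cball 0 1) (\<lambda>x. field (grad u x) \<bullet> grad \<theta> x)"
      using C1_on_continuous_grad[OF u_C1] C1_on_continuous_grad[OF C1]
      by (intro continuous_on_inner continuous_on_compose2[OF continuous_on_field[of UNIV]])
        (auto intro: continuous_on_subset)
  qed (use clK K(2) gz in auto)
  have outK: "x \<notin> K" if "norm x \<le> 1" for x using K(2) that by auto
  have [measurable]: "\<theta> \<in> borel_measurable borel"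
    by (rule borel_measurable_continuous_onI[OF C1_on_continuous[OF C1]])
  have "test_function_on (- cball 0 1) \<theta>"
    by (rule test_function_onI[OF \<theta> K])
  then have "(LINT x:(- ball 0 1)|lebesgue.
           (norm (grad u x) powr (m - 2) * g (norm (grad u x)) + norm (grad u x) powr (s - 2))
             * (grad u x \<bullet> grad \<theta> x))
        = (LINT x:(- ball 0 1)|lebesgue.
             ext_conv \<alpha> (\<lambda>y. u y powr p) x * u x powr q * \<theta> x)"
    using sol unfolding positive_C1_solution_def by blast
  moreover have "(LINT x:(- ball 0 1)|lebesgue.
           (norm (grad u x) powr (m - 2) * g (norm (grad u x)) + norm (grad u x) powr (s - 2))
             * (grad u x \<bullet> grad \<theta> x)) = (LINT x|lborel. field (grad u x) \<bullet> grad \<theta> x)"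
    by (rule lebesgue_weak_form[OF borel_measurable_continuous_onI[OF cont]])
      (simp_all add: field_def gz outK)
  moreover have "(LINT x:(- ball 0 1)|lebesgue.
             ext_conv \<alpha> (\<lambda>y. u y powr p) x * u x powr q * \<theta> x) = (LINT x|lborel. F x * \<theta> x)"
    by (rule lebesgue_weak_form) (simp_all add: F_eq K(3) outK)
  ultimately show ?thesis by simp
qed

text \<open>The weak identity of the solution, extended to C1 test functions, makes it a
  supersolution with F as source; all barrier estimates now apply to u.\<close>

sublocale exterior_supersolution "\<lambda>t. t powr (m - 2) * g t + t powr (s - 2)" s u F "DIM('a)"
proof
  show "0 < u x" if "1 < norm x" for x using u_pos[of x] that by simp
  fix \<phi> :: "'a \<Rightarrow> real" and K
  assume \<phi>: "C1_on UNIV \<phi>" "compact K" "K \<subseteq> - cball 0 1" "\<And>x. x \<notin> K \<Longrightarrow> \<phi> x = 0" "\<And>x. 0 \<le> \<phi> x"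
  show "(LINT x|lborel. F x * \<phi> x) \<le> (LINT x|lborel. field (grad u x) \<bullet> grad \<phi> x)"
  proof (rule eq_refl, rule sym, rule weak_identity_extends[where S = "- cball 0 1" and F = F and K = K])
    show "open (- cball (0::'a) 1)" by auto
  qed (fact u_C1 F_integrable weak_smooth \<phi>)+
qed (use s_dim u_C1 F_nonneg F_integrable in auto)

lemma superlinear_growth_contradiction:
  assumes "s - 1 < e" "0 < c"
    and "\<And>r W x. 2 \<le> r \<Longrightarrow> 0 < W \<Longrightarrow> (\<And>y. r \<le> norm y \<Longrightarrow> W * norm y powr (- decay) \<le> u y) \<Longrightarrow>
      r < norm x \<Longrightarrow> c * W powr e / norm x ^ DIM('a) \<le> F x"
  shows False
proof -
  interpret superlinear_supersolution "\<lambda>t. t powr (m - 2) * g t + t powr (s - 2)" s u F "DIM('a)" c e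
    by unfold_locales (use assms in auto)
  show False by (rule no_superlinear_supersolution)
qed

section \<open>The three necessary inequalities\<close>

lemma power_lower:
  assumes "0 \<le> W" "0 < t" "W * t powr (- decay) \<le> w" "0 < r"
  shows "W powr r * t powr (- (decay * r)) \<le> w powr r"
proof -
  have "(W * t powr (- decay)) powr r \<le> w powr r" using assms by (intro powr_mono2) auto
  then show ?thesis by (simp add: powr_mult powr_powr)
qed

text \<open>Under the opposite inequality u^p / (1 + |y|^\<alpha>) is at least c |y|^(-N) for |y|
  \<ge> 2, which is not integrable. The factor 1/2 in c comes from 1 + t^\<alpha> \<le> 2
  t^\<alpha>.\<close>

lemma p_condition: "real DIM('a) - \<alpha> < decay * p"
proof (rule ccontr)
  assume "\<not> ?thesis"
  then have le: "decay * p \<le> real DIM('a) - \<alpha>" by simp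
  obtain W where W: "0 < W" "\<And>x. 2 \<le> norm x \<Longrightarrow> W * norm x powr (- decay) \<le> u x"
    using initial_decay by blast
  define c where "c = W powr p / 2"
  have c: "0 < c" using W by (simp add: c_def)
  have p: "0 < p" using pq s_gt_1 by linarith
  have "integrable lborel (\<lambda>z::'a. c * (indicator (- ball 0 2) z * (1 / norm z ^ DIM('a))))"
  proof (rule Bochner_Integration.integrable_bound[OF v_integrable])
    have [measurable]: "ball (0::'a) 2 \<in> sets borel" by simp
    show "(\<lambda>z::'a. c * (indicator (- ball 0 2) z * (1 / norm z ^ DIM('a)))) \<in> borel_measurable lborel"
      by measurable
    have low: "c * (indicator (- ball 0 2) z * (1 / norm z ^ DIM('a))) \<le> v z / (1 + norm z powr \<alpha>)" for z :: 'a
    proof (cases "2 \<le> norm z")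
      case True
      define t where "t = norm z"
      have t: "2 \<le> t" using True by (simp add: t_def)
      have "W powr p * t powr (- (decay * p)) \<le> u z powr p"
        using W(2)[OF True] W(1) t p unfolding t_def by (intro power_lower) auto
      moreover have "t powr (- (real DIM('a) - \<alpha>)) \<le> t powr (- (decay * p))"
        using t le by (intro powr_mono) auto
      ultimately have "W powr p * t powr (- (real DIM('a) - \<alpha>)) \<le> u z powr p"
        using mult_left_mono[of "t powr (- (real DIM('a) - \<alpha>))" "t powr (- (decay * p))" "W powr p"] by simp
      moreover have "1 + t powr \<alpha> \<le> 2 * t powr \<alpha>"
        using t alpha ge_one_powr_ge_zero[of t \<alpha>] by simp
      ultimately have "(W powr p * t powr (- (real DIM('a) - \<alpha>))) / (2 * t powr \<alpha>) \<le> u z powr p / (1 + t powr \<alpha>)"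
        by (intro frac_le) (auto simp: add_pos_nonneg)
      moreover have "(W powr p * t powr (- (real DIM('a) - \<alpha>))) / (2 * t powr \<alpha>) = c * (1 / t ^ DIM('a))"
        using t by (simp add: c_def powr_minus powr_diff powr_realpow field_simps)
      ultimately show ?thesis using t by (simp add: t_def ext_power_def)
    next
      case False
      then show ?thesis using ext_power_nonneg[of p u z]
        by (auto intro!: divide_nonneg_nonneg add_nonneg_nonneg)
    qed
    show "AE z in lborel. norm (c * (indicator (- ball 0 2) z * (1 / norm z ^ DIM('a))))
        \<le> norm (v z / (1 + norm z powr \<alpha>))"
      using c by (intro always_eventually allI norm_le_of_nonneg low) auto
  qed
  then have "integrable lborel (\<lambda>z::'a. (1 / c) * (c * (indicator (- ball 0 2) z * (1 / norm z ^ DIM('a)))))"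
    by (rule integrable_mult_right)
  then have "integrable lborel (\<lambda>z::'a. indicator (- ball 0 2) z * (1 / norm z ^ DIM('a)))"
    using c by simp
  then show False using not_integrable_critical by blast
qed

text \<open>A fixed amount of mass of u^p near z already makes the Riesz potential at least a
  multiple of |x|^(-\<alpha>). Only the factor u^q carries W, hence e = q.\<close>

lemma q_condition: "real DIM('a) - \<alpha> < decay * q"
proof (rule ccontr)
  assume "\<not> ?thesis"
  then have le: "\<alpha> + decay * q \<le> real DIM('a)" by simp
  have p: "0 < p" and q: "0 < q" using pq s_gt_1 by linarith+
  obtain W0 where W0: "0 < W0" "\<And>x. 2 \<le> norm x \<Longrightarrow> W0 * norm x powr (- decay) \<le> u x"
    using initial_decay by blast
  \<comment> \<open>The ball of radius 1/2 about z lies in 2 \<le> |y| \<le> 3, where the initial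
    decay bound holds.\<close>
  obtain z :: 'a where z: "norm z = 5/2" using vector_choose_size[of "5/2"] by auto
  define \<eta> where "\<eta> = W0 powr p * 3 powr (- (decay * p))"
  define V where "V = unit_ball_vol (real DIM('a)) * (1/2) ^ DIM('a)"
  have V: "0 < V" using unit_ball_vol_pos[OF of_nat_0_le_iff, of "DIM('a)"] by (simp add: V_def)
  have \<eta>: "0 < \<eta>" using W0 by (simp add: \<eta>_def)
  have ann: "2 \<le> norm y" "norm y \<le> 3" if "y \<in> cball z (1/2)" for y
    using that z norm_triangle_ineq4[of z "z - y"] norm_triangle_ineq[of y "z - y"] by (auto simp: dist_norm)
  show False
  proof (rule superlinear_growth_contradiction[OF pq(2), of "\<eta> * 3 powr (- \<alpha>) * V"])
    show "0 < \<eta> * 3 powr (- \<alpha>) * V" using \<eta> V by simp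
    fix r W and x :: 'a
    assume r: "2 \<le> r" and W: "0 < W" and lower: "\<And>y. r \<le> norm y \<Longrightarrow> W * norm y powr (- decay) \<le> u y" and x: "r < norm x"
    define t where "t = norm x"
    have t: "2 < t" "r < t" using r x by (simp_all add: t_def)
    have "\<eta> * (3 * t) powr (- \<alpha>) * (unit_ball_vol (real DIM('a)) * (1/2) ^ DIM('a)) \<le> riesz \<alpha> v x"
    proof (rule riesz_lower_bound[where z = z])
      show "integrable lborel (\<lambda>y. v y / norm (x - y) powr \<alpha>)"
        by (rule riesz_integrable) (use t in \<open>simp add: t_def\<close>)
      fix y assume y: "y \<in> cball z (1/2)"
      show "norm (x - y) \<le> 3 * t" using norm_triangle_ineq4[of x y] ann[OF y] t by (simp add: t_def)
      have "W0 * 3 powr (- decay) \<le> W0 * norm y powr (- decay)"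
        using W0 ann[OF y] decay_pos by (intro mult_left_mono powr_mono2') auto
      also have "\<dots> \<le> u y" by (rule W0(2)[OF ann(1)[OF y]])
      finally have "\<eta> \<le> u y powr p" unfolding \<eta>_def using W0 p by (intro power_lower) auto
      then show "\<eta> \<le> v y" using ann[OF y] by (simp add: ext_power_def)
    qed (use \<eta> t alpha in \<open>auto simp: ext_power_nonneg\<close>)
    then have R: "\<eta> * (3 * t) powr (- \<alpha>) * V \<le> riesz \<alpha> v x" by (simp add: V_def)
    have U: "W powr q * t powr (- (decay * q)) \<le> ext_power q u x"
    proof -
      have "W powr q * t powr (- (decay * q)) \<le> u x powr q"
        using lower[of x] t W q unfolding t_def by (intro power_lower) auto
      then show ?thesis using t by (simp add: ext_power_def t_def)
    qed
    have "t powr (- real DIM('a)) \<le> t powr (- (\<alpha> + decay * q))"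
      using le t by (intro powr_mono) auto
    then have "\<eta> * 3 powr (- \<alpha>) * V * W powr q * t powr (- real DIM('a))
        \<le> \<eta> * 3 powr (- \<alpha>) * V * W powr q * t powr (- (\<alpha> + decay * q))"
      using \<eta> V by (intro mult_left_mono) auto
    also have "\<dots> = (\<eta> * (3 * t) powr (- \<alpha>) * V) * (W powr q * t powr (- (decay * q)))"
      by (simp add: powr_mult powr_add[symmetric])
    also have "\<dots> \<le> riesz \<alpha> v x * ext_power q u x"
      using R U \<eta> V by (intro mult_mono riesz_nonneg) auto
    finally have "\<eta> * 3 powr (- \<alpha>) * V * W powr q * t powr (- real DIM('a)) \<le> F x" by (simp only: F_def)
    moreover have "t powr (- real DIM('a)) = 1 / t ^ DIM('a)"
      using t by (simp add: powr_minus_divide powr_realpow)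
    ultimately show "\<eta> * 3 powr (- \<alpha>) * V * W powr q / norm x ^ DIM('a) \<le> F x" by (simp add: t_def)
  qed
qed

text \<open>Here the Riesz potential is estimated through the mass of u^p at distances comparable to
  t = |x|. The ball of radius t/2 about 3x/2 lies in t \<le> |y| \<le> 2t, hence in the region of
  the bound with W, and within distance t of x. So the potential is at least a multiple of W^p t^(N
  - \<alpha> - decay p), and both factors contribute to e = p + q.\<close>

lemma pq_condition: "2 * real DIM('a) - \<alpha> < decay * (p + q)"
proof (rule ccontr)
  assume "\<not> ?thesis"
  then have le: "decay * (p + q) \<le> 2 * real DIM('a) - \<alpha>" by simp
  have p: "0 < p" and q: "0 < q" using pq s_gt_1 by linarith+
  define V where "V = unit_ball_vol (real DIM('a)) * (1/2) ^ DIM('a) * 2 powr (- (decay * p))"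
  have V: "0 < V" using unit_ball_vol_pos[OF of_nat_0_le_iff, of "DIM('a)"] by (simp add: V_def)
  show False
  proof (rule superlinear_growth_contradiction[of "p + q" V])
    show "s - 1 < p + q" using pq s_gt_1 by linarith
    fix r W and x :: 'a
    assume r: "2 \<le> r" and W: "0 < W" and lower: "\<And>y. r \<le> norm y \<Longrightarrow> W * norm y powr (- decay) \<le> u y" and x: "r < norm x"
    define t where "t = norm x"
    have t: "2 < t" "r < t" using r x by (simp_all add: t_def)
    define \<eta> where "\<eta> = W powr p * (2 * t) powr (- (decay * p))"
    have \<eta>: "0 < \<eta>" using W t by (simp add: \<eta>_def)
    have "\<eta> * t powr (- \<alpha>) * (unit_ball_vol (real DIM('a)) * (t / 2) ^ DIM('a)) \<le> riesz \<alpha> v x"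
    proof (rule riesz_lower_bound[where z = "(3/2) *\<^sub>R x"])
      show "integrable lborel (\<lambda>y. v y / norm (x - y) powr \<alpha>)"
        by (rule riesz_integrable) (use t in \<open>simp add: t_def\<close>)
      fix y assume "y \<in> cball ((3/2) *\<^sub>R x) (t / 2)"
      then have y: "norm ((3/2) *\<^sub>R x - y) \<le> t / 2" by (simp add: dist_norm)
      have n: "norm ((3/2) *\<^sub>R x) = 3/2 * t" by (simp add: t_def)
      have ann: "t \<le> norm y" "norm y \<le> 2 * t"
        using y n norm_triangle_ineq4[of "(3/2) *\<^sub>R x" "(3/2) *\<^sub>R x - y"] norm_triangle_ineq[of y "(3/2) *\<^sub>R x - y"] by auto
      have "(3/2) *\<^sub>R x = x + (1/2) *\<^sub>R x" using scaleR_left_distrib[of 1 "1/2" x] by simp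
      then have eq: "x - y = ((3/2) *\<^sub>R x - y) - (1/2) *\<^sub>R x" by simp
      have "norm (x - y) \<le> norm ((3/2) *\<^sub>R x - y) + norm ((1/2) *\<^sub>R x)"
        unfolding eq by (rule norm_triangle_ineq4)
      also have "\<dots> \<le> t" using y by (simp add: t_def)
      finally show "norm (x - y) \<le> t" .
      have "W * (2 * t) powr (- decay) \<le> W * norm y powr (- decay)"
        using W ann t decay_pos by (intro mult_left_mono powr_mono2') auto
      also have "\<dots> \<le> u y" using ann t by (intro lower) auto
      finally have "\<eta> \<le> u y powr p" unfolding \<eta>_def using W t p by (intro power_lower) auto
      then show "\<eta> \<le> v y" using ann t by (simp add: ext_power_def)
    qed (use \<eta> t alpha in \<open>auto simp: ext_power_nonneg\<close>)
    moreover have "\<eta> * t powr (- \<alpha>) * (unit_ball_vol (real DIM('a)) * (t / 2) ^ DIM('a))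
        = V * W powr p * t powr (real DIM('a) - \<alpha> - decay * p)"
    proof -
      have "t powr (real DIM('a) - \<alpha> - decay * p) = t powr (- (decay * p)) * t powr (- \<alpha>) * t ^ DIM('a)"
      proof -
        have "real DIM('a) - \<alpha> - decay * p = - (decay * p) + - \<alpha> + real DIM('a)" by simp
        then show ?thesis using t by (simp only: powr_add) (simp add: powr_realpow)
      qed
      then show ?thesis by (simp add: \<eta>_def V_def powr_mult power_divide)
    qed
    ultimately have R: "V * W powr p * t powr (real DIM('a) - \<alpha> - decay * p) \<le> riesz \<alpha> v x" by simp
    have U: "W powr q * t powr (- (decay * q)) \<le> ext_power q u x"
    proof -
      have "W powr q * t powr (- (decay * q)) \<le> u x powr q"
        using lower[of x] t W q unfolding t_def by (intro power_lower) auto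
      then show ?thesis using t by (simp add: ext_power_def t_def)
    qed
    have "t powr (- real DIM('a)) \<le> t powr (real DIM('a) - \<alpha> - decay * p + - (decay * q))"
      using le t by (intro powr_mono) (auto simp: algebra_simps)
    then have "V * W powr (p + q) * t powr (- real DIM('a))
        \<le> V * W powr (p + q) * t powr (real DIM('a) - \<alpha> - decay * p + - (decay * q))"
      using V by (intro mult_left_mono) auto
    also have "\<dots> = (V * W powr p * t powr (real DIM('a) - \<alpha> - decay * p)) * (W powr q * t powr (- (decay * q)))"
      by (simp only: powr_add mult_ac)
    also have "\<dots> \<le> riesz \<alpha> v x * ext_power q u x"
      using R U V by (intro mult_mono riesz_nonneg) auto
    finally have "V * W powr (p + q) * t powr (- real DIM('a)) \<le> F x" by (simp only: F_def)
    moreover have "t powr (- real DIM('a)) = 1 / t ^ DIM('a)"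
      using t by (simp add: powr_minus_divide powr_realpow)
    ultimately show "V * W powr (p + q) / norm x ^ DIM('a) \<le> F x" by (simp add: t_def)
  qed (rule V)
qed

end

section \<open>Rotation invariance, bounds and continuity of Riesz potentials\<close>

lemma nn_integral_lborel_translate:
  fixes F :: "'a::euclidean_space \<Rightarrow> ennreal"
  assumes [measurable]: "F \<in> borel_measurable borel"
  shows "(\<integral>\<^sup>+x. F (c + x) \<partial>lborel) = (\<integral>\<^sup>+x. F x \<partial>lborel)"
proof -
  have "(\<integral>\<^sup>+x. F x \<partial>lborel) = (\<integral>\<^sup>+x. F x \<partial>distr lborel borel ((+) c))"
    by (simp only: lborel_distr_plus)
  also have "\<dots> = (\<integral>\<^sup>+x. F (c + x) \<partial>lborel)"
    by (subst nn_integral_distr) auto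
  finally show ?thesis by simp
qed

lemma nn_integral_lborel_reflect:
  fixes F :: "'a::euclidean_space \<Rightarrow> ennreal"
  assumes [measurable]: "F \<in> borel_measurable borel"
  shows "(\<integral>\<^sup>+x. F (c - x) \<partial>lborel) = (\<integral>\<^sup>+x. F x \<partial>lborel)"
proof -
  have "(\<integral>\<^sup>+x. F x \<partial>lborel) = (\<integral>\<^sup>+x. F x \<partial>distr lborel borel (\<lambda>x. c - x))"
    by (simp only: lborel_eq_reflect[of c, symmetric])
  also have "\<dots> = (\<integral>\<^sup>+x. F (c - x) \<partial>lborel)"
    by (subst nn_integral_distr) auto
  finally show ?thesis by simp
qed

text \<open>The uniqueness proof for translation invariant measures: averaging over translates by vectors
  of the unit ball, which \<open>f\<close> maps to itself.\<close>

lemma lborel_involutive_isometry: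
  fixes f :: "'a::euclidean_space \<Rightarrow> 'a"
  assumes lin: "linear f" and iso: "\<And>x. norm (f x) = norm x" and inv: "\<And>x. f (f x) = x"
  shows "distr lborel borel f = lborel"
proof (rule measure_eqI)
  have [measurable]: "f \<in> borel_measurable borel"
    using lin by (intro borel_measurable_continuous_onI linear_continuous_on linear_conv_bounded_linear[THEN iffD1])
  have [measurable]: "ball (0::'a) 1 \<in> sets borel" by simp
  fix A :: "'a set" assume "A \<in> sets (distr lborel borel f)"
  then have A [measurable]: "A \<in> sets borel" by simp
  let ?B = "ball (0::'a) 1"
  define h :: "'a \<Rightarrow> ennreal" where "h = indicator A"
  define V where "V = emeasure lborel ?B"
  have h [measurable]: "h \<in> borel_measurable borel" unfolding h_def by measurable
  have vol: "\<not> unit_ball_vol (real DIM('a)) \<le> 0"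
    using unit_ball_vol_pos[OF of_nat_0_le_iff, of "DIM('a)"] by linarith
  have V: "V \<noteq> 0" "V \<noteq> \<infinity>"
    by (auto simp: V_def emeasure_ball ennreal_eq_0_iff vol)
  have fB: "indicator ?B (z - f x) = (indicator ?B (f z - x) :: ennreal)" for x z
  proof -
    have "f (z - f x) = f z - x" using lin by (simp add: linear_diff inv)
    then have "norm (z - f x) = norm (f z - x)" using iso[of "z - f x"] by simp
    then show ?thesis by (simp add: indicator_def)
  qed
  have VB: "(\<integral>\<^sup>+x. indicator ?B (c - x) \<partial>lborel) = V" for c
    by (subst nn_integral_lborel_reflect) (auto simp: V_def)
  have "V * (\<integral>\<^sup>+x. h (f x) \<partial>lborel) = (\<integral>\<^sup>+y. indicator ?B y * (\<integral>\<^sup>+x. h (f x) \<partial>lborel) \<partial>lborel)"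
    by (subst nn_integral_multc) (auto simp: V_def)
  also have "\<dots> = (\<integral>\<^sup>+y. (\<integral>\<^sup>+x. indicator ?B y * h (f x + y) \<partial>lborel) \<partial>lborel)"
  proof (rule nn_integral_cong)
    fix y :: 'a
    have "(\<integral>\<^sup>+x. h (f x) \<partial>lborel) = (\<integral>\<^sup>+x. h (f (f y + x)) \<partial>lborel)"
      by (rule nn_integral_lborel_translate[symmetric]) measurable
    also have "\<dots> = (\<integral>\<^sup>+x. h (f x + y) \<partial>lborel)"
      using lin by (simp add: linear_add inv add.commute)
    finally show "indicator ?B y * (\<integral>\<^sup>+x. h (f x) \<partial>lborel) = (\<integral>\<^sup>+x. indicator ?B y * h (f x + y) \<partial>lborel)"
      by (simp add: nn_integral_cmult)
  qed
  also have "\<dots> = (\<integral>\<^sup>+x. (\<integral>\<^sup>+y. indicator ?B y * h (f x + y) \<partial>lborel) \<partial>lborel)"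
    by (rule lborel_pair.Fubini') measurable
  also have "\<dots> = (\<integral>\<^sup>+x. (\<integral>\<^sup>+z. indicator ?B (f z - x) * h z \<partial>lborel) \<partial>lborel)"
  proof (rule nn_integral_cong)
    fix x :: 'a
    have "(\<integral>\<^sup>+y. indicator ?B y * h (f x + y) \<partial>lborel) = (\<integral>\<^sup>+y. indicator ?B ((f x + y) - f x) * h (f x + y) \<partial>lborel)"
      by simp
    also have "\<dots> = (\<integral>\<^sup>+z. indicator ?B (z - f x) * h z \<partial>lborel)"
      by (rule nn_integral_lborel_translate[where F = "\<lambda>z. indicator ?B (z - f x) * h z"]) measurable
    finally show "(\<integral>\<^sup>+y. indicator ?B y * h (f x + y) \<partial>lborel) = (\<integral>\<^sup>+z. indicator ?B (f z - x) * h z \<partial>lborel)"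
      by (simp only: fB)
  qed
  also have "\<dots> = (\<integral>\<^sup>+z. (\<integral>\<^sup>+x. indicator ?B (f z - x) * h z \<partial>lborel) \<partial>lborel)"
    by (rule lborel_pair.Fubini') measurable
  also have "\<dots> = (\<integral>\<^sup>+z. V * h z \<partial>lborel)"
    by (intro nn_integral_cong) (subst nn_integral_multc, auto simp: VB)
  also have "\<dots> = V * (\<integral>\<^sup>+z. h z \<partial>lborel)"
    by (rule nn_integral_cmult) measurable
  finally have "V * (\<integral>\<^sup>+x. h (f x) \<partial>lborel) = V * (\<integral>\<^sup>+z. h z \<partial>lborel)" .
  then have "(\<integral>\<^sup>+x. h (f x) \<partial>lborel) = (\<integral>\<^sup>+z. h z \<partial>lborel)"
    using V by (simp add: ennreal_mult_cancel_left)
  moreover have "(\<integral>\<^sup>+x. h (f x) \<partial>lborel) = (\<integral>\<^sup>+x. h x \<partial>distr lborel borel f)"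
    by (subst nn_integral_distr) auto
  ultimately show "emeasure (distr lborel borel f) A = emeasure lborel A"
    by (simp add: h_def)
qed simp

text \<open>The reflection in the hyperplane orthogonal to x - y exchanges x and y. It is an
  involution, as \<open>lborel_involutive_isometry\<close> requires.\<close>

lemma reflection_exists:
  fixes x y :: "'a::euclidean_space"
  assumes "norm x = norm y"
  obtains f where "linear f" "\<And>z. norm (f z) = norm z" "\<And>z. f (f z) = z" "f x = y"
proof (cases "x = y")
  case True
  then show ?thesis using that[of "\<lambda>z. z"] by (simp add: linear_id[unfolded id_def])
next
  case False
  define e where "e = (x - y) /\<^sub>R norm (x - y)"
  have ee: "e \<bullet> e = 1"
    using False by (simp add: e_def dot_square_norm power2_eq_square)
  define f where "f z = z - (2 * (z \<bullet> e)) *\<^sub>R e" for z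
  have fe: "f z \<bullet> e = - (z \<bullet> e)" for z by (simp add: f_def inner_diff_left ee)
  show ?thesis
  proof
    show "linear f" by (rule linearI) (simp_all add: f_def inner_add_left algebra_simps)
    show "norm (f z) = norm z" for z
    proof -
      have "f z \<bullet> f z = z \<bullet> z"
        by (simp add: f_def inner_diff_left inner_diff_right ee inner_commute algebra_simps)
      then show ?thesis by (simp add: norm_eq_sqrt_inner)
    qed
    show "f (f z) = z" for z
      unfolding f_def[of "f z"] fe by (simp add: f_def)
    have "x \<bullet> x = y \<bullet> y" using assms by (simp add: norm_eq)
    then have "(x - y) \<bullet> (x - y) = 2 * (x \<bullet> (x - y))"
      by (simp add: inner_diff_left inner_diff_right inner_commute)
    then have "2 * (x \<bullet> (x - y)) = norm (x - y) * norm (x - y)" by (simp add: dot_square_norm power2_eq_square)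
    moreover have "x \<bullet> e = (x \<bullet> (x - y)) / norm (x - y)"
      unfolding e_def inner_scaleR_right divide_inverse by (rule mult.commute)
    ultimately have "2 * (x \<bullet> e) = norm (x - y)" using False by simp
    then have "(2 * (x \<bullet> e)) *\<^sub>R e = x - y"
      using False by (simp add: e_def)
    then show "f x = y" by (simp add: f_def)
  qed
qed

lemma riesz_radial:
  fixes v :: "'a::euclidean_space \<Rightarrow> real"
  assumes [measurable]: "v \<in> borel_measurable borel" and rad: "\<And>y z. norm y = norm z \<Longrightarrow> v y = v z"
    and "norm x = norm x'"
  shows "riesz \<alpha> v x = riesz \<alpha> v x'"
proof -
  obtain f where f: "linear f" "\<And>z. norm (f z) = norm z" "\<And>z. f (f z) = z" "f x = x'"
    using reflection_exists[OF assms(3)] by metis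
  have [measurable]: "f \<in> borel_measurable borel"
    using f(1) by (intro borel_measurable_continuous_onI linear_continuous_on linear_conv_bounded_linear[THEN iffD1])
  have "riesz \<alpha> v x' = (LINT y|distr lborel borel f. v y / norm (x' - y) powr \<alpha>)"
    unfolding riesz_def by (simp only: lborel_involutive_isometry[OF f(1-3)])
  also have "\<dots> = (LINT y|lborel. v (f y) / norm (x' - f y) powr \<alpha>)"
    by (subst integral_distr) auto
  also have "\<dots> = (LINT y|lborel. v y / norm (x - y) powr \<alpha>)"
  proof (rule Bochner_Integration.integral_cong[OF refl])
    fix y
    have "norm (x' - f y) = norm (x - y)"
      using f(2)[of "x - y"] f(1) f(4) by (simp add: linear_diff)
    then show "v (f y) / norm (x' - f y) powr \<alpha> = v y / norm (x - y) powr \<alpha>"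
      using rad[OF f(2)[of y]] by simp
  qed
  finally show ?thesis by (simp add: riesz_def)
qed

section \<open>Riesz potentials of powers\<close>

lemma integrable_scaleR_cancel:
  fixes f :: "'a::euclidean_space \<Rightarrow> real"
  assumes [measurable]: "f \<in> borel_measurable borel" and "0 < c" and int: "integrable lborel (\<lambda>x. f (c *\<^sub>R x))"
  shows "integrable lborel f"
proof -
  have "integrable (distr lborel borel (\<lambda>x. 0 + c *\<^sub>R x)) f"
    using int by (subst integrable_distr_eq) auto
  then have "integrable (distr lborel borel (\<lambda>x. 0 + c *\<^sub>R x)) (\<lambda>x. \<bar>c\<bar> ^ DIM('a) * f x)"
    by (rule integrable_mult_right)
  then have "integrable (density (distr lborel borel (\<lambda>x. 0 + c *\<^sub>R x)) (\<lambda>_. ennreal (\<bar>c\<bar> ^ DIM('a)))) f"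
    by (subst integrable_density) auto
  moreover have "density (distr lborel borel (\<lambda>x::'a. 0 + c *\<^sub>R x)) (\<lambda>_. ennreal (\<bar>c\<bar> ^ DIM('a))) = lborel"
    by (rule lborel_affine[symmetric]) (use \<open>0 < c\<close> in simp)
  ultimately show ?thesis by simp
qed

lemma norm_powr_integral_scaled:
  fixes A :: "'a::euclidean_space set"
  assumes "0 < \<rho>" and [measurable]: "A \<in> sets borel"
    and int: "integrable lborel (\<lambda>z. indicator A z * norm z powr (- a))"
  shows "integrable lborel (\<lambda>z. indicator A (z /\<^sub>R \<rho>) * norm z powr (- a))"
    and "(LINT z|lborel. indicator A (z /\<^sub>R \<rho>) * norm z powr (- a))
      = \<rho> powr (real DIM('a) - a) * (LINT z|lborel. indicator A z * norm z powr (- a))"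
proof -
  let ?f = "\<lambda>z. indicator A (z /\<^sub>R \<rho>) * norm z powr (- a)"
  have f [measurable]: "?f \<in> borel_measurable borel" by measurable
  have eq: "?f (\<rho> *\<^sub>R z) = \<rho> powr (- a) * (indicator A z * norm z powr (- a))" for z
    using assms(1) by (simp add: powr_mult)
  have "integrable lborel (\<lambda>z. ?f (\<rho> *\<^sub>R z))"
    unfolding eq using int by (rule integrable_mult_right)
  then show "integrable lborel ?f"
    by (rule integrable_scaleR_cancel[OF f assms(1)])
  have "(LINT z|lborel. ?f z) = \<rho> ^ DIM('a) * (LINT z|lborel. ?f (\<rho> *\<^sub>R z))"
    by (rule lborel_integral_scaleR[OF f assms(1)])
  also have "\<dots> = \<rho> ^ DIM('a) * (\<rho> powr (- a) * (LINT z|lborel. indicator A z * norm z powr (- a)))"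
    unfolding eq by simp
  also have "\<rho> ^ DIM('a) * (\<rho> powr (- a) * I) = \<rho> powr (real DIM('a) - a) * I" for I
    using assms(1) by (simp add: powr_diff powr_minus powr_realpow field_simps)
  finally show "(LINT z|lborel. ?f z) = \<rho> powr (real DIM('a) - a) * (LINT z|lborel. indicator A z * norm z powr (- a))" .
qed

text \<open>Split at \<rho> = |x| / 2. Near 0 the kernel is at most \<rho>^(-\<alpha>), near x the
  power is at most \<rho>^(-P), and elsewhere the product is at most |z|^(-\<alpha>-P) for z the
  shorter of y and x - y. P < N, \<alpha> < N and \<alpha> + P > N make the respective integrals
  finite, and scaling gives each of them the same power of \<rho>.\<close>

lemma riesz_of_power:
  fixes \<alpha> P :: real
  assumes \<alpha>: "0 < \<alpha>" "\<alpha> < real DIM('a)" and P: "0 < P" "P < real DIM('a)" "real DIM('a) < \<alpha> + P"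
  obtains C where "0 \<le> C"
    "\<And>x::'a::euclidean_space. x \<noteq> 0 \<Longrightarrow> integrable lborel (\<lambda>y. norm y powr (- P) / norm (x - y) powr \<alpha>)"
    "\<And>x::'a. x \<noteq> 0 \<Longrightarrow> (LINT y|lborel. norm y powr (- P) / norm (x - y) powr \<alpha>)
        \<le> C * norm x powr (real DIM('a) - \<alpha> - P)"
proof -
  let ?B = "ball (0::'a) 1" and ?N = "real DIM('a)"
  have B [measurable]: "?B \<in> sets borel" "- ?B \<in> sets borel" by (simp, rule borel_comp, simp)
  define J where "J S a = (LINT z|lborel. indicator S z * norm z powr (- a))" for S :: "'a set" and a
  have J_nonneg: "0 \<le> J S a" for S a
    unfolding J_def by (rule Bochner_Integration.integral_nonneg) simp
  define C0 where "C0 = J ?B P + J ?B \<alpha> + 2 * J (- ?B) (\<alpha> + P)"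
  have key: "integrable lborel (\<lambda>y. norm y powr (- P) / norm (x - y) powr \<alpha>) \<and>
      (LINT y|lborel. norm y powr (- P) / norm (x - y) powr \<alpha>) \<le> C0 * (norm x / 2) powr (?N - \<alpha> - P)"
    if "x \<noteq> 0" for x :: 'a
  proof -
    define \<rho> where "\<rho> = norm x / 2"
    have \<rho>: "0 < \<rho>" using that by (simp add: \<rho>_def)
    define I where "I S a z = indicator S (z /\<^sub>R \<rho>) * norm z powr (- a)" for S :: "'a set" and a z
    have int: "integrable lborel (I ?B P)" "integrable lborel (I ?B \<alpha>)" "integrable lborel (I (- ?B) (\<alpha> + P))"
      unfolding I_def using \<rho> P \<alpha>
      by (intro norm_powr_integral_scaled(1) B integrable_norm_powr_cball integrable_norm_powr_outside; simp)+
    have val: "(LINT z|lborel. I ?B P z) = \<rho> powr (?N - P) * J ?B P"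
        "(LINT z|lborel. I ?B \<alpha> z) = \<rho> powr (?N - \<alpha>) * J ?B \<alpha>"
        "(LINT z|lborel. I (- ?B) (\<alpha> + P) z) = \<rho> powr (?N - (\<alpha> + P)) * J (- ?B) (\<alpha> + P)"
      unfolding I_def J_def using \<rho> P \<alpha>
      by (intro norm_powr_integral_scaled(2) B integrable_norm_powr_cball integrable_norm_powr_outside; simp)+
    have I_nonneg: "0 \<le> I S a z" for S a z by (simp add: I_def)
    have inB: "z /\<^sub>R \<rho> \<in> ?B \<longleftrightarrow> norm z < \<rho>" for z :: 'a
      using \<rho> by (simp add: inverse_eq_divide divide_less_eq)
    let ?U = "\<lambda>y. \<rho> powr (- \<alpha>) * I ?B P y + \<rho> powr (- P) * I ?B \<alpha> (x - y) + I (- ?B) (\<alpha> + P) y + I (- ?B) (\<alpha> + P) (x - y)"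
    have bound: "norm y powr (- P) / norm (x - y) powr \<alpha> \<le> ?U y" for y
    proof -
      have nn: "0 \<le> \<rho> powr (- \<alpha>) * I ?B P y" "0 \<le> \<rho> powr (- P) * I ?B \<alpha> (x - y)"
        "0 \<le> I (- ?B) (\<alpha> + P) y" "0 \<le> I (- ?B) (\<alpha> + P) (x - y)"
        by (auto intro!: mult_nonneg_nonneg I_nonneg)
      have eq: "norm y powr (- P) / norm (x - y) powr \<alpha> = norm y powr (- P) * norm (x - y) powr (- \<alpha>)"
        by (simp add: powr_minus_divide)
      have tri: "2 * \<rho> \<le> norm y + norm (x - y)"
        using norm_triangle_ineq[of y "x - y"] by (simp add: \<rho>_def)
      consider "norm y < \<rho>" | "norm (x - y) < \<rho>" | "\<rho> \<le> norm y" "norm y \<le> norm (x - y)"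
        | "\<rho> \<le> norm (x - y)" "norm (x - y) \<le> norm y"
        by linarith
      then show ?thesis
      proof cases
        case 1
        then have "norm (x - y) powr (- \<alpha>) \<le> \<rho> powr (- \<alpha>)"
          using tri \<rho> \<alpha> by (intro powr_mono2') auto
        then have "norm y powr (- P) * norm (x - y) powr (- \<alpha>) \<le> \<rho> powr (- \<alpha>) * I ?B P y"
          using 1 inB[of y] by (simp add: I_def mult.commute[of _ "norm y powr - P"] mult_left_mono)
        then show ?thesis unfolding eq using nn by linarith
      next
        case 2
        then have "norm y powr (- P) \<le> \<rho> powr (- P)"
          using tri \<rho> P by (intro powr_mono2') auto
        then have "norm y powr (- P) * norm (x - y) powr (- \<alpha>) \<le> \<rho> powr (- P) * I ?B \<alpha> (x - y)"
          using 2 inB[of "x - y"] by (simp add: I_def mult_right_mono)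
        then show ?thesis unfolding eq using nn by linarith
      next
        case 3
        then have "norm (x - y) powr (- \<alpha>) \<le> norm y powr (- \<alpha>)"
          using \<rho> \<alpha> by (intro powr_mono2') auto
        then have "norm y powr (- P) * norm (x - y) powr (- \<alpha>) \<le> norm y powr (- P) * norm y powr (- \<alpha>)"
          by (intro mult_left_mono) auto
        also have "\<dots> = I (- ?B) (\<alpha> + P) y"
        proof -
          have "y /\<^sub>R \<rho> \<in> - ?B" using 3 inB[of y] by simp
          then show ?thesis by (simp add: I_def powr_add[symmetric] add.commute)
        qed
        finally show ?thesis unfolding eq using nn by linarith
      next
        case 4
        then have "norm y powr (- P) \<le> norm (x - y) powr (- P)"
          using \<rho> P by (intro powr_mono2') auto
        then have "norm y powr (- P) * norm (x - y) powr (- \<alpha>) \<le> norm (x - y) powr (- P) * norm (x - y) powr (- \<alpha>)"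
          by (intro mult_right_mono) auto
        also have "\<dots> = I (- ?B) (\<alpha> + P) (x - y)"
        proof -
          have "(x - y) /\<^sub>R \<rho> \<in> - ?B" using 4 inB[of "x - y"] by simp
          then show ?thesis by (simp add: I_def powr_add[symmetric] add.commute)
        qed
        finally show ?thesis unfolding eq using nn by linarith
      qed
    qed
    have intU: "integrable lborel ?U"
      by (intro Bochner_Integration.integrable_add integrable_mult_right integrable_reflect int)
    have intK: "integrable lborel (\<lambda>y. norm y powr (- P) / norm (x - y) powr \<alpha>)"
    proof (rule Bochner_Integration.integrable_bound[OF intU])
      show "(\<lambda>y. norm y powr (- P) / norm (x - y) powr \<alpha>) \<in> borel_measurable lborel" by measurable
      show "AE y in lborel. norm (norm y powr (- P) / norm (x - y) powr \<alpha>) \<le> norm (?U y)"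
        by (intro always_eventually allI norm_le_of_nonneg bound) simp
    qed
    have refl: "(LINT y|lborel. I S a (x - y)) = (LINT y|lborel. I S a y)" if "integrable lborel (I S a)" for S a
      by (rule lborel_integral_reflect[symmetric]) (use borel_measurable_integrable[OF that] in simp)
    have "(LINT y|lborel. norm y powr (- P) / norm (x - y) powr \<alpha>) \<le> (LINT y|lborel. ?U y)"
      by (rule Bochner_Integration.integral_mono[OF intK intU bound])
    also have "\<dots> = \<rho> powr (- \<alpha>) * (LINT y|lborel. I ?B P y) + \<rho> powr (- P) * (LINT y|lborel. I ?B \<alpha> (x - y))
        + (LINT y|lborel. I (- ?B) (\<alpha> + P) y) + (LINT y|lborel. I (- ?B) (\<alpha> + P) (x - y))"
      by (simp add: Bochner_Integration.integral_add Bochner_Integration.integrable_add integrable_reflect int)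
    also have "\<dots> = C0 * \<rho> powr (?N - \<alpha> - P)"
    proof -
      have "\<rho> powr (- \<alpha>) * \<rho> powr (?N - P) = \<rho> powr (?N - \<alpha> - P)" "\<rho> powr (- P) * \<rho> powr (?N - \<alpha>) = \<rho> powr (?N - \<alpha> - P)"
        by (simp_all add: powr_add[symmetric] algebra_simps)
      then have e: "\<rho> powr (- \<alpha>) * (\<rho> powr (?N - P) * X) = \<rho> powr (?N - \<alpha> - P) * X"
        "\<rho> powr (- P) * (\<rho> powr (?N - \<alpha>) * X) = \<rho> powr (?N - \<alpha> - P) * X" for X
        by (simp_all add: mult.assoc[symmetric])
      show ?thesis
        unfolding refl[OF int(2)] refl[OF int(3)] val e C0_def by (simp add: algebra_simps)
    qed
    finally show ?thesis using intK by (simp add: \<rho>_def)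
  qed
  show ?thesis
  proof
    show "0 \<le> C0 * 2 powr (\<alpha> + P - ?N)"
      unfolding C0_def by (intro mult_nonneg_nonneg add_nonneg_nonneg J_nonneg) auto
    fix x :: 'a assume x: "x \<noteq> 0"
    show "integrable lborel (\<lambda>y. norm y powr (- P) / norm (x - y) powr \<alpha>)" using key[OF x] by simp
    have "(norm x / 2) powr (?N - \<alpha> - P) = 2 powr (\<alpha> + P - ?N) * norm x powr (?N - \<alpha> - P)"
      by (simp add: powr_divide powr_diff powr_add field_simps)
    then show "(LINT y|lborel. norm y powr (- P) / norm (x - y) powr \<alpha>)
        \<le> C0 * 2 powr (\<alpha> + P - ?N) * norm x powr (?N - \<alpha> - P)"
      using key[OF x] by (simp add: mult.assoc)
  qed
qed

text \<open>Reflection moves the variable from the singular kernel into v, so dominated convergence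
  applies with a fixed kernel. The integrands converge for almost every z, because v can jump only
  across the unit sphere.\<close>

lemma riesz_continuous:
  fixes v :: "'a::euclidean_space \<Rightarrow> real"
  assumes v [measurable]: "v \<in> borel_measurable borel" and v_nonneg: "\<And>y. 0 \<le> v y"
    and bd: "\<And>y. 1 \<le> norm y \<Longrightarrow> v y \<le> B * norm y powr (- P)" and zero: "\<And>y. norm y \<le> 1 \<Longrightarrow> v y = 0"
    and cont: "continuous_on (- cball 0 1) v"
    and \<alpha>: "0 < \<alpha>" "\<alpha> < real DIM('a)" and P: "0 < P" "real DIM('a) < \<alpha> + P" and "0 \<le> B"
  shows "continuous_on UNIV (riesz \<alpha> v)"
proof -
  have "isCont (riesz \<alpha> v) x" for x
    unfolding continuous_at_sequentially comp_def
  proof (intro allI impI)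
    fix X assume X: "X \<longlonglongrightarrow> x"
    then obtain R0 where R0: "\<And>n. norm (X n) \<le> R0"
      using convergent_imp_Bseq[of X] by (auto simp: convergent_def Bseq_def)
    define R where "R = max 1 R0"
    have R: "1 \<le> R" "\<And>n. norm (X n) \<le> R" using R0 by (auto simp: R_def le_max_iff_disj)
    have riesz_eq: "riesz \<alpha> v y = (LINT z|lborel. v (y - z) / norm z powr \<alpha>)" for y
    proof -
      have "riesz \<alpha> v y = (LINT z|lborel. v (y - z) / norm (y - (y - z)) powr \<alpha>)"
        unfolding riesz_def by (rule lborel_integral_reflect) measurable
      then show ?thesis by simp
    qed
    \<comment> \<open>Near 0 the bound v \<le> B suffices. For |z| \<ge> 1 and |y| \<le> R, v(y - z)
      is at most B (2 R)^P |z|^(-P): if |z| \<ge> 2 R because |y - z| \<ge> |z| / 2, otherwise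
      because (2 R / |z|)^P \<ge> 1.\<close>
    let ?D = "\<lambda>z::'a. B * (indicator (ball 0 1) z * norm z powr (- \<alpha>))
      + B * (2 * R) powr P * (indicator (- ball 0 1) z * norm z powr (- (\<alpha> + P)))"
    have "(\<lambda>n. (LINT z|lborel. v (X n - z) / norm z powr \<alpha>)) \<longlonglongrightarrow> (LINT z|lborel. v (x - z) / norm z powr \<alpha>)"
    proof (rule integral_dominated_convergence[where w = ?D])
      show "integrable lborel ?D"
        using \<alpha> P by (intro Bochner_Integration.integrable_add integrable_mult_right
            integrable_norm_powr_cball integrable_norm_powr_outside) auto
      have "AE z in lborel. norm (x - z) \<noteq> 1"
      proof -
        have "AE z in distr lborel borel (\<lambda>z. x - z). norm (z::'a) \<noteq> 1"
          using AE_not_unit_sphere by (simp only: lborel_eq_reflect[of x, symmetric])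
        then show ?thesis by (subst (asm) AE_distr_iff) auto
      qed
      then show "AE z in lborel. (\<lambda>n. v (X n - z) / norm z powr \<alpha>) \<longlonglongrightarrow> v (x - z) / norm z powr \<alpha>"
      proof eventually_elim
        case (elim z)
        have Xz: "(\<lambda>n. X n - z) \<longlonglongrightarrow> x - z" by (intro tendsto_intros X)
        have "(\<lambda>n. v (X n - z)) \<longlonglongrightarrow> v (x - z)"
        proof (cases "norm (x - z) < 1")
          case True
          then have "\<forall>\<^sub>F n in sequentially. norm (X n - z) < 1"
            using order_tendstoD(2)[OF tendsto_norm[OF Xz]] by blast
          then have "\<forall>\<^sub>F n in sequentially. v (x - z) = v (X n - z)"
            by eventually_elim (use True zero in simp)
          then show ?thesis by (rule Lim_transform_eventually[OF tendsto_const])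
        next
          case False
          then have "x - z \<in> - cball 0 1" using elim by simp
          moreover have "open (- cball (0::'a) 1)" by (intro open_Compl closed_cball)
          ultimately have "isCont v (x - z)" using cont continuous_on_eq_continuous_at by blast
          then show ?thesis by (rule isCont_tendsto_compose[OF _ Xz])
        qed
        then show ?case
          by (cases "z = 0") (auto intro!: tendsto_divide)
      qed
      show "AE z in lborel. norm (v (X n - z) / norm z powr \<alpha>) \<le> ?D z" for n
      proof (intro always_eventually allI)
        fix z :: 'a
        have vB: "v y \<le> B" for y
        proof (cases "1 \<le> norm y")
          case True
          have "y \<noteq> 0" using True by auto
          then have "norm y powr (- P) \<le> 1" using powr_mono[of "- P" 0 "norm y"] True P by simp
          then have "B * norm y powr (- P) \<le> B * 1" using \<open>0 \<le> B\<close> by (intro mult_left_mono)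
          then show ?thesis using bd[OF True] by simp
        qed (use zero \<open>0 \<le> B\<close> in simp)
        have norm_eq: "norm (v (X n - z) / norm z powr \<alpha>) = v (X n - z) * norm z powr (- \<alpha>)"
          using v_nonneg[of "X n - z"] by (simp add: powr_minus_divide)
        show "norm (v (X n - z) / norm z powr \<alpha>) \<le> ?D z"
        proof (cases "norm z < 1")
          case True
          have "v (X n - z) * norm z powr (- \<alpha>) \<le> B * norm z powr (- \<alpha>)"
            by (intro mult_right_mono vB) auto
          then show ?thesis using True unfolding norm_eq by simp
        next
          case False
          have "v (X n - z) \<le> B * ((2 * R) powr P * norm z powr (- P))"
          proof (cases "2 * R \<le> norm z")
            case True
            have "norm z / 2 \<le> norm (X n - z)"
              using norm_triangle_ineq2[of z "X n"] R(2)[of n] True by (simp add: norm_minus_commute)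
            moreover have ge1: "1 \<le> norm (X n - z)" using calculation True R by linarith
            ultimately have "norm (X n - z) powr (- P) \<le> (norm z / 2) powr (- P)"
              using False P by (intro powr_mono2') auto
            also have "\<dots> = 2 powr P * norm z powr (- P)"
              by (simp add: powr_divide powr_minus field_simps)
            also have "\<dots> \<le> (2 * R) powr P * norm z powr (- P)"
              using R P by (intro mult_right_mono powr_mono2) auto
            finally have "B * norm (X n - z) powr (- P) \<le> B * ((2 * R) powr P * norm z powr (- P))"
              using \<open>0 \<le> B\<close> by (intro mult_left_mono)
            then show ?thesis using bd[OF ge1] by linarith
          next
            case False2: False
            have "(2 * R) powr (- P) \<le> norm z powr (- P)" using False False2 P by (intro powr_mono2') auto
            then have "(2 * R) powr P * (2 * R) powr (- P) \<le> (2 * R) powr P * norm z powr (- P)"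
              by (intro mult_left_mono) auto
            then have "1 \<le> (2 * R) powr P * norm z powr (- P)"
              using R by (simp add: powr_add[symmetric])
            then have "B * 1 \<le> B * ((2 * R) powr P * norm z powr (- P))" using \<open>0 \<le> B\<close> by (intro mult_left_mono)
            then show ?thesis using vB[of "X n - z"] by simp
          qed
          then have "v (X n - z) * norm z powr (- \<alpha>) \<le> B * ((2 * R) powr P * norm z powr (- P)) * norm z powr (- \<alpha>)"
            by (intro mult_right_mono) auto
          also have "\<dots> = B * (2 * R) powr P * norm z powr (- (\<alpha> + P))"
            by (simp add: powr_add[symmetric] mult.assoc) (simp add: minus_diff_commute[of P \<alpha>])
          finally show ?thesis using False unfolding norm_eq by simp
        qed
      qed
    qed measurable
    then show "(\<lambda>n. riesz \<alpha> v (X n)) \<longlonglongrightarrow> riesz \<alpha> v x" by (simp only: riesz_eq)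
  qed
  then show ?thesis by (simp add: continuous_at_imp_continuous_on)
qed

section \<open>Radial solutions by monotone iteration\<close>

lemma powr_tail:
  fixes b t :: real
  assumes "0 < b" "0 < t"
  shows "integrable lborel (\<lambda>r. if t \<le> r then r powr (- 1 - b) else 0)"
    and "(LINT r|lborel. (if t \<le> r then r powr (- 1 - b) else 0)) = t powr (- b) / b"
proof -
  have "((\<lambda>r. r powr (- 1 - b)) has_integral - (t powr (- 1 - b + 1)) / (- 1 - b + 1)) {t..}"
    using assms by (intro has_integral_powr_to_inf) auto
  then have "((\<lambda>r. if r \<in> {t..} then r powr (- 1 - b) else 0) has_integral - (t powr (- 1 - b + 1)) / (- 1 - b + 1)) UNIV"
    by (simp only: has_integral_restrict_UNIV)
  then have I: "((\<lambda>r. if t \<le> r then r powr (- 1 - b) else 0) has_integral t powr (- b) / b) UNIV"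
    by simp
  have nn: "(\<integral>\<^sup>+r. ennreal (if t \<le> r then r powr (- 1 - b) else 0) \<partial>lborel) = ennreal (t powr (- b) / b)"
    by (rule nn_integral_has_integral_lborel[OF _ _ I]) auto
  show int: "integrable lborel (\<lambda>r. if t \<le> r then r powr (- 1 - b) else 0)"
    by (rule integrableI_nonneg) (auto simp: nn)
  show "(LINT r|lborel. (if t \<le> r then r powr (- 1 - b) else 0)) = t powr (- b) / b"
    by (subst integral_eq_nn_integral) (use assms in \<open>auto simp: nn\<close>)
qed

text \<open>\<beta> is the decay exponent and P \<le> \<beta> p the weakened exponent for u^p.
  \<kappa> is the surplus that makes the flux density \<tau>^(N-1) \<open>src\<close> of order
  \<tau>^(-1-\<kappa>), hence integrable. \<open>small\<close> keeps the total flux below (\<beta>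
  \<delta>)^(s-1), the value from which \<open>Psi_upper\<close> and integration recover the bound
  \<delta> t^(-\<beta>).\<close>

locale radial_iteration = flux_profile a s for a :: "real \<Rightarrow> real" and s :: real +
  fixes e :: "'a::euclidean_space" and N :: nat and \<alpha> p q \<beta> P \<kappa> C \<delta> \<epsilon> :: real
  assumes N_eq: "N = DIM('a)" and e: "norm e = 1" and N_ge: "2 \<le> N"
    and alpha: "0 < \<alpha>" "\<alpha> < real N" and pq: "0 < p" "0 < q"
    and beta: "0 < \<beta>" "(real N - 1) / (s - 1) = 1 + \<beta>"
    and P: "0 < P" "P < real N" "real N < \<alpha> + P" "P \<le> \<beta> * p"
    and kappa: "\<kappa> = \<alpha> + P + \<beta> * q - 2 * real N" "0 < \<kappa>"
    and C: "0 \<le> C"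
      "\<And>x::'a. x \<noteq> 0 \<Longrightarrow> integrable lborel (\<lambda>y. norm y powr (- P) / norm (x - y) powr \<alpha>)"
      "\<And>x::'a. x \<noteq> 0 \<Longrightarrow> (LINT y|lborel. norm y powr (- P) / norm (x - y) powr \<alpha>) \<le> C * norm x powr (real N - \<alpha> - P)"
    and delta: "0 < \<delta>" and eps: "0 < \<epsilon>"
    and small: "\<epsilon> + C * \<delta> powr (p + q) / \<kappa> \<le> (\<beta> * \<delta>) powr (s - 1)"
begin

definition vU :: "(real \<Rightarrow> real) \<Rightarrow> 'a \<Rightarrow> real" where
  "vU U = ext_power p (\<lambda>y. U (norm y))"

text \<open>The potential is evaluated along the ray through e; as \<open>vU U\<close> is radial,
  this represents every direction.\<close>

definition src :: "(real \<Rightarrow> real) \<Rightarrow> real \<Rightarrow> real" where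
  "src U \<tau> = riesz \<alpha> (vU U) (\<tau> *\<^sub>R e) * U \<tau> powr q"

definition flx :: "(real \<Rightarrow> real) \<Rightarrow> real \<Rightarrow> real" where
  "flx U r = \<epsilon> + (LINT \<tau>|lborel. (if 1 \<le> \<tau> \<and> \<tau> \<le> r then \<tau> ^ (N - 1) * src U \<tau> else 0))"

text \<open>The cutoff 1 \<le> r makes T U constant for t \<le> 1, so its bound at 1 also controls
  it there.\<close>

definition T :: "(real \<Rightarrow> real) \<Rightarrow> real \<Rightarrow> real" where
  "T U t = (LINT r|lborel. (if 1 \<le> r \<and> t \<le> r then Psi (flx U r / r ^ (N - 1)) else 0))"

definition adm :: "(real \<Rightarrow> real) \<Rightarrow> bool" where
  "adm U \<longleftrightarrow> U \<in> borel_measurable borel \<and> (\<forall>t. 0 \<le> U t) \<and> (\<forall>t\<ge>1. U t \<le> \<delta> * t powr (- \<beta>))"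

lemma admD:
  assumes "adm U"
  shows "U \<in> borel_measurable borel" "0 \<le> U t" "1 \<le> t \<Longrightarrow> U t \<le> \<delta> * t powr (- \<beta>)"
  using assms by (auto simp: adm_def)

lemma vU_nonneg: "0 \<le> vU U y"
  by (simp add: vU_def ext_power_nonneg)

lemma vU_measurable [measurable]:
  assumes "adm U" shows "vU U \<in> borel_measurable borel"
proof -
  have [measurable]: "U \<in> borel_measurable borel" using assms by (rule admD)
  have [measurable]: "- cball (0::'a) 1 \<in> sets borel" by (intro borel_comp) simp
  show ?thesis unfolding vU_def ext_power_def[abs_def] by measurable
qed

lemma vU_bound:
  assumes "adm U" shows "vU U y \<le> \<delta> powr p * norm y powr (- P)"
proof (cases "norm y \<le> 1")
  case False
  have "U (norm y) powr p \<le> (\<delta> * norm y powr (- \<beta>)) powr p"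
    using admD[OF assms] False pq by (intro powr_mono2) auto
  also have "\<dots> = \<delta> powr p * norm y powr (- (\<beta> * p))"
    by (simp add: powr_mult powr_powr)
  also have "\<dots> \<le> \<delta> powr p * norm y powr (- P)"
    using False P by (intro mult_left_mono powr_mono) auto
  finally show ?thesis using False by (simp add: vU_def ext_power_def)
qed (simp add: vU_def ext_power_def)

lemma riesz_vU:
  assumes U: "adm U" and x: "1 \<le> norm x"
  shows "integrable lborel (\<lambda>y. vU U y / norm (x - y) powr \<alpha>)"
    and "riesz \<alpha> (vU U) x \<le> \<delta> powr p * C * norm x powr (real N - \<alpha> - P)"
    and "0 \<le> riesz \<alpha> (vU U) x"
proof -
  have x0: "x \<noteq> 0" using x by auto
  let ?D = "\<lambda>y. \<delta> powr p * (norm y powr (- P) / norm (x - y) powr \<alpha>)"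
  have intD: "integrable lborel ?D" by (intro integrable_mult_right C(2) x0)
  have le: "vU U y / norm (x - y) powr \<alpha> \<le> ?D y" for y
    using vU_bound[OF U, of y] by (simp add: divide_right_mono)
  have nn: "0 \<le> vU U y / norm (x - y) powr \<alpha>" for y by (simp add: vU_nonneg)
  have [measurable]: "vU U \<in> borel_measurable borel" by (rule vU_measurable[OF U])
  show int: "integrable lborel (\<lambda>y. vU U y / norm (x - y) powr \<alpha>)"
  proof (rule Bochner_Integration.integrable_bound[OF intD])
    show "(\<lambda>y. vU U y / norm (x - y) powr \<alpha>) \<in> borel_measurable lborel" by measurable
  qed (intro always_eventually allI norm_le_of_nonneg le nn)
  have "riesz \<alpha> (vU U) x \<le> (LINT y|lborel. ?D y)"
    unfolding riesz_def by (rule Bochner_Integration.integral_mono[OF int intD le])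
  also have "\<dots> = \<delta> powr p * (LINT y|lborel. norm y powr (- P) / norm (x - y) powr \<alpha>)"
    by (rule integral_mult_right_zero)
  also have "\<dots> \<le> \<delta> powr p * (C * norm x powr (real N - \<alpha> - P))"
    by (intro mult_left_mono C(3) x0) auto
  finally show "riesz \<alpha> (vU U) x \<le> \<delta> powr p * C * norm x powr (real N - \<alpha> - P)" by (simp add: mult.assoc)
  show "0 \<le> riesz \<alpha> (vU U) x"
    unfolding riesz_def by (rule Bochner_Integration.integral_nonneg) (rule nn)
qed

lemma norm_e [simp]: "norm e = 1"
  by (rule e)

lemma src_measurable [measurable]:
  assumes U: "adm U" shows "src U \<in> borel_measurable borel"
proof -
  have [measurable]: "U \<in> borel_measurable borel" using U by (rule admD)
  have [measurable]: "riesz \<alpha> (vU U) \<in> borel_measurable borel" by (rule riesz_measurable[OF vU_measurable[OF U]])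
  show ?thesis unfolding src_def[abs_def] by measurable
qed

lemma src_bound:
  assumes U: "adm U" and \<tau>: "1 \<le> \<tau>"
  shows "0 \<le> \<tau> ^ (N - 1) * src U \<tau>" "\<tau> ^ (N - 1) * src U \<tau> \<le> C * \<delta> powr (p + q) * \<tau> powr (- 1 - \<kappa>)"
proof -
  have n: "1 \<le> norm (\<tau> *\<^sub>R e)" using \<tau> by simp
  have R: "0 \<le> riesz \<alpha> (vU U) (\<tau> *\<^sub>R e)" "riesz \<alpha> (vU U) (\<tau> *\<^sub>R e) \<le> \<delta> powr p * C * \<tau> powr (real N - \<alpha> - P)"
    using riesz_vU(2,3)[OF U n] \<tau> by simp_all
  then show "0 \<le> \<tau> ^ (N - 1) * src U \<tau>" using \<tau> by (simp add: src_def)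
  have "U \<tau> powr q \<le> (\<delta> * \<tau> powr (- \<beta>)) powr q"
    using admD[OF U] \<tau> pq by (intro powr_mono2) auto
  then have Uq: "U \<tau> powr q \<le> \<delta> powr q * \<tau> powr (- (\<beta> * q))"
    by (simp add: powr_mult powr_powr)
  have "src U \<tau> \<le> (\<delta> powr p * C * \<tau> powr (real N - \<alpha> - P)) * (\<delta> powr q * \<tau> powr (- (\<beta> * q)))"
    unfolding src_def using R Uq C(1) by (intro mult_mono) auto
  then have "\<tau> ^ (N - 1) * src U \<tau> \<le> \<tau> powr (real N - 1) * ((\<delta> powr p * C * \<tau> powr (real N - \<alpha> - P)) * (\<delta> powr q * \<tau> powr (- (\<beta> * q))))"
    using \<tau> N_ge by (simp add: powr_realpow[symmetric] of_nat_diff mult_left_mono)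
  also have "\<dots> = C * (\<delta> powr p * \<delta> powr q) * (\<tau> powr (real N - 1) * \<tau> powr (real N - \<alpha> - P) * \<tau> powr (- (\<beta> * q)))"
    by (simp only: mult_ac)
  \<comment> \<open>The exponents add up to -1 - \<kappa>; this is the definition of
    \<kappa>.\<close>
  also have "\<tau> powr (real N - 1) * \<tau> powr (real N - \<alpha> - P) * \<tau> powr (- (\<beta> * q)) = \<tau> powr (- 1 - \<kappa>)"
    unfolding powr_add[symmetric] by (rule arg_cong[where f = "\<lambda>z. \<tau> powr z"]) (simp add: kappa)
  finally show "\<tau> ^ (N - 1) * src U \<tau> \<le> C * \<delta> powr (p + q) * \<tau> powr (- 1 - \<kappa>)"
    by (simp add: powr_add)
qed

abbreviation "srcdom \<tau> \<equiv> C * \<delta> powr (p + q) * (if 1 \<le> \<tau> then \<tau> powr (- 1 - \<kappa>) else 0)"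

lemma src_le_dom:
  assumes U: "adm U"
  shows "0 \<le> (if 1 \<le> \<tau> \<and> \<tau> \<le> r then \<tau> ^ (N - 1) * src U \<tau> else 0)"
    "(if 1 \<le> \<tau> \<and> \<tau> \<le> r then \<tau> ^ (N - 1) * src U \<tau> else 0) \<le> srcdom \<tau>"
  using src_bound[OF U, of \<tau>] C(1) by auto

lemma src_dom_integrable: "integrable lborel srcdom"
  using powr_tail(1)[of \<kappa> 1] kappa by (intro integrable_mult_right) auto

lemma src_integrable:
  assumes U: "adm U"
  shows "integrable lborel (\<lambda>\<tau>. if 1 \<le> \<tau> \<and> \<tau> \<le> r then \<tau> ^ (N - 1) * src U \<tau> else 0)"
proof (rule Bochner_Integration.integrable_bound[OF src_dom_integrable])
  have [measurable]: "src U \<in> borel_measurable borel" by (rule src_measurable[OF U])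
  show "(\<lambda>\<tau>. if 1 \<le> \<tau> \<and> \<tau> \<le> r then \<tau> ^ (N - 1) * src U \<tau> else 0) \<in> borel_measurable lborel" by measurable
qed (intro always_eventually allI norm_le_of_nonneg src_le_dom U)

lemma flx_bounds:
  assumes U: "adm U"
  shows "\<epsilon> \<le> flx U r" "flx U r \<le> (\<beta> * \<delta>) powr (s - 1)"
proof -
  show "\<epsilon> \<le> flx U r"
    unfolding flx_def using Bochner_Integration.integral_nonneg[OF src_le_dom(1)[OF U]] by simp
  have "(LINT \<tau>|lborel. (if 1 \<le> \<tau> \<and> \<tau> \<le> r then \<tau> ^ (N - 1) * src U \<tau> else 0)) \<le> (LINT \<tau>|lborel. srcdom \<tau>)"
    by (rule Bochner_Integration.integral_mono[OF src_integrable[OF U] src_dom_integrable src_le_dom(2)[OF U]])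
  also have "\<dots> = C * \<delta> powr (p + q) / \<kappa>"
    using powr_tail(2)[of \<kappa> 1] kappa by simp
  finally show "flx U r \<le> (\<beta> * \<delta>) powr (s - 1)" unfolding flx_def using small by linarith
qed

lemma flx_measurable [measurable]:
  assumes U: "adm U" shows "flx U \<in> borel_measurable borel"
proof -
  have [measurable]: "src U \<in> borel_measurable borel" by (rule src_measurable[OF U])
  show ?thesis unfolding flx_def[abs_def] by measurable
qed

lemma Psi_flx:
  assumes U: "adm U" and r: "1 \<le> r"
  shows "0 < Psi (flx U r / r ^ (N - 1))" "Psi (flx U r / r ^ (N - 1)) \<le> \<beta> * \<delta> * r powr (- 1 - \<beta>)"
proof -
  have f: "0 < flx U r" using flx_bounds(1)[OF U] eps by (rule less_le_trans[rotated])
  then show "0 < Psi (flx U r / r ^ (N - 1))" using r by simp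
  have "Psi (flx U r / r ^ (N - 1)) \<le> (flx U r / r ^ (N - 1)) powr (1 / (s - 1))"
    using f r by (intro Psi_upper) auto
  also have "\<dots> \<le> ((\<beta> * \<delta>) powr (s - 1) / r ^ (N - 1)) powr (1 / (s - 1))"
    using f r flx_bounds(2)[OF U] s_gt_1 by (intro powr_mono2 divide_right_mono) auto
  also have "\<dots> = \<beta> * \<delta> / (r ^ (N - 1)) powr (1 / (s - 1))"
    using beta delta s_gt_1 by (simp add: powr_divide powr_powr)
  also have "(r ^ (N - 1)) powr (1 / (s - 1)) = r powr (1 + \<beta>)"
    using r N_ge beta(2) by (simp add: powr_realpow[symmetric] powr_powr of_nat_diff)
  also have "\<beta> * \<delta> / r powr (1 + \<beta>) = \<beta> * \<delta> * r powr (- 1 - \<beta>)"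
    using powr_minus_divide[of r "1 + \<beta>"] by simp
  finally show "Psi (flx U r / r ^ (N - 1)) \<le> \<beta> * \<delta> * r powr (- 1 - \<beta>)" .
qed

abbreviation "Tint U t r \<equiv> (if 1 \<le> r \<and> t \<le> r then Psi (flx U r / r ^ (N - 1)) else 0)"
abbreviation "Tdom t r \<equiv> \<beta> * \<delta> * (if max 1 t \<le> r then r powr (- 1 - \<beta>) else 0)"

lemma Tint_le_dom:
  assumes U: "adm U" shows "0 \<le> Tint U t r" "Tint U t r \<le> Tdom t r"
  using Psi_flx[OF U, of r] by (auto simp: less_imp_le)

lemma Tdom_integrable: "integrable lborel (Tdom t)"
  using powr_tail(1)[of \<beta> "max 1 t"] beta by (intro integrable_mult_right) auto

lemma Tint_measurable:
  assumes U: "adm U" shows "Tint U t \<in> borel_measurable lborel"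
proof -
  have [measurable]: "flx U \<in> borel_measurable borel" by (rule flx_measurable[OF U])
  show ?thesis by measurable
qed

lemma Tint_integrable:
  assumes U: "adm U" shows "integrable lborel (Tint U t)"
  by (rule Bochner_Integration.integrable_bound[OF Tdom_integrable[of t] Tint_measurable[OF U]])
    (intro always_eventually allI norm_le_of_nonneg Tint_le_dom U)

lemma adm_T:
  assumes U: "adm U" shows "adm (T U)"
  unfolding adm_def
proof (intro conjI allI impI)
  have [measurable]: "flx U \<in> borel_measurable borel" by (rule flx_measurable[OF U])
  show "T U \<in> borel_measurable borel" unfolding T_def[abs_def] by measurable
  show "0 \<le> T U t" for t
    unfolding T_def by (rule Bochner_Integration.integral_nonneg) (rule Tint_le_dom[OF U])
  fix t :: real assume t: "1 \<le> t"
  have "T U t \<le> (LINT r|lborel. Tdom t r)"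
    unfolding T_def
    by (rule Bochner_Integration.integral_mono[OF Tint_integrable[OF U] Tdom_integrable Tint_le_dom(2)[OF U]])
  also have "\<dots> = \<delta> * t powr (- \<beta>)"
    using powr_tail(2)[of \<beta> t] beta t by (simp add: max_def)
  finally show "T U t \<le> \<delta> * t powr (- \<beta>)" .
qed

lemma T_mono:
  assumes U: "adm U" and V: "adm V" and le: "\<And>t. U t \<le> V t"
  shows "T U t \<le> T V t"
proof -
  have vle: "vU U y \<le> vU V y" for y
    unfolding vU_def ext_power_def using le admD(2)[OF U] pq by (intro mult_left_mono powr_mono2) auto
  have rle: "riesz \<alpha> (vU U) x \<le> riesz \<alpha> (vU V) x" if "1 \<le> norm x" for x
    unfolding riesz_def
    by (rule Bochner_Integration.integral_mono[OF riesz_vU(1)[OF U that] riesz_vU(1)[OF V that]])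
      (simp add: divide_right_mono vle)
  have sle: "src U \<tau> \<le> src V \<tau>" if "1 \<le> \<tau>" for \<tau>
    unfolding src_def using that le[of \<tau>] admD(2)[OF U] pq riesz_vU(3)[OF V, of "\<tau> *\<^sub>R e"]
    by (intro mult_mono rle powr_mono2) auto
  have fle: "flx U r \<le> flx V r" for r
    unfolding flx_def
    by (intro add_left_mono Bochner_Integration.integral_mono[OF src_integrable[OF U] src_integrable[OF V]])
      (auto intro!: mult_left_mono sle)
  show ?thesis
    unfolding T_def
    by (rule Bochner_Integration.integral_mono[OF Tint_integrable[OF U] Tint_integrable[OF V]])
      (auto intro!: divide_right_mono fle)
qed

section \<open>The iterates and their limit\<close>

definition iter :: "nat \<Rightarrow> real \<Rightarrow> real" where
  "iter n = (T ^^ n) (\<lambda>_. 0)"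

lemma iter_Suc: "iter (Suc n) = T (iter n)"
  by (simp add: iter_def)

lemma adm_iter: "adm (iter n)"
proof (induction n)
  case 0
  show ?case using delta by (auto simp: iter_def adm_def)
next
  case (Suc n)
  then show ?case by (simp add: iter_Suc adm_T)
qed

lemma iter_mono: "iter n t \<le> iter (Suc n) t"
proof (induction n arbitrary: t)
  case 0
  show ?case using admD(2)[OF adm_iter[of 1]] by (simp add: iter_def)
next
  case (Suc n)
  have "T (iter n) t \<le> T (iter (Suc n)) t"
    by (rule T_mono[OF adm_iter adm_iter Suc.IH])
  then show ?case by (simp add: iter_Suc)
qed

lemma T_below_1: "t \<le> 1 \<Longrightarrow> T U t = T U 1"
  unfolding T_def by (rule Bochner_Integration.integral_cong) auto

text \<open>A bound for every real t, not only t \<ge> 1, ensures that the supremum defining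
  \<open>U\<close> is a finite limit everywhere.\<close>

lemma iter_le: "iter n t \<le> \<delta>"
proof (cases n)
  case 0
  then show ?thesis using delta by (simp add: iter_def)
next
  case (Suc k)
  have "iter n t = iter n (max 1 t)"
    unfolding Suc iter_Suc using T_below_1[of t] by (auto simp: max_def)
  also have "\<dots> \<le> \<delta> * (max 1 t) powr (- \<beta>)" by (rule admD(3)[OF adm_iter]) simp
  also have "\<dots> \<le> \<delta> * 1"
  proof (intro mult_left_mono)
    have "(max 1 t) powr (- \<beta>) \<le> (max 1 t) powr 0" using beta by (intro powr_mono) auto
    also have "(max 1 t) powr 0 = 1" by (simp add: max_def)
    finally show "(max 1 t) powr (- \<beta>) \<le> 1" .
  qed (use delta in simp)
  finally show ?thesis by simp
qed

definition U :: "real \<Rightarrow> real" where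
  "U t = (SUP n. iter n t)"

lemma iter_tendsto: "(\<lambda>n. iter n t) \<longlonglongrightarrow> U t"
  unfolding U_def
  by (rule LIMSEQ_incseq_SUP) (auto intro!: bdd_aboveI[of _ \<delta>] incseq_SucI iter_mono iter_le)

lemma adm_U: "adm U"
  unfolding adm_def
proof (intro conjI allI impI)
  show "U \<in> borel_measurable borel"
    by (rule borel_measurable_LIMSEQ_real[OF iter_tendsto]) (rule admD(1)[OF adm_iter])
  show "0 \<le> U t" for t
    by (rule LIMSEQ_le_const[OF iter_tendsto]) (use admD(2)[OF adm_iter] in auto)
  show "U t \<le> \<delta> * t powr (- \<beta>)" if "1 \<le> t" for t
    by (rule LIMSEQ_le_const2[OF iter_tendsto]) (use admD(3)[OF adm_iter that] in auto)
qed

lemma iter_powr_tendsto: "0 < k \<Longrightarrow> (\<lambda>n. iter n t powr k) \<longlonglongrightarrow> U t powr k"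
  by (rule tendsto_powr'[OF iter_tendsto tendsto_const]) (use admD(2)[OF adm_iter] in auto)

lemma riesz_tendsto:
  assumes x: "1 \<le> norm x"
  shows "(\<lambda>n. riesz \<alpha> (vU (iter n)) x) \<longlonglongrightarrow> riesz \<alpha> (vU U) x"
  unfolding riesz_def
proof (rule integral_dominated_convergence[where w = "\<lambda>y. \<delta> powr p * (norm y powr (- P) / norm (x - y) powr \<alpha>)"])
  have "x \<noteq> 0" using x by auto
  then show "integrable lborel (\<lambda>y. \<delta> powr p * (norm y powr (- P) / norm (x - y) powr \<alpha>))"
    by (intro integrable_mult_right C(2))
  show "(\<lambda>y. vU U y / norm (x - y) powr \<alpha>) \<in> borel_measurable lborel"
    by (rule borel_measurable_integrable[OF riesz_vU(1)[OF adm_U x]])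
  show "(\<lambda>y. vU (iter n) y / norm (x - y) powr \<alpha>) \<in> borel_measurable lborel" for n
    by (rule borel_measurable_integrable[OF riesz_vU(1)[OF adm_iter x]])
  have "(\<lambda>n. vU (iter n) y) \<longlonglongrightarrow> vU U y" for y
    unfolding vU_def ext_power_def by (intro tendsto_mult tendsto_const iter_powr_tendsto pq)
  then show "AE y in lborel. (\<lambda>n. vU (iter n) y / norm (x - y) powr \<alpha>) \<longlonglongrightarrow> vU U y / norm (x - y) powr \<alpha>"
    by (simp add: divide_inverse tendsto_mult_right)
  show "AE y in lborel. norm (vU (iter n) y / norm (x - y) powr \<alpha>) \<le> \<delta> powr p * (norm y powr (- P) / norm (x - y) powr \<alpha>)" for n
    using vU_bound[OF adm_iter] vU_nonneg by (simp add: divide_right_mono abs_of_nonneg)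
qed

lemma flx_tendsto: "(\<lambda>n. flx (iter n) r) \<longlonglongrightarrow> flx U r"
  unfolding flx_def
proof (intro tendsto_add tendsto_const integral_dominated_convergence[where w = srcdom])
  show "integrable lborel srcdom" by (rule src_dom_integrable)
  have "(\<lambda>n. src (iter n) \<tau>) \<longlonglongrightarrow> src U \<tau>" if "1 \<le> \<tau>" for \<tau>
    unfolding src_def using that by (intro tendsto_mult riesz_tendsto iter_powr_tendsto pq) simp
  then show "AE \<tau> in lborel. (\<lambda>n. if 1 \<le> \<tau> \<and> \<tau> \<le> r then \<tau> ^ (N - 1) * src (iter n) \<tau> else 0)
      \<longlonglongrightarrow> (if 1 \<le> \<tau> \<and> \<tau> \<le> r then \<tau> ^ (N - 1) * src U \<tau> else 0)"
    by (intro always_eventually allI) (auto intro!: tendsto_mult_left)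
  show "AE \<tau> in lborel. norm (if 1 \<le> \<tau> \<and> \<tau> \<le> r then \<tau> ^ (N - 1) * src (iter n) \<tau> else 0) \<le> srcdom \<tau>" for n
    using src_le_dom[OF adm_iter, of _ r n] by (intro always_eventually allI) (simp only: real_norm_def abs_of_nonneg)
qed (rule borel_measurable_integrable[OF src_integrable[OF adm_U]]
    borel_measurable_integrable[OF src_integrable[OF adm_iter]])+

text \<open>Dominated convergence at the third level: it has already passed through the Riesz
  potential and the flux, and continuity of \<open>Psi\<close> carries the limit to the
  slope.\<close>

lemma T_fixed_point: "T U t = U t"
proof -
  have "(\<lambda>n. T (iter n) t) \<longlonglongrightarrow> T U t"
    unfolding T_def
  proof (rule integral_dominated_convergence[where w = "Tdom t"])
    have "(\<lambda>n. Psi (flx (iter n) r / r ^ (N - 1))) \<longlonglongrightarrow> Psi (flx U r / r ^ (N - 1))" if "1 \<le> r" for r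
      by (rule isCont_tendsto_compose[OF isCont_Psi]) (intro tendsto_divide flx_tendsto tendsto_const, use that in auto)
    then show "AE r in lborel. (\<lambda>n. Tint (iter n) t r) \<longlonglongrightarrow> Tint U t r"
      by (intro always_eventually allI) auto
    show "AE r in lborel. norm (Tint (iter n) t r) \<le> Tdom t r" for n
      using Tint_le_dom[OF adm_iter[of n], where t = t] by (intro always_eventually allI) (simp only: real_norm_def abs_of_nonneg)
  qed (intro Tdom_integrable Tint_measurable adm_U adm_iter)+
  then have "(\<lambda>n. iter (Suc n) t) \<longlonglongrightarrow> T U t" by (simp add: iter_Suc)
  moreover have "(\<lambda>n. iter (Suc n) t) \<longlonglongrightarrow> U t" by (rule LIMSEQ_Suc[OF iter_tendsto])
  ultimately show ?thesis by (rule LIMSEQ_unique)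
qed

end

section \<open>From the fixed point to a weak solution\<close>

context radial_iteration
begin

definition h :: "real \<Rightarrow> real" where "h \<tau> = \<tau> ^ (N - 1) * src U \<tau>"
definition \<psi> :: "real \<Rightarrow> real" where "\<psi> r = Psi (flx U r / r ^ (N - 1))"
definition u :: "'a \<Rightarrow> real" where "u x = U (norm x)"

lemma flx_eq_integral:
  "h integrable_on {1..r}" "flx U r = \<epsilon> + integral {1..r} h"
proof -
  have eq: "(\<lambda>\<tau>. if 1 \<le> \<tau> \<and> \<tau> \<le> r then \<tau> ^ (N - 1) * src U \<tau> else 0) = (\<lambda>\<tau>. indicator {1..r} \<tau> *\<^sub>R h \<tau>)"
    by (auto simp: h_def indicator_def)
  have int: "set_integrable lborel {1..r} h"
    using src_integrable[OF adm_U, of r] unfolding eq set_integrable_def .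
  show "h integrable_on {1..r}" by (rule set_borel_integral_eq_integral(1)[OF int])
  have "(LINT \<tau>:{1..r}|lborel. h \<tau>) = integral {1..r} h"
    by (rule set_borel_integral_eq_integral(2)[OF int])
  then show "flx U r = \<epsilon> + integral {1..r} h"
    unfolding flx_def eq set_lebesgue_integral_def by simp
qed

lemma flx_continuous: "continuous_on {1..b} (flx U)"
proof -
  have "continuous_on {1..b} (\<lambda>r. \<epsilon> + integral {1..r} h)"
    by (intro continuous_intros indefinite_integral_continuous_1 flx_eq_integral)
  then show ?thesis by (simp add: flx_eq_integral(2)[abs_def])
qed

lemma psi_continuous: "continuous_on {1..b} \<psi>"
  unfolding \<psi>_def by (intro continuous_intros flx_continuous) auto

lemma U_eq_integral:
  assumes "1 \<le> t" shows "U t = U 1 - integral {1..t} \<psi>"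
proof -
  have int: "set_integrable lborel {1..t} \<psi>"
    unfolding set_integrable_def by (rule borel_integrable_compact[OF _ psi_continuous]) simp
  have "integrable lborel (\<lambda>r. Tint U 1 r - Tint U t r)"
    by (intro Bochner_Integration.integrable_diff Tint_integrable adm_U)
  have "U 1 - U t = T U 1 - T U t" by (simp only: T_fixed_point)
  also have "\<dots> = (LINT r|lborel. Tint U 1 r - Tint U t r)"
    unfolding T_def by (rule Bochner_Integration.integral_diff[symmetric, OF Tint_integrable[OF adm_U] Tint_integrable[OF adm_U]])
  also have "\<dots> = (LINT r|lborel. indicator {1..t} r *\<^sub>R \<psi> r)"
  proof (rule integral_cong_AE)
    \<comment> \<open>At r = t the difference on the left is 0 while the right side is
      \<open>\<psi> t\<close>, so equality holds only off this point.\<close>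
    have "AE r in lborel. r \<noteq> t" by (rule AE_lborel_singleton)
    then show "AE r in lborel. Tint U 1 r - Tint U t r = indicator {1..t} r *\<^sub>R \<psi> r"
      by eventually_elim (use assms in \<open>auto simp: indicator_def \<psi>_def\<close>)
    show "(\<lambda>r. indicator {1..t} r *\<^sub>R \<psi> r) \<in> borel_measurable lborel"
      using int by (auto simp: set_integrable_def dest: borel_measurable_integrable)
  qed (rule borel_measurable_integrable, fact)
  also have "\<dots> = integral {1..t} \<psi>"
    using set_borel_integral_eq_integral(2)[OF int] by (simp add: set_lebesgue_integral_def)
  finally show ?thesis by simp
qed

lemma U_DERIV:
  assumes "1 < t" shows "(U has_real_derivative - \<psi> t) (at t)"
proof -
  have "((\<lambda>t. integral {1..t} \<psi>) has_real_derivative \<psi> t) (at t within {1..t + 1})"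
    by (rule integral_has_real_derivative[OF psi_continuous]) (use assms in auto)
  then have "((\<lambda>t. U 1 - integral {1..t} \<psi>) has_real_derivative - \<psi> t) (at t within {1..t + 1})"
    by (auto intro!: derivative_eq_intros)
  then have "((\<lambda>t. U 1 - integral {1..t} \<psi>) has_real_derivative - \<psi> t) (at t)"
    using assms by (simp add: at_within_Icc_at)
  then show ?thesis
  proof (rule has_field_derivative_transform_within_open[where S = "{1<..}"])
    fix x :: real assume "x \<in> {1<..}"
    then show "U 1 - integral {1..x} \<psi> = U x" by (intro U_eq_integral[symmetric]) simp
  qed (use assms in auto)
qed

lemma U_continuous: "continuous_on {1..b} U"
proof -
  have "continuous_on {1..b} (\<lambda>t. U 1 - integral {1..t} \<psi>)"
    by (intro continuous_intros indefinite_integral_continuous_1 integrable_continuous_interval psi_continuous)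
  moreover have "continuous_on {1..b} U \<longleftrightarrow> continuous_on {1..b} (\<lambda>t. U 1 - integral {1..t} \<psi>)"
    by (rule continuous_on_cong) (auto intro: U_eq_integral)
  ultimately show ?thesis by simp
qed

lemma U_isCont: "1 < t \<Longrightarrow> isCont U t"
  by (rule DERIV_isCont[OF U_DERIV])

lemma psi_pos: "1 \<le> t \<Longrightarrow> 0 < \<psi> t"
  unfolding \<psi>_def by (rule Psi_flx(1)[OF adm_U])

text \<open>The flux is at least \<epsilon> > 0, so U is strictly decreasing; being nonnegative
  farther out, it is positive here.\<close>

lemma U_pos:
  assumes t: "1 < t" shows "0 < U t"
proof -
  have "U (t + 1) < U t"
  proof (rule DERIV_neg_imp_decreasing[where f = U])
    fix x assume "t \<le> x" "x \<le> t + 1"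
    then show "\<exists>y. DERIV U x :> y \<and> y < 0"
      using U_DERIV[of x] psi_pos[of x] t by (intro exI[of _ "- \<psi> x"]) auto
  qed simp
  then show "0 < U t" using admD(2)[OF adm_U, of "t + 1"] by linarith
qed

lemma vU_eq: "vU U = ext_power p u"
  by (simp add: vU_def u_def[abs_def])

lemma u_continuous: "continuous_on (- cball 0 1) u"
proof (rule continuous_at_imp_continuous_on, rule ballI)
  fix x :: 'a assume "x \<in> - cball 0 1"
  then show "isCont u x" unfolding u_def[abs_def] by (intro isCont_o2[OF _ U_isCont] continuous_intros) auto
qed

lemma u_pos: "x \<in> - cball 0 1 \<Longrightarrow> 0 < u x"
  using U_pos[of "norm x"] by (simp add: u_def)

text \<open>Continuity of the source turns the integral defining the flux into a differentiable
  function with continuous derivative, as \<open>radial_field_weak\<close> demands.\<close>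

lemma riesz_vU_continuous: "continuous_on UNIV (riesz \<alpha> (vU U))"
proof (rule riesz_continuous[where P = P and B = "\<delta> powr p"])
  show "vU U \<in> borel_measurable borel" by (rule vU_measurable[OF adm_U])
  have "continuous_on (- cball 0 1) (\<lambda>y. u y powr p)"
    using u_pos by (intro continuous_intros u_continuous) (auto simp: less_imp_neq[symmetric])
  moreover have "continuous_on (- cball 0 1) (vU U) \<longleftrightarrow> continuous_on (- cball 0 1) (\<lambda>y. u y powr p)"
    by (rule continuous_on_cong) (auto simp: vU_eq ext_power_def)
  ultimately show "continuous_on (- cball 0 1) (vU U)" by simp
  show "vU U y = 0" if "norm y \<le> 1" for y using that by (simp add: vU_def ext_power_def)
qed (use vU_nonneg vU_bound[OF adm_U] alpha P N_eq in auto)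

lemma h_continuous: "continuous_on {1..b} h"
proof -
  have "continuous_on {1..b} (\<lambda>\<tau>. riesz \<alpha> (vU U) (\<tau> *\<^sub>R e))"
    by (rule continuous_on_compose2[OF riesz_vU_continuous]) (auto intro!: continuous_intros)
  moreover have "continuous_on {1..b} (\<lambda>\<tau>. U \<tau> powr q)"
    by (intro continuous_on_powr' U_continuous continuous_intros) (use pq admD(2)[OF adm_U] in auto)
  ultimately show ?thesis
    unfolding h_def src_def by (intro continuous_on_mult continuous_on_power continuous_on_id)
qed

lemma flx_DERIV:
  assumes "1 < t" shows "(flx U has_real_derivative h t) (at t)"
proof -
  have "((\<lambda>t. integral {1..t} h) has_real_derivative h t) (at t within {1..t + 1})"
    by (rule integral_has_real_derivative[OF h_continuous]) (use assms in auto)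
  then have "((\<lambda>t. \<epsilon> + integral {1..t} h) has_real_derivative h t) (at t within {1..t + 1})"
    by (auto intro!: derivative_eq_intros)
  then show ?thesis
    using assms by (simp add: at_within_Icc_at flx_eq_integral(2)[abs_def])
qed

lemma u_GDERIV:
  assumes "1 < norm x" shows "GDERIV u x :> - \<psi> (norm x) *\<^sub>R (x /\<^sub>R norm x)"
proof -
  have "x \<noteq> 0" using assms by auto
  then have "GDERIV norm x :> x /\<^sub>R norm x"
    using GDERIV_norm[of x] by (simp add: sgn_div_norm)
  then show ?thesis
    unfolding u_def[abs_def] by (rule GDERIV_DERIV_compose) (rule U_DERIV[OF assms])
qed

lemma psi_isCont: "1 < t \<Longrightarrow> isCont \<psi> t"
  using continuous_on_interior[OF psi_continuous[of "t + 1"], of t] by simp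

lemma u_C1: "C1_on (- cball 0 1) u"
proof (rule C1_onI)
  show "GDERIV u x :> - \<psi> (norm x) *\<^sub>R (x /\<^sub>R norm x)" if "x \<in> - cball 0 1" for x
    using that by (intro u_GDERIV) auto
  show "continuous_on (- cball 0 1) (\<lambda>x::'a. - \<psi> (norm x) *\<^sub>R (x /\<^sub>R norm x))"
  proof (rule continuous_at_imp_continuous_on, rule ballI)
    fix x :: 'a assume "x \<in> - cball 0 1"
    then have "1 < norm x" "x \<noteq> 0" by auto
    then show "isCont (\<lambda>x::'a. - \<psi> (norm x) *\<^sub>R (x /\<^sub>R norm x)) x"
      by (intro continuous_intros isCont_o2[OF _ psi_isCont]) auto
  qed
qed

lemma field_grad_u:
  assumes x: "1 < norm x" shows "field (grad u x) = - ((flx U (norm x) / norm x ^ N) *\<^sub>R x)"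
proof -
  have "norm x \<noteq> 0" using x by linarith
  then have "norm (x /\<^sub>R norm x) = 1" by simp
  then have "field (grad u x) = Phi (- \<psi> (norm x)) *\<^sub>R (x /\<^sub>R norm x)"
    unfolding grad_eqI[OF u_GDERIV[OF x]] by (rule field_scaleR_unit)
  also have "\<dots> = - ((flx U (norm x) / (norm x ^ (N - 1) * norm x)) *\<^sub>R x)"
    by (simp add: \<psi>_def divide_inverse)
  also have "norm x ^ (N - 1) * norm x = norm x ^ N"
    using N_ge by (metis Suc_diff_1 power_Suc2 pos2 order_less_le_trans)
  finally show ?thesis .
qed

lemma src_norm:
  assumes x: "1 < norm x" shows "h (norm x) / norm x ^ (N - 1) = riesz \<alpha> (ext_power p u) x * u x powr q"
proof -
  have "riesz \<alpha> (vU U) (norm x *\<^sub>R e) = riesz \<alpha> (vU U) x"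
    by (rule riesz_radial[OF vU_measurable[OF adm_U]]) (auto simp: vU_def ext_power_def indicator_def)
  then show ?thesis using x by (auto simp: h_def src_def u_def vU_eq[symmetric])
qed

text \<open>The field of grad u is radial with flux \<open>flx U\<close>, whose derivative is
  \<open>h\<close>. \<open>radial_field_weak\<close> moves the derivative off the test function, and
  \<open>src_norm\<close> identifies the result with the right side of the equation.\<close>

theorem radial_solution:
  assumes coeff: "\<And>t. 0 \<le> t \<Longrightarrow> a t = t powr (m - 2) * g t + t powr (s - 2)"
  shows "positive_C1_solution g m s \<alpha> p q u"
  unfolding positive_C1_solution_def
proof (intro conjI ballI allI impI)
  show "Ck_on 1 (- cball 0 1) u" using u_C1 by (simp only: Ck_on_1_iff_C1_on)
  show "0 < u x" if "x \<in> - cball 0 1" for x using that by (rule u_pos)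
  have ep [measurable]: "ext_power p u \<in> borel_measurable borel"
    using vU_measurable[OF adm_U] by (simp add: vU_eq)
  have rz [measurable]: "riesz \<alpha> (ext_power p u) \<in> borel_measurable borel"
    by (rule riesz_measurable[OF ep])
  have eq [measurable]: "ext_power q u \<in> borel_measurable borel"
    by (rule ext_power_measurable[OF u_continuous u_pos])
  show "set_integrable lebesgue (- ball 0 1) (\<lambda>y. u y powr p / (1 + norm y powr \<alpha>))"
    unfolding solution_integrable_iff[OF ep]
  proof (rule Bochner_Integration.integrable_bound)
    show "integrable lborel (\<lambda>y::'a. \<delta> powr p * (indicator (- ball 0 1) y * norm y powr (- (\<alpha> + P))))"
      using P N_eq by (intro integrable_mult_right integrable_norm_powr_outside) auto
    show "(\<lambda>y. ext_power p u y / (1 + norm y powr \<alpha>)) \<in> borel_measurable lborel" by measurable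
    have "ext_power p u y / (1 + norm y powr \<alpha>) \<le> \<delta> powr p * (indicator (- ball 0 1) y * norm y powr (- (\<alpha> + P)))" for y
    proof (cases "norm y \<le> 1")
      case False
      have "0 < norm y powr \<alpha>" using False by auto
      then have "ext_power p u y / (1 + norm y powr \<alpha>) \<le> (\<delta> powr p * norm y powr (- P)) / norm y powr \<alpha>"
        using vU_bound[OF adm_U, of y] by (intro frac_le) (auto simp: vU_eq)
      also have "\<dots> = \<delta> powr p * norm y powr (- (\<alpha> + P))"
      proof -
        have "- (\<alpha> + P) = - P - \<alpha>" by simp
        then show ?thesis by (simp only: powr_diff times_divide_eq_right)
      qed
      finally show ?thesis using False by simp
    qed (simp add: ext_power_def)
    then show "AE y in lborel. norm (ext_power p u y / (1 + norm y powr \<alpha>))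
        \<le> norm (\<delta> powr p * (indicator (- ball 0 1) y * norm y powr (- (\<alpha> + P))))"
      by (intro always_eventually allI norm_le_of_nonneg) (auto simp: ext_power_nonneg)
  qed
  fix \<phi> :: "'a \<Rightarrow> real" assume \<phi>: "test_function_on (- cball 0 1) \<phi>"
  define K where "K = closure {x. \<phi> x \<noteq> 0}"
  have K: "compact K" "K \<subseteq> - cball 0 1" using \<phi> by (auto simp: test_function_on_def K_def)
  have supp: "\<phi> x = 0" if "x \<notin> K" for x
    using that closure_subset[of "{x. \<phi> x \<noteq> 0}"] by (auto simp: K_def)
  have "Ck_on 1 UNIV \<phi>" using \<phi> unfolding test_function_on_def by blast
  then have C1: "C1_on UNIV \<phi>" by (simp only: Ck_on_1_iff_C1_on)
  have clK: "closed K" using K(1) by (rule compact_imp_closed)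
  have gz: "grad \<phi> x = 0" if "x \<notin> K" for x by (rule grad_zero_outside(2)[OF clK supp that])
  have outK: "x \<notin> K" if "norm x \<le> 1" for x using K(2) that by auto
  have [measurable]: "\<phi> \<in> borel_measurable borel"
    by (rule borel_measurable_continuous_onI[OF C1_on_continuous[OF C1]])
  obtain b where b: "\<And>x. x \<in> K \<Longrightarrow> norm x < b"
    using compact_imp_bounded[OF K(1)] unfolding bounded_pos_less by blast
  have KA: "K \<subseteq> {x. 1 < norm x \<and> norm x < b}" using K(2) b by auto
  have cont: "continuous_on UNIV (\<lambda>x. field (grad u x) \<bullet> grad \<phi> x)"
  proof (rule continuous_on_glue_zero[of "- cball 0 1" K])
    show "continuous_on (- cball 0 1) (\<lambda>x. field (grad u x) \<bullet> grad \<phi> x)"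
      using C1_on_continuous_grad[OF u_C1] C1_on_continuous_grad[OF C1]
      by (intro continuous_on_inner continuous_on_compose2[OF continuous_on_field[of UNIV]])
        (auto intro: continuous_on_subset)
  qed (use clK K(2) gz in auto)
  have "(LINT x:(- ball 0 1)|lebesgue.
           (norm (grad u x) powr (m - 2) * g (norm (grad u x)) + norm (grad u x) powr (s - 2))
             * (grad u x \<bullet> grad \<phi> x)) = (LINT x|lborel. field (grad u x) \<bullet> grad \<phi> x)"
    by (rule lebesgue_weak_form[OF borel_measurable_continuous_onI[OF cont]])
      (simp_all add: field_def coeff gz outK)
  also have "\<dots> = - (LINT x|lborel. flx U (norm x) / norm x ^ DIM('a) * (x \<bullet> grad \<phi> x))"
  proof -
    have "field (grad u x) \<bullet> grad \<phi> x = - (flx U (norm x) / norm x ^ DIM('a) * (x \<bullet> grad \<phi> x))" for x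
    proof (cases "x \<in> K")
      case True
      then have "1 < norm x" using KA by auto
      then show ?thesis by (simp add: field_grad_u flip: N_eq)
    qed (simp add: gz)
    then show ?thesis by simp
  qed
  also have "\<dots> = (LINT x|lborel. h (norm x) / norm x ^ (DIM('a) - 1) * \<phi> x)"
  proof -
    have "continuous_on {1<..<b} h"
      by (rule continuous_on_subset[OF h_continuous[of b]]) auto
    from radial_field_weak[OF zero_less_one flx_DERIV this C1 K(1) KA supp]
    show ?thesis by simp
  qed
  also have "\<dots> = (LINT x|lborel. riesz \<alpha> (ext_power p u) x * ext_power q u x * \<phi> x)"
  proof (rule Bochner_Integration.integral_cong[OF refl])
    fix x :: 'a
    show "h (norm x) / norm x ^ (DIM('a) - 1) * \<phi> x = riesz \<alpha> (ext_power p u) x * ext_power q u x * \<phi> x"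
    proof (cases "x \<in> K")
      case True
      then have "1 < norm x" using KA by auto
      then show ?thesis using src_norm[of x] by (simp add: ext_power_def flip: N_eq)
    qed (simp add: supp)
  qed
  also have "\<dots> = (LINT x:(- ball 0 1)|lebesgue.
             ext_conv \<alpha> (\<lambda>y. u y powr p) x * u x powr q * \<phi> x)"
  proof (rule lebesgue_weak_form[symmetric])
    show "(\<lambda>x. riesz \<alpha> (ext_power p u) x * ext_power q u x * \<phi> x) \<in> borel_measurable borel"
      by measurable
  qed (simp_all add: ext_conv_eq_riesz[OF ep] ext_power_def supp outK)
  finally show "(LINT x:(- ball 0 1)|lebesgue.
           (norm (grad u x) powr (m - 2) * g (norm (grad u x)) + norm (grad u x) powr (s - 2))
             * (grad u x \<bullet> grad \<phi> x))
        = (LINT x:(- ball 0 1)|lebesgue.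
             ext_conv \<alpha> (\<lambda>y. u y powr p) x * u x powr q * \<phi> x)" .
qed

end

section \<open>Choice of the constants and the equivalence\<close>

lemma solution_exists:
  fixes s \<alpha> p q :: real
  assumes prof: "flux_profile (\<lambda>t. t powr (m - 2) * g t + t powr (s - 2)) s"
    and s: "s < real DIM('a::euclidean_space)" and \<alpha>: "0 < \<alpha>" "\<alpha> < real DIM('a)" and pq: "0 < p" "0 < q" "s - 1 < p + q"
    and \<beta>: "\<beta> = (real DIM('a) - s) / (s - 1)"
    and cond: "real DIM('a) - \<alpha> < \<beta> * p" "real DIM('a) - \<alpha> < \<beta> * q" "2 * real DIM('a) - \<alpha> < \<beta> * (p + q)"
  shows "\<exists>u :: 'a \<Rightarrow> real. positive_C1_solution g m s \<alpha> p q u"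
proof -
  interpret flux_profile "\<lambda>t. t powr (m - 2) * g t + t powr (s - 2)" s by (rule prof)
  let ?N = "real DIM('a)"
  have \<beta>0: "0 < \<beta>" using s s_gt_1 by (simp add: \<beta>)
  \<comment> \<open>The midpoint between the lower bounds N - \<alpha>, 2N - \<alpha> - \<beta> q
    and the upper bounds N, \<beta> p. Each of the four comparisons of a lower with an upper bound
    is \<alpha> > 0 or one of the three conditions in \<open>cond\<close>.\<close>
  define P where "P = (max (?N - \<alpha>) (2 * ?N - \<alpha> - \<beta> * q) + min ?N (\<beta> * p)) / 2"
  have P: "?N - \<alpha> < P" "2 * ?N - \<alpha> - \<beta> * q < P" "P < ?N" "P \<le> \<beta> * p"
    using cond \<alpha> unfolding P_def by (auto simp: max_def min_def field_simps)
  have P0: "0 < P" using P(1) \<alpha> by linarith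
  obtain C where C: "0 \<le> C"
    "\<And>x::'a. x \<noteq> 0 \<Longrightarrow> integrable lborel (\<lambda>y. norm y powr (- P) / norm (x - y) powr \<alpha>)"
    "\<And>x::'a. x \<noteq> 0 \<Longrightarrow> (LINT y|lborel. norm y powr (- P) / norm (x - y) powr \<alpha>) \<le> C * norm x powr (?N - \<alpha> - P)"
    using riesz_of_power[OF \<alpha> P0 P(3)] P(1) by auto
  define \<kappa> where "\<kappa> = \<alpha> + P + \<beta> * q - 2 * ?N"
  have \<kappa>: "0 < \<kappa>" using P(2) by (simp add: \<kappa>_def)
  define w where "w = p + q - (s - 1)"
  have w: "0 < w" using pq by (simp add: w_def)
  \<comment> \<open>Solves (C + 1) \<delta>^(p+q) / \<kappa> = (\<beta> \<delta>)^(s-1) / 2,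
    possible because p + q > s - 1; C + 1 replaces C to allow C = 0. The source takes at most half
    of the admissible flux, and \<epsilon> is the other half.\<close>
  define \<delta> where "\<delta> = (\<beta> powr (s - 1) * \<kappa> / (2 * (C + 1))) powr (1 / w)"
  have \<delta>0: "0 < \<delta>" using \<beta>0 \<kappa> C(1) by (simp add: \<delta>_def)
  have \<delta>w: "\<delta> powr w = \<beta> powr (s - 1) * \<kappa> / (2 * (C + 1))"
    using \<beta>0 \<kappa> C(1) w by (simp add: \<delta>_def powr_powr)
  define \<epsilon> where "\<epsilon> = (\<beta> * \<delta>) powr (s - 1) / 2"
  have \<epsilon>0: "0 < \<epsilon>" using \<beta>0 \<delta>0 by (simp add: \<epsilon>_def)
  have "C * \<delta> powr (p + q) / \<kappa> \<le> (C + 1) * \<delta> powr (p + q) / \<kappa>"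
    using \<kappa> by (intro divide_right_mono mult_right_mono) auto
  also have "\<dots> = (C + 1) * (\<delta> powr w * \<delta> powr (s - 1)) / \<kappa>"
    by (simp add: powr_add[symmetric] w_def)
  also have "\<dots> = \<beta> powr (s - 1) * \<delta> powr (s - 1) / 2"
  proof -
    have cancel: "D * (x * k / (2 * D) * y) / k = x * y / 2" if "0 < D" "0 < k" for D k x y :: real
      using that by simp
    show ?thesis unfolding \<delta>w by (rule cancel) (use C(1) \<kappa> in auto)
  qed
  also have "\<dots> = \<epsilon>" by (simp add: \<epsilon>_def powr_mult)
  finally have "C * \<delta> powr (p + q) / \<kappa> \<le> \<epsilon>" .
  moreover have "(\<beta> * \<delta>) powr (s - 1) = 2 * \<epsilon>" by (simp add: \<epsilon>_def)
  ultimately have small: "\<epsilon> + C * \<delta> powr (p + q) / \<kappa> \<le> (\<beta> * \<delta>) powr (s - 1)" by linarith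
  obtain e :: 'a where e: "norm e = 1" using vector_choose_size[of 1] by auto
  have N2: "2 \<le> DIM('a)"
  proof -
    have "1 < ?N" using s s_gt_1 by linarith
    then show ?thesis by simp
  qed
  interpret radial_iteration "\<lambda>t. t powr (m - 2) * g t + t powr (s - 2)" s e "DIM('a)" \<alpha> p q \<beta> P \<kappa> C \<delta> \<epsilon>
  proof
    show "(?N - 1) / (s - 1) = 1 + \<beta>" using s_gt_1 by (simp add: \<beta> field_simps)
    show "?N < \<alpha> + P" using P(1) by simp
  qed (fact e N2 \<alpha> pq \<beta>0 P P0 \<kappa>_def \<kappa> C \<delta>0 \<epsilon>0 small refl)+
  show ?thesis using radial_solution[of m g] by auto
qed

lemma solution_exists_iff:
  fixes s \<alpha> p q :: real
  assumes prof: "flux_profile (\<lambda>t. t powr (m - 2) * g t + t powr (s - 2)) s"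
    and s: "s < real DIM('a::euclidean_space)" and \<alpha>: "0 < \<alpha>" "\<alpha> < real DIM('a)"
    and pq: "s - 1 < p" "s - 1 < q"
  shows "(\<exists>u :: 'a \<Rightarrow> real. positive_C1_solution g m s \<alpha> p q u) \<longleftrightarrow>
    min p q > (s - 1) * (real DIM('a) - \<alpha>) / (real DIM('a) - s) \<and>
    p + q > (s - 1) * (2 * real DIM('a) - \<alpha>) / (real DIM('a) - s)"
proof -
  interpret flux_profile "\<lambda>t. t powr (m - 2) * g t + t powr (s - 2)" s by (rule prof)
  define \<beta> where "\<beta> = (real DIM('a) - s) / (s - 1)"
  have less: "(s - 1) * X / (real DIM('a) - s) < r \<longleftrightarrow> X < \<beta> * r" for X r
    using s s_gt_1 by (simp add: \<beta>_def pos_divide_less_eq pos_less_divide_eq mult.commute)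
  have "(\<exists>u :: 'a \<Rightarrow> real. positive_C1_solution g m s \<alpha> p q u) \<longleftrightarrow>
    real DIM('a) - \<alpha> < \<beta> * p \<and> real DIM('a) - \<alpha> < \<beta> * q \<and> 2 * real DIM('a) - \<alpha> < \<beta> * (p + q)"
  proof
    assume "\<exists>u :: 'a \<Rightarrow> real. positive_C1_solution g m s \<alpha> p q u"
    then obtain u :: "'a \<Rightarrow> real" where u: "positive_C1_solution g m s \<alpha> p q u" by blast
    interpret exterior_solution g m s \<alpha> p q u
      by unfold_locales (use u \<alpha> s pq in auto)
    show "real DIM('a) - \<alpha> < \<beta> * p \<and> real DIM('a) - \<alpha> < \<beta> * q \<and> 2 * real DIM('a) - \<alpha> < \<beta> * (p + q)"
      using p_condition q_condition pq_condition by (simp add: \<beta>_def decay_def)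
  next
    assume "real DIM('a) - \<alpha> < \<beta> * p \<and> real DIM('a) - \<alpha> < \<beta> * q \<and> 2 * real DIM('a) - \<alpha> < \<beta> * (p + q)"
    then show "\<exists>u :: 'a \<Rightarrow> real. positive_C1_solution g m s \<alpha> p q u"
      using pq s_gt_1 by (intro solution_exists[OF prof s \<alpha> _ _ _ \<beta>_def]) auto
  qed
  then show ?thesis by (auto simp: less)
qed

theorem corollary1p4:
  fixes N :: nat and \<alpha> p q m s :: real
  assumes "N = CARD('n::finite)"
    and "0 < \<alpha>" and "\<alpha> < real N"
    and "p > 0" and "q > 0"
    and "m > s" and "s > 1" and "s < real N"
    and "q \<ge> \<alpha> - 1"
    and "min p q > m - 1"
  shows "((\<exists>u :: real ^ 'n \<Rightarrow> real. positive_C1_solution (\<lambda>t. 1) m s \<alpha> p q u)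
            \<longleftrightarrow> min p q > (s - 1) * (real N - \<alpha>) / (real N - s) \<and>
                p + q > (s - 1) * (2 * real N - \<alpha>) / (real N - s)) \<and>
         (m \<ge> 2 \<longrightarrow>
           ((\<exists>u :: real ^ 'n \<Rightarrow> real.
               positive_C1_solution (\<lambda>t. 1 / sqrt (1 + t powr m)) m s \<alpha> p q u)
            \<longleftrightarrow> min p q > (s - 1) * (real N - \<alpha>) / (real N - s) \<and>
                p + q > (s - 1) * (2 * real N - \<alpha>) / (real N - s)))"
proof -
  have N: "N = DIM(real ^ 'n)" using assms(1) by simp
  \<comment> \<open>From min p q > m - 1 > s - 1 both exponents are superlinear relative to the
    s-Laplacian.\<close>
  have dims: "s < real DIM(real ^ 'n)" "0 < \<alpha>" "\<alpha> < real DIM(real ^ 'n)" "s - 1 < p" "s - 1 < q"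
    using assms by auto
  show ?thesis
    unfolding N
    using solution_exists_iff[OF flux_profile_plain[OF assms(7,6)] dims]
      solution_exists_iff[OF flux_profile_sqrt[OF assms(7,6)] dims]
    by blast
qed

end
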